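(* For any real numbers $0\leq t_L\leq t_H\leq t_P\leq t_A\leq 1$, there exists a spectral measure $\mu$ on $\mathbb{R}$ such that $$\dim_L \mu=t_L,\quad \dim_H \mu=t_H,\quad \dim_P\mu=t_P\quad\text{and}\quad \dim_A\mu=t_A.$$
   Context: A compactly supported Borel probability measure $\mu$ on $\mathbb{R}^d$ is called a spectral measure if there is a countable set $\Lambda\subseteq\mathbb{R}^d$ such that $\{e^{-2\pi i\langle\lambda,x\rangle}:\lambda\in\Lambda\}$ is an orthonormal basis of $L^2(\mu)$. For a compactly supported Borel probability measure $\mu$ on $\mathbb{R}^d$, let $|\mathrm{supp}(\mu)|$ denote the diameter of its support and $B(x,r)$ the ball of center $x$ and radius $r$. The Assouad dimension $\dim_A\mu$ is the infimum of all $s\ge 0$ for which there exists a constant $C>0$ such that for all $0<r<R<|\mathrm{supp}(\mu)|$ and all $x\in\mathrm{supp}(\mu)$, $\frac{\mu(B(x,R))}{\mu(B(x,r))}\le C\left(\frac{R}{r}\right)^s$. The lower dimension $\dim_L\mu$ is the supremum of all $s\ge 0$ for which there exists a constant $C>0$ such that for all $0<r<R<|\mathrm{supp}(\mu)|$ and all $x\in\mathrm{supp}(\mu)$, $\frac{\mu(B(x,R))}{\mu(B(x,r))}\ge C\left(\frac{R}{r}\right)^s$. The Hausdorff dimension and packing dimension of the measure $\mu$ are $\dim_H\mu=\inf\{\dim_H E: E \text{ Borel},\ \mu(E)>0\}$ and $\dim_P\mu=\inf\{\dim_P E: E \text{ Borel},\ \mu(E)>0\}$, where $\dim_H E$ and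 $\dim_P E$ are the Hausdorff and packing dimensions of the set $E$. *)

theory Defs
  imports "HOL-Probability.Probability"
begin

section \<open>Compactly supported and spectral measures\<close>

definition msupport :: "'a::topological_space measure \<Rightarrow> 'a set" where
  "msupport M = {x. \<forall>U. open U \<longrightarrow> x \<in> U \<longrightarrow> emeasure M U > 0}"

definition compactly_supported_borel_prob :: "'a::euclidean_space measure \<Rightarrow> bool" where
  "compactly_supported_borel_prob M \<longleftrightarrow>
     prob_space M \<and> sets M = sets borel \<and> compact (msupport M)"

definition expo :: "'a::euclidean_space \<Rightarrow> 'a \<Rightarrow> complex" where
  "expo l x = exp (- (2 * complex_of_real pi * \<i> * complex_of_real (l \<bullet> x)))"

definition square_integrable :: "'a measure \<Rightarrow> ('a \<Rightarrow> complex) \<Rightarrow> bool" where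
  "square_integrable M f \<longleftrightarrow>
     f \<in> borel_measurable M \<and> integrable M (\<lambda>x. (cmod (f x))\<^sup>2)"

text \<open>An orthonormal basis of the Hilbert space \<open>L\<^sup>2(M)\<close> is an orthonormal family with dense
  linear span. The space is represented by its square-integrable functions rather than by their
  classes modulo equality almost everywhere; both conditions depend on the classes only.\<close>

definition orthonormal_basis_L2 :: "'a measure \<Rightarrow> 'i set \<Rightarrow> ('i \<Rightarrow> 'a \<Rightarrow> complex) \<Rightarrow> bool" where
  "orthonormal_basis_L2 M I e \<longleftrightarrow>
     (\<forall>i\<in>I. square_integrable M (e i)) \<and>
     (\<forall>i\<in>I. \<forall>j\<in>I. (\<integral>x. e i x * cnj (e j x) \<partial>M) = (if i = j then 1 else 0)) \<and>
     (\<forall>f. square_integrable M f \<longrightarrow>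
       (\<forall>\<epsilon>>0. \<exists>F c. finite F \<and> F \<subseteq> I \<and>
          sqrt (\<integral>x. (cmod (f x - (\<Sum>i\<in>F. c i * e i x)))\<^sup>2 \<partial>M) < \<epsilon>))"

definition spectral_measure :: "'a::euclidean_space measure \<Rightarrow> bool" where
  "spectral_measure M \<longleftrightarrow>
     compactly_supported_borel_prob M \<and>
     (\<exists>\<Lambda>. countable \<Lambda> \<and> orthonormal_basis_L2 M \<Lambda> expo)"

section \<open>Assouad and lower dimension of a measure\<close>

text \<open>Using closed balls instead of open ones gives the same admissible pairs of an exponent and
  a constant, because the inequalities are required for all radii \<open>r < R\<close> below the diameter.\<close>

definition assouad_dim :: "'a::euclidean_space measure \<Rightarrow> ereal" where
  "assouad_dim M = Inf (ereal ` {s. s \<ge> 0 \<and> (\<exists>C>0. \<forall>r R. \<forall>x\<in>msupport M.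
     0 < r \<longrightarrow> r < R \<longrightarrow> R < diameter (msupport M) \<longrightarrow>
     measure M (ball x R) / measure M (ball x r) \<le> C * (R / r) powr s)})"

definition lower_dim :: "'a::euclidean_space measure \<Rightarrow> ereal" where
  "lower_dim M = Sup (ereal ` {s. s \<ge> 0 \<and> (\<exists>C>0. \<forall>r R. \<forall>x\<in>msupport M.
     0 < r \<longrightarrow> r < R \<longrightarrow> R < diameter (msupport M) \<longrightarrow>
     measure M (ball x R) / measure M (ball x r) \<ge> C * (R / r) powr s)})"

section \<open>Hausdorff dimension\<close>

text \<open>The size \<open>|U|\<^sup>s\<close> of a covering set, with \<open>|U|\<^sup>0 = 1\<close> for all nonempty \<open>U\<close>. The case distinction
  is needed because \<open>0 powr 0 = 0\<close>.\<close>

definition cover_size :: "real \<Rightarrow> 'a::metric_space set \<Rightarrow> ennreal" where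
  "cover_size s U =
     (if U = {} then 0 else if s = 0 then 1 else ennreal (diameter U powr s))"

text \<open>Covering sets are explicitly bounded, as \<^const>\<open>diameter\<close> is unspecified on unbounded sets.
  Finite covers are included, since members of the sequence may be empty.\<close>

definition hausdorff_premeasure :: "real \<Rightarrow> real \<Rightarrow> 'a::metric_space set \<Rightarrow> ennreal" where
  "hausdorff_premeasure s \<delta> E =
     Inf {(\<Sum>n. cover_size s (U n)) |U :: nat \<Rightarrow> 'a set.
           E \<subseteq> (\<Union>n. U n) \<and> (\<forall>n. bounded (U n) \<and> diameter (U n) \<le> \<delta>)}"

definition hausdorff_measure :: "real \<Rightarrow> 'a::metric_space set \<Rightarrow> ennreal" where
  "hausdorff_measure s E = (SUP \<delta>\<in>{0<..}. hausdorff_premeasure s \<delta> E)"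

definition hausdorff_dim :: "'a::metric_space set \<Rightarrow> ereal" where
  "hausdorff_dim E = Inf (ereal ` {s. s \<ge> 0 \<and> hausdorff_measure s E = 0})"

definition measure_hausdorff_dim :: "'a::euclidean_space measure \<Rightarrow> ereal" where
  "measure_hausdorff_dim M = Inf {hausdorff_dim E |E. E \<in> sets borel \<and> emeasure M E > 0}"

section \<open>Packing dimension\<close>

text \<open>A \<open>\<delta>\<close>-packing of \<open>E\<close> is a countable family of pairwise disjoint closed balls with centres
  in \<open>E\<close> and radii at most \<open>\<delta>\<close>, given by its set of pairs of a centre and a radius.\<close>

definition packing :: "real \<Rightarrow> 'a::metric_space set \<Rightarrow> ('a \<times> real) set \<Rightarrow> bool" where
  "packing \<delta> E P \<longleftrightarrow>
     countable P \<and> (\<forall>(x, r)\<in>P. x \<in> E \<and> 0 < r \<and> r \<le> \<delta>) \<and>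
     disjoint_family_on (\<lambda>(x, r). cball x r) P"

definition packing_premeasure_at :: "real \<Rightarrow> real \<Rightarrow> 'a::metric_space set \<Rightarrow> ennreal" where
  "packing_premeasure_at s \<delta> E =
     Sup {(\<Sum>\<^sub>\<infinity>(x, r)\<in>P. ennreal ((2 * r) powr s)) |P. packing \<delta> E P}"

definition packing_premeasure :: "real \<Rightarrow> 'a::metric_space set \<Rightarrow> ennreal" where
  "packing_premeasure s E = (INF \<delta>\<in>{0<..}. packing_premeasure_at s \<delta> E)"

text \<open>The premeasure is not countably subadditive, hence the second infimum, over countable covers.\<close>

definition packing_measure :: "real \<Rightarrow> 'a::metric_space set \<Rightarrow> ennreal" where
  "packing_measure s E =
     Inf {(\<Sum>n. packing_premeasure s (F n)) |F :: nat \<Rightarrow> 'a set. E \<subseteq> (\<Union>n. F n)}"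

definition packing_dim :: "'a::metric_space set \<Rightarrow> ereal" where
  "packing_dim E = Inf (ereal ` {s. s \<ge> 0 \<and> packing_measure s E = 0})"

definition measure_packing_dim :: "'a::euclidean_space measure \<Rightarrow> ereal" where
  "measure_packing_dim M = Inf {packing_dim E |E. E \<in> sets borel \<and> emeasure M E > 0}"

end

theory Submission
  imports Defs "HOL-Real_Asymp.Real_Asymp"
begin

text \<open>
  For \<open>S \<subseteq> \<nat>\<close> let \<open>\<mu>\<close> be the law of \<open>\<Sum>k\<in>S. \<epsilon>\<^sub>k 2\<^sup>-\<^sup>k\<^sup>-\<^sup>1\<close> with independent fair bits \<open>\<epsilon>\<^sub>k\<close>. With
  \<open>c(n)\<close> the number of elements of \<open>S\<close> below \<open>n\<close>, a ball of radius about \<open>2\<^sup>-\<^sup>n\<close> centred in the support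
  has mass about \<open>2\<close> to the power \<open>-c(n)\<close>. Hence the Hausdorff and packing dimensions of \<open>\<mu>\<close> are the
  lower and upper density of \<open>S\<close>, and the lower and Assouad dimensions are its lower and upper
  Banach density; all four can be prescribed. The frequencies \<open>\<Sum>k\<in>B. 2\<^sup>k\<close>, for finite \<open>B \<subseteq> S\<close>, are
  orthogonal. On the level \<open>n\<close> atoms the exponentials form a basis, and if the positions
  \<open>n, ..., n + 3\<close> are missing from \<open>S\<close>, each exponential of level \<open>n\<close> is almost constant on the
  level \<open>n\<close> cylinders. So their span approximates every function up to a fixed proportion of its
  norm; as this holds for infinitely many \<open>n\<close>, the span is dense. Inserting sparse runs of four
  missing positions does not change any of the densities.
\<close>

section \<open>Random binary digits on a prescribed set of positions\<close>

text \<open>The gaps are essential: for \<open>S = UNIV\<close> the measure is Lebesgue measure on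
  the unit interval and the frequencies are just the nonnegative integers, an orthonormal but
  incomplete family. A gap after level \<open>n\<close> confines the tail \<open>y / 2 ^ n\<close>
  to \<open>y \<le> 1/16\<close>, so that the phases of frequencies below \<open>2 ^ n\<close>
  hardly move along it. One gap reduces the error only by a fixed factor. The step has to be applied
  again to the residual, whose oscillation must be small at the scale of the next gap; hence gaps
  arbitrarily far out. The mass of a ball depends on its radius alone, up to a constant factor, so
  all four dimensions become statements about the counting function. They are decoupled by scale.
  Block \<open>k\<close> starts at \<open>2 ^ (k * k)\<close>; the quotients
  \<open>2 ^ (2 * k + 1)\<close> of consecutive starts are unbounded, so the density at the end of a
  block is essentially that of the block. Runs of length \<open>k\<close> are unbounded, hence
  visible to Banach densities, while their total length is quadratic in \<open>k\<close> and
  negligible against \<open>2 ^ (k * k)\<close>.\<close>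

definition coins :: "(nat \<Rightarrow> bool) measure" where
  "coins = PiM UNIV (\<lambda>_. measure_pmf (bernoulli_pmf (1/2)))"

definition digit_sum :: "nat set \<Rightarrow> (nat \<Rightarrow> bool) \<Rightarrow> real" where
  "digit_sum S \<omega> = (\<Sum>k. if k \<in> S \<and> \<omega> k then (1/2) ^ Suc k else 0)"

definition digit_measure :: "nat set \<Rightarrow> real measure" where
  "digit_measure S = distr coins borel (digit_sum S)"

text \<open>Rescaling by \<open>2 ^ n\<close> turns the digits from position \<open>n\<close> on
  into a measure of the same family, whose digit set is shifted by \<open>n\<close>.\<close>

definition tail_digits :: "nat \<Rightarrow> nat set \<Rightarrow> nat set" where
  "tail_digits n S = {k. n + k \<in> S}"

text \<open>For \<open>A \<subseteq> S \<inter> {..<n}\<close> this is the left end of a cylinder of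
  level \<open>n\<close>, which lies in the interval of length \<open>1 / 2 ^ n\<close> starting
  there.\<close>

definition point :: "nat set \<Rightarrow> real" where
  "point A = (\<Sum>k\<in>A. (1/2) ^ Suc k)"

lemma sets_digit_measure [simp, measurable_cong]: "sets (digit_measure S) = sets borel"
  by (simp add: digit_measure_def)

lemma space_digit_measure [simp]: "space (digit_measure S) = UNIV"
  by (simp add: digit_measure_def)

lemma sequence_space_coin: "sequence_space (measure_pmf p)"
  by unfold_locales

lemma prob_space_coins: "prob_space coins"
  unfolding coins_def by (intro prob_space_PiM measure_pmf.prob_space_axioms)

lemma coin_measurable [measurable]: "(\<lambda>\<omega>. \<omega> k) \<in> coins \<rightarrow>\<^sub>M count_space UNIV"
proof -
  have "(\<lambda>\<omega>. \<omega> k) \<in> coins \<rightarrow>\<^sub>M measure_pmf (bernoulli_pmf (1/2))"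
    unfolding coins_def by (rule measurable_component_singleton) simp
  then show ?thesis by simp
qed

lemma digit_sum_measurable [measurable]: "digit_sum S \<in> borel_measurable coins"
  unfolding digit_sum_def by measurable

lemma prob_space_digit_measure: "prob_space (digit_measure S)"
  unfolding digit_measure_def by (intro prob_space.prob_space_distr prob_space_coins) simp

lemma digit_summable: "summable (\<lambda>k. if P k then (1/2::real) ^ Suc k else 0)"
  by (rule summable_comparison_test'[of "\<lambda>k. (1/2::real) ^ Suc k" 0])
     (auto intro!: summable_mult summable_geometric)

lemma digit_sum_in: "digit_sum S \<omega> \<in> {0..1}"
proof -
  have "digit_sum S \<omega> \<le> (\<Sum>k. (1/2::real) ^ Suc k)"
    unfolding digit_sum_def
    by (intro suminf_le digit_summable) (auto intro!: summable_mult summable_geometric)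
  also have "\<dots> = 1" using power_half_series sums_unique by fastforce
  finally show ?thesis
    unfolding digit_sum_def using digit_summable by (auto intro!: suminf_nonneg)
qed

lemma digit_sum_case_nat:
  "digit_sum S (case_nat b \<omega>) = (of_bool (0 \<in> S \<and> b) + digit_sum (tail_digits 1 S) \<omega>) / 2"
proof -
  let ?f = "\<lambda>k. if k \<in> S \<and> case_nat b \<omega> k then (1/2::real) ^ Suc k else 0"
  have "(\<Sum>k. ?f (Suc k)) = digit_sum S (case_nat b \<omega>) - ?f 0"
    unfolding digit_sum_def by (intro suminf_split_head digit_summable)
  moreover have "(\<Sum>k. ?f (Suc k)) = (\<Sum>k. (if k \<in> tail_digits 1 S \<and> \<omega> k then (1/2) ^ Suc k else 0) / 2)"
    by (intro suminf_cong) (auto simp: tail_digits_def)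
  moreover have "\<dots> = digit_sum (tail_digits 1 S) \<omega> / 2"
    unfolding digit_sum_def by (intro suminf_divide digit_summable)
  ultimately show ?thesis by (auto simp: field_simps)
qed

text \<open>Prepending one independent coin preserves the law of the sequence; this is how
  independence of the digits enters.\<close>

lemma coins_iterate:
  "coins = distr (measure_pmf (bernoulli_pmf (1/2)) \<Otimes>\<^sub>M coins) coins (\<lambda>(b, \<omega>). case_nat b \<omega>)"
proof -
  interpret sequence_space "measure_pmf (bernoulli_pmf (1/2))" by (rule sequence_space_coin)
  show ?thesis unfolding coins_def using PiM_iter by simp
qed

text \<open>Self-similarity, by conditioning on the digit at position 0: two halves of equal weight
  if that position is in \<open>S\<close>, otherwise only the left half. The bound on
  \<open>f\<close> provides the integrability for Fubini.\<close>

lemma integral_digit_measure_step: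
  fixes f :: "real \<Rightarrow> 'b::{banach, second_countable_topology}"
  assumes [measurable]: "f \<in> borel_measurable borel" and bnd: "\<And>x. norm (f x) \<le> B"
  shows "(\<integral>x. f x \<partial>digit_measure S) =
    (if 0 \<in> S then (1/2) *\<^sub>R ((\<integral>x. f (x / 2) \<partial>digit_measure (tail_digits 1 S)) + (\<integral>x. f ((1 + x) / 2) \<partial>digit_measure (tail_digits 1 S)))
     else (\<integral>x. f (x / 2) \<partial>digit_measure (tail_digits 1 S)))"
proof -
  let ?c = "measure_pmf (bernoulli_pmf (1/2))"
  interpret C: prob_space coins by (rule prob_space_coins)
  interpret P: pair_prob_space ?c coins ..
  have case_meas [measurable]: "(\<lambda>(b, \<omega>). case_nat b \<omega>) \<in> ?c \<Otimes>\<^sub>M coins \<rightarrow>\<^sub>M coins"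
    unfolding coins_def by measurable
  have [measurable]: "digit_sum S \<in> borel_measurable coins" by simp
  have "(\<integral>x. f x \<partial>digit_measure S) = (\<integral>\<omega>. f (digit_sum S \<omega>) \<partial>coins)"
    unfolding digit_measure_def by (rule integral_distr) auto
  also have "\<dots> = (\<integral>\<omega>. f (digit_sum S \<omega>) \<partial>distr (?c \<Otimes>\<^sub>M coins) coins (\<lambda>(b, \<omega>). case_nat b \<omega>))"
    by (subst coins_iterate) simp
  also have "\<dots> = (\<integral>p. f (digit_sum S ((\<lambda>(b, \<omega>). case_nat b \<omega>) p)) \<partial>(?c \<Otimes>\<^sub>M coins))"
    by (rule integral_distr) auto
  also have "\<dots> = (\<integral>p. (\<lambda>(b, \<omega>). f ((of_bool (0 \<in> S \<and> b) + digit_sum (tail_digits 1 S) \<omega>) / 2)) p \<partial>(?c \<Otimes>\<^sub>M coins))"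
    by (intro Bochner_Integration.integral_cong) (auto simp: digit_sum_case_nat)
  also have "\<dots> = (\<integral>b. (\<integral>\<omega>. f ((of_bool (0 \<in> S \<and> b) + digit_sum (tail_digits 1 S) \<omega>) / 2) \<partial>coins) \<partial>?c)"
    by (rule P.integral_fst[symmetric], rule P.integrable_const_bound[where B = B])
       (use bnd in \<open>auto simp: case_prod_beta\<close>)
  also have "\<dots> = (\<integral>b. (\<integral>x. f ((of_bool (0 \<in> S \<and> b) + x) / 2) \<partial>digit_measure (tail_digits 1 S)) \<partial>?c)"
    unfolding digit_measure_def by (intro Bochner_Integration.integral_cong) (auto simp: integral_distr)
  also have "\<dots> = (1/2) *\<^sub>R (\<integral>x. f ((of_bool (0 \<in> S) + x) / 2) \<partial>digit_measure (tail_digits 1 S))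
     + (1/2) *\<^sub>R (\<integral>x. f (x / 2) \<partial>digit_measure (tail_digits 1 S))"
    by (subst integral_measure_pmf[where A = UNIV]) (auto simp: UNIV_bool)
  finally show ?thesis
    by (auto simp: scaleR_add_right add.commute simp flip: scaleR_add_left)
qed

text \<open>Iteration of the one-digit step: the measure is the average of rescaled copies of the
  tail measure, placed at the points of level \<open>n\<close>. Masses of balls, orthogonality and
  the approximation step all rest on this formula.\<close>

lemma integral_digit_measure_level:
  fixes f :: "real \<Rightarrow> 'b::{banach, second_countable_topology}"
  assumes f [measurable]: "f \<in> borel_measurable borel" and bnd: "\<And>x. norm (f x) \<le> B"
  shows "(\<integral>x. f x \<partial>digit_measure S) =
    (1/2) ^ card (S \<inter> {..<n}) *\<^sub>R
      (\<Sum>A\<in>Pow (S \<inter> {..<n}). \<integral>y. f (point A + y / 2 ^ n) \<partial>digit_measure (tail_digits n S))"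
proof (induction n)
  case 0
  then show ?case by (simp add: point_def tail_digits_def)
next
  case (Suc n)
  let ?S = "S \<inter> {..<n}"
  have sh: "tail_digits (Suc 0) (tail_digits n S) = tail_digits (Suc n) S" "0 \<in> tail_digits n S \<longleftrightarrow> n \<in> S"
    by (auto simp: tail_digits_def)
  let ?I = "\<lambda>g. \<integral>y. g y \<partial>digit_measure (tail_digits (Suc n) S)"
  \<comment> \<open>If \<open>n\<close> is in \<open>S\<close>, the copy at \<open>point A\<close>
    splits into a left half at \<open>point A\<close> and a right half at
    \<open>point (insert n A)\<close>.\<close>
  have step: "(\<integral>y. f (point A + y / 2 ^ n) \<partial>digit_measure (tail_digits n S)) =
      (if n \<in> S then (1/2) *\<^sub>R (?I (\<lambda>y. f (point A + y / 2 ^ Suc n)) + ?I (\<lambda>y. f (point (insert n A) + y / 2 ^ Suc n)))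
       else ?I (\<lambda>y. f (point A + y / 2 ^ Suc n)))" if "A \<in> Pow ?S" for A
  proof -
    have "finite A" "n \<notin> A" using that by (auto intro: finite_subset)
    then have "point (insert n A) = (1/2) ^ Suc n + point A" by (simp add: point_def)
    then show ?thesis
      by (subst integral_digit_measure_step[where B = B])
         (use bnd in \<open>auto simp: sh power_divide field_simps\<close>)
  qed
  show ?case
  proof (cases "n \<in> S")
    case False
    then have "S \<inter> {..<Suc n} = ?S" by (auto simp: less_Suc_eq)
    then show ?thesis using False Suc.IH step by simp
  next
    case True
    then have eq: "S \<inter> {..<Suc n} = insert n ?S" by (auto simp: less_Suc_eq)
    have "(\<Sum>A\<in>Pow (insert n ?S). ?I (\<lambda>y. f (point A + y / 2 ^ Suc n))) =
      (\<Sum>A\<in>Pow ?S. ?I (\<lambda>y. f (point A + y / 2 ^ Suc n))) + (\<Sum>A\<in>insert n ` Pow ?S. ?I (\<lambda>y. f (point A + y / 2 ^ Suc n)))"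
      unfolding Pow_insert by (rule sum.union_disjoint) auto
    also have "(\<Sum>A\<in>insert n ` Pow ?S. ?I (\<lambda>y. f (point A + y / 2 ^ Suc n))) =
        (\<Sum>A\<in>Pow ?S. ?I (\<lambda>y. f (point (insert n A) + y / 2 ^ Suc n)))"
      by (rule sum.reindex_cong[of "insert n"]) (auto simp: inj_on_def)
    finally have *: "(\<Sum>A\<in>Pow (insert n ?S). ?I (\<lambda>y. f (point A + y / 2 ^ Suc n))) =
      (\<Sum>A\<in>Pow ?S. ?I (\<lambda>y. f (point A + y / 2 ^ Suc n)) + ?I (\<lambda>y. f (point (insert n A) + y / 2 ^ Suc n)))"
      by (simp add: sum.distrib)
    have "(\<Sum>A\<in>Pow ?S. \<integral>y. f (point A + y / 2 ^ n) \<partial>digit_measure (tail_digits n S)) =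
       (1/2) *\<^sub>R (\<Sum>A\<in>Pow (insert n ?S). ?I (\<lambda>y. f (point A + y / 2 ^ Suc n)))"
      unfolding * scaleR_sum_right using True by (intro sum.cong refl) (simp add: step)
    then show ?thesis unfolding Suc.IH eq by simp
  qed
qed

lemma AE_digit_measure: "AE x in digit_measure S. x \<in> {0..1}"
  unfolding digit_measure_def by (subst AE_distr_iff) (use digit_sum_in in auto)

lemma measure_digit_measure_level:
  assumes E [measurable]: "E \<in> sets borel"
  shows "measure (digit_measure S) E =
    (1/2) ^ card (S \<inter> {..<n}) *
      (\<Sum>A\<in>Pow (S \<inter> {..<n}). measure (digit_measure (tail_digits n S)) {y. point A + y / 2 ^ n \<in> E})"
proof -
  have "measure (digit_measure S) E = (\<integral>x. indicator E x \<partial>digit_measure S)" by simp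
  also have "\<dots> = (1/2) ^ card (S \<inter> {..<n}) *\<^sub>R
      (\<Sum>A\<in>Pow (S \<inter> {..<n}). \<integral>y. indicator E (point A + y / 2 ^ n) \<partial>digit_measure (tail_digits n S))"
    by (rule integral_digit_measure_level[where B = 1]) (auto simp: indicator_def)
  also have "\<dots> = (1/2) ^ card (S \<inter> {..<n}) *
      (\<Sum>A\<in>Pow (S \<inter> {..<n}). \<integral>y. indicator {y. point A + y / 2 ^ n \<in> E} y \<partial>digit_measure (tail_digits n S))"
    by (simp add: indicator_def)
  finally show ?thesis by simp
qed

section \<open>Mass of balls and the support\<close>

definition freq :: "nat set \<Rightarrow> real" where
  "freq B = (\<Sum>k\<in>B. 2 ^ k)"

text \<open>The set of all values of the digit sum, written as a decreasing intersection of finite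
  unions of closed dyadic intervals. In this form closedness and the efficient covers are
  immediate.\<close>

definition digit_set :: "nat set \<Rightarrow> real set" where
  "digit_set S = (\<Inter>n. \<Union>A\<in>Pow (S \<inter> {..<n}). {point A..point A + 1 / 2 ^ n})"

section \<open>Characters of the real line\<close>

lemma expo_eq_cis: "expo l (x::real) = cis (- (2 * pi * (l * x)))"
  by (simp add: expo_def cis_conv_exp algebra_simps)

lemma norm_expo [simp]: "cmod (expo l (x::real)) = 1"
  by (simp add: expo_eq_cis)

lemma expo_0_left [simp]: "expo 0 (x::real) = 1" and expo_0_right [simp]: "expo l (0::real) = 1"
  by (simp_all add: expo_eq_cis)

lemma expo_add_right: "expo l (x + y :: real) = expo l x * expo l y"
  by (simp add: expo_eq_cis cis_mult algebra_simps)

lemma expo_add_left: "expo (l + m) (x :: real) = expo l x * expo m x"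
  by (simp add: expo_eq_cis cis_mult algebra_simps)

lemma expo_mult_cnj_left: "expo l (x::real) * cnj (expo m x) = expo (l - m) x"
  by (simp add: expo_eq_cis cis_cnj cis_mult algebra_simps)

lemma expo_mult_cnj_right: "expo l (x::real) * cnj (expo l y) = expo l (x - y)"
  by (simp add: expo_eq_cis cis_cnj cis_mult algebra_simps)

lemma expo_sum_right: "expo l (\<Sum>k\<in>A. f k :: real) = (\<Prod>k\<in>A. expo l (f k))"
  by (induction A rule: infinite_finite_induct) (simp_all add: expo_add_right)

lemma expo_sum_left: "expo (\<Sum>k\<in>A. f k) (x :: real) = (\<Prod>k\<in>A. expo (f k) x)"
  by (induction A rule: infinite_finite_induct) (simp_all add: expo_add_left)

text \<open>Used to annihilate a factor \<open>expo l x + 1\<close> in the product formulas for the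
  orthogonality sums.\<close>

lemma expo_half_integer:
  assumes "l * x - 1 / 2 \<in> \<int>"
  shows "expo l (x::real) = -1"
proof -
  obtain j where "l * x - 1 / 2 = of_int j" using assms by (auto elim: Ints_cases)
  then have "l * x = of_int j + 1 / 2" by simp
  then have "expo l x = cis (2 * pi * of_int (- j)) * cis (- pi)"
    by (simp add: expo_eq_cis cis_mult algebra_simps)
  also have "cis (2 * pi * of_int (- j)) = 1" by (rule cis_multiple_2pi) simp
  finally show ?thesis by (simp add: cis.ctr complex_eq_iff)
qed

lemma norm_expo_minus_1_le: "cmod (expo l (x::real) - 1) \<le> 2 * pi * \<bar>l * x\<bar>"
proof -
  have "cmod (iexp (- (2 * pi * (l * x))) - (\<Sum>k\<le>0. (\<i> * complex_of_real (- (2 * pi * (l * x)))) ^ k / fact k))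
      \<le> \<bar>- (2 * pi * (l * x))\<bar> ^ Suc 0 / fact (Suc 0)"
    by (rule iexp_approx1)
  then show ?thesis by (simp add: expo_eq_cis cis_conv_exp abs_mult)
qed

text \<open>Common elements cancel, and among the remaining terms only that of \<open>k\<close> is
  not an integer. Its sign is irrelevant, as \<open>1 / 2\<close> and \<open>- 1 / 2\<close> differ
  by an integer.\<close>

lemma sum_diff_half_integer:
  fixes c :: "nat \<Rightarrow> real"
  assumes fin: "finite A" "finite B" and k: "k \<in> sym_diff A B" "c k = 1 / 2"
    and c: "\<And>i. i \<in> sym_diff A B \<Longrightarrow> i \<noteq> k \<Longrightarrow> c i \<in> \<int>"
  shows "sum c A - sum c B - 1 / 2 \<in> \<int>"
proof -
  have eq: "sum c A - sum c B = sum c (A - B) - sum c (B - A)"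
    using fin sum.Int_Diff[of A c B] sum.Int_Diff[of B c A] by (simp add: Int_commute)
  show ?thesis
  proof (cases "k \<in> A")
    case True
    then have "sum c (A - B) = 1 / 2 + sum c (A - B - {k})" "k \<notin> B"
      using fin k by (auto simp: sum.remove[of _ k])
    moreover have "sum c (A - B - {k}) \<in> \<int>" "sum c (B - A) \<in> \<int>"
      using c True by (auto intro!: Ints_sum)
    ultimately show ?thesis by (simp add: eq)
  next
    case False
    then have "sum c (B - A) = 1 / 2 + sum c (B - A - {k})" 
      using fin k by (auto simp: sum.remove[of _ k])
    moreover have "sum c (B - A - {k}) \<in> \<int>" "sum c (A - B) \<in> \<int>"
      using c False k by (auto intro!: Ints_sum)
    \<comment> \<open>The term of \<open>k\<close> is subtracted here, and together with the other
      half it gives the integer -1.\<close>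
    ultimately have "sum c A - sum c B - 1 / 2 = sum c (A - B) - sum c (B - A - {k}) - 1"
      by (simp add: eq)
    then show ?thesis using \<open>sum c (B - A - {k}) \<in> \<int>\<close> \<open>sum c (A - B) \<in> \<int>\<close> by simp
  qed
qed

text \<open>Take for \<open>k\<close> the largest position in which \<open>A\<close> and
  \<open>B\<close> differ. After scaling by \<open>2 ^ k\<close> its term is \<open>1 / 2\<close>,
  and smaller positions contribute integers.\<close>

lemma point_diff_half_integer:
  assumes "finite A" "finite B" "A \<noteq> B"
  obtains k where "k \<in> A \<union> B" "2 ^ k * (point A - point B) - 1 / 2 \<in> \<int>"
proof -
  define k where "k = Max (sym_diff A B)"
  have ne: "sym_diff A B \<noteq> {}" "finite (sym_diff A B)" using assms by auto
  then have k: "k \<in> sym_diff A B" unfolding k_def by (rule Max_in[rotated])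
  have "(\<Sum>i\<in>A. 2 ^ k * (1/2) ^ Suc i) - (\<Sum>i\<in>B. 2 ^ k * (1/2) ^ Suc i) - 1 / 2 \<in> (\<int> :: real set)"
  proof (rule sum_diff_half_integer[OF assms(1,2) k])
    fix i assume i: "i \<in> sym_diff A B" "i \<noteq> k"
    then have "i < k" using ne Max_ge[of "sym_diff A B" i] by (simp add: k_def order.strict_iff_order)
    then have "2 ^ k * (1/2::real) ^ Suc i = 2 ^ (k - Suc i)"
      by (simp add: power_diff power_one_over field_simps)
    then show "2 ^ k * (1/2::real) ^ Suc i \<in> \<int>" by simp
  qed (simp add: power_one_over)
  then have "2 ^ k * (point A - point B) - 1 / 2 \<in> \<int>"
    by (simp add: point_def right_diff_distrib sum_distrib_left)
  with k that show ?thesis by auto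
qed

text \<open>Dual to the statement on points: frequencies grow with the position, so now the smallest
  differing position gives the term \<open>1 / 2\<close>.\<close>

lemma freq_diff_half_integer:
  assumes "finite A" "finite B" "A \<noteq> B"
  obtains k where "k \<in> A \<union> B" "(freq A - freq B) * (1/2) ^ Suc k - 1 / 2 \<in> \<int>"
proof -
  define k where "k = Min (sym_diff A B)"
  have ne: "sym_diff A B \<noteq> {}" "finite (sym_diff A B)" using assms by auto
  then have k: "k \<in> sym_diff A B" unfolding k_def by (rule Min_in[rotated])
  have "(\<Sum>i\<in>A. 2 ^ i * (1/2) ^ Suc k) - (\<Sum>i\<in>B. 2 ^ i * (1/2) ^ Suc k) - 1 / 2 \<in> (\<int> :: real set)"
  proof (rule sum_diff_half_integer[OF assms(1,2) k])
    fix i assume i: "i \<in> sym_diff A B" "i \<noteq> k"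
    then have "k < i" using ne Min_le[of "sym_diff A B" i] by (simp add: k_def order.strict_iff_order)
    then have "2 ^ i * (1/2::real) ^ Suc k = 2 ^ (i - Suc k)"
      by (simp add: power_diff power_one_over field_simps)
    then show "2 ^ i * (1/2::real) ^ Suc k \<in> \<int>" by simp
  qed (simp add: power_one_over)
  then have "(freq A - freq B) * (1/2) ^ Suc k - 1 / 2 \<in> \<int>"
    by (simp only: freq_def left_diff_distrib sum_distrib_right)
  with k that show ?thesis by blast
qed

lemma not_Ints_half: "(1 / 2 :: real) \<notin> \<int>"
proof
  assume "(1 / 2 :: real) \<in> \<int>"
  then obtain j :: int where "1 / 2 = (of_int j :: real)" by (auto elim: Ints_cases)
  then have "1 = 2 * j" by linarith
  then show False by presburger
qed

text \<open>Equal values for different sets would make \<open>- 1 / 2\<close> an integer.\<close>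

lemma inj_on_point: "inj_on point {A. finite A}"
proof (rule inj_onI, rule ccontr)
  fix A B assume "A \<in> {A. finite A}" "B \<in> {A. finite A}" "point A = point B" "A \<noteq> B"
  then show False using point_diff_half_integer[of A B] not_Ints_half minus_in_Ints_iff[of "1/2::real"] by simp
qed

lemma inj_on_freq: "inj_on freq {A. finite A}"
proof (rule inj_onI, rule ccontr)
  fix A B assume "A \<in> {A. finite A}" "B \<in> {A. finite A}" "freq A = freq B" "A \<noteq> B"
  then show False using freq_diff_half_integer[of A B] not_Ints_half minus_in_Ints_iff[of "1/2::real"] by simp
qed

section \<open>Size and spacing of points and frequencies\<close>

lemma freq_nonneg: "0 \<le> freq B" by (simp add: freq_def sum_nonneg)

lemma freq_less:
  assumes "B \<subseteq> {..<n}" shows "freq B < 2 ^ n"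
proof -
  have "freq B \<le> (\<Sum>k<n. 2 ^ k)" unfolding freq_def using assms by (intro sum_mono2) auto
  also have "\<dots> < 2 ^ n" by (induction n) auto
  finally show ?thesis .
qed

lemma point_nonneg: "0 \<le> point B" by (simp add: point_def sum_nonneg)

lemma point_le:
  assumes "B \<subseteq> {..<n}" shows "point B \<le> 1 - 1 / 2 ^ n"
proof -
  have "point B \<le> (\<Sum>k<n. (1/2) ^ Suc k)" unfolding point_def using assms by (intro sum_mono2) auto
  also have "\<dots> = 1 - 1 / 2 ^ n" by (induction n) (auto simp: power_one_over field_simps)
  finally show ?thesis .
qed

lemma point_scaled_Ints:
  assumes "A \<subseteq> {..<n}" shows "2 ^ n * point A \<in> \<int>"
proof -
  have "2 ^ n * (1/2::real) ^ Suc i = 2 ^ (n - Suc i)" if "i \<in> A" for i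
    using that assms by (auto simp: power_diff power_one_over field_simps)
  then have "2 ^ n * point A = (\<Sum>i\<in>A. 2 ^ (n - Suc i))" by (simp add: point_def sum_distrib_left)
  also have "\<dots> \<in> \<int>" by (intro Ints_sum) simp
  finally show ?thesis .
qed

text \<open>Scaled by \<open>2 ^ n\<close>, distinct points of level \<open>n\<close> are distinct
  integers, and an interval of length 3 contains at most four of them.\<close>

lemma card_points_interval_le:
  assumes F: "\<And>A. A \<in> F \<Longrightarrow> A \<subseteq> {..<n} \<and> a \<le> 2 ^ n * point A \<and> 2 ^ n * point A \<le> a + 3"
  shows "finite F" "card F \<le> 4"
proof -
  have sub: "F \<subseteq> Pow {..<n}" using F by auto
  then show "finite F" by (rule finite_subset) simp
  have inj: "inj_on (\<lambda>A. \<lfloor>2 ^ n * point A\<rfloor>) F"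
  proof (rule inj_onI)
    fix A B assume AB: "A \<in> F" "B \<in> F" "\<lfloor>2 ^ n * point A\<rfloor> = \<lfloor>2 ^ n * point B\<rfloor>"
    then have "2 ^ n * point A = 2 ^ n * point B"
      using F point_scaled_Ints by (metis of_int_floor)
    moreover have "finite A" "finite B" using AB F by (meson finite_lessThan finite_subset)+
    ultimately show "A = B" using inj_on_point by (auto simp: inj_on_def)
  qed
  have "(\<lambda>A. \<lfloor>2 ^ n * point A\<rfloor>) ` F \<subseteq> {\<lceil>a\<rceil>..\<lceil>a\<rceil> + 3}"
  proof (safe, simp_all only: atLeastAtMost_iff, intro conjI)
    fix A assume "A \<in> F"
    then have A: "a \<le> 2 ^ n * point A" "2 ^ n * point A \<le> a + 3" 
       "2 ^ n * point A = of_int \<lfloor>2 ^ n * point A\<rfloor>" using F point_scaled_Ints by (auto simp: of_int_floor)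
    then show "\<lceil>a\<rceil> \<le> \<lfloor>2 ^ n * point A\<rfloor>" by (simp add: ceiling_le_iff)
    show "\<lfloor>2 ^ n * point A\<rfloor> \<le> \<lceil>a\<rceil> + 3" using A(2) by linarith
  qed
  then have "card ((\<lambda>A. \<lfloor>2 ^ n * point A\<rfloor>) ` F) \<le> card {\<lceil>a\<rceil>..\<lceil>a\<rceil> + 3}" by (intro card_mono) auto
  then show "card F \<le> 4" using inj by (simp add: card_image)
qed

text \<open>In units of \<open>1 / 2 ^ n\<close>, a cylinder that meets the ball has its left end in
  an interval of length 3: two for the diameter of the ball, one for the cylinder. So at most four
  cylinders contribute, each of mass \<open>(1/2) ^ card (S \<inter> {..<n})\<close>.\<close>

lemma measure_cball_le:
  assumes r: "r \<le> 1 / 2 ^ n"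
  shows "measure (digit_measure S) (cball x r) \<le> 4 * (1/2) ^ card (S \<inter> {..<n})"
proof -
  interpret prob_space "digit_measure (tail_digits n S)" by (rule prob_space_digit_measure)
  let ?m = "\<lambda>A. measure (digit_measure (tail_digits n S)) {y. point A + y / 2 ^ n \<in> cball x r}"
  define F where "F = {A \<in> Pow (S \<inter> {..<n}). {y. point A + y / 2 ^ n \<in> cball x r} \<inter> {0..1} \<noteq> {}}"
  have r': "r * 2 ^ n \<le> 1" using r by (simp add: field_simps)
  have "A \<subseteq> {..<n} \<and> x * 2 ^ n - 2 \<le> 2 ^ n * point A \<and> 2 ^ n * point A \<le> (x * 2 ^ n - 2) + 3" if A: "A \<in> F" for A
  proof -
    obtain y where y: "y \<in> {0..1}" "\<bar>x - (point A + y / 2 ^ n)\<bar> \<le> r"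
      using A unfolding F_def mem_Collect_eq mem_cball dist_real_def by blast
    have "\<bar>x - (point A + y / 2 ^ n)\<bar> * 2 ^ n \<le> r * 2 ^ n" using y by (intro mult_right_mono) auto
    from order_trans[OF this r'] have "\<bar>(x - (point A + y / 2 ^ n)) * 2 ^ n\<bar> \<le> 1" by (simp add: abs_mult)
    moreover have "(x - (point A + y / 2 ^ n)) * 2 ^ n = x * 2 ^ n - 2 ^ n * point A - y" by (simp add: field_simps)
    ultimately have "\<bar>x * 2 ^ n - 2 ^ n * point A - y\<bar> \<le> 1" by simp
    then show ?thesis using A y by (auto simp: F_def)
  qed
  from card_points_interval_le[OF this] have F: "finite F" "card F \<le> 4" by auto
  have zero: "?m A = 0" if "A \<in> Pow (S \<inter> {..<n}) - F" for A
  proof -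
    have "AE y in digit_measure (tail_digits n S). point A + y / 2 ^ n \<notin> cball x r"
      by (rule AE_mp[OF AE_digit_measure], intro AE_I2 impI notI) (use that in \<open>unfold F_def, blast\<close>)
    from emeasure_eq_0_AE[OF this] show ?thesis by (simp add: measure_def)
  qed
  have "(\<Sum>A\<in>Pow (S \<inter> {..<n}). ?m A) = (\<Sum>A\<in>F. ?m A)"
    using zero by (intro sum.mono_neutral_right) (auto simp: F_def)
  also have "\<dots> \<le> (\<Sum>A\<in>F. 1)" by (intro sum_mono) auto
  also have "\<dots> \<le> 4" using F by simp
  finally show ?thesis
    by (subst measure_digit_measure_level[where n = n]) (auto simp: mult_le_cancel_left)
qed

text \<open>The ball contains the cylinder interval of level \<open>n\<close> around
  \<open>x\<close>. The strict inequality is what an open ball requires.\<close>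

lemma measure_ball_ge:
  assumes x: "x \<in> digit_set S" and r: "1 / 2 ^ n < r"
  shows "(1/2) ^ card (S \<inter> {..<n}) \<le> measure (digit_measure S) (ball x r)"
proof -
  interpret prob_space "digit_measure (tail_digits n S)" by (rule prob_space_digit_measure)
  have "x \<in> (\<Union>A\<in>Pow (S \<inter> {..<n}). {point A..point A + 1 / 2 ^ n})"
    using x unfolding digit_set_def by (rule INT_D) simp
  then obtain A where A: "A \<subseteq> S \<inter> {..<n}" "x \<in> {point A..point A + 1 / 2 ^ n}"
    by (elim UN_E PowD[elim_format])
  let ?m = "\<lambda>A. measure (digit_measure (tail_digits n S)) {y. point A + y / 2 ^ n \<in> ball x r}"
  have "prob {y. point A + y / 2 ^ n \<in> ball x r} = 1"
  proof (subst prob_eq_1)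
    show "AE y in digit_measure (tail_digits n S). y \<in> {y. point A + y / 2 ^ n \<in> ball x r}"
    proof (rule AE_mp[OF AE_digit_measure], intro AE_I2 impI)
      fix y :: real assume "y \<in> {0..1}"
      then have "point A + y / 2 ^ n \<in> {point A..point A + 1 / 2 ^ n}" by (simp add: divide_right_mono)
      then have "\<bar>x - (point A + y / 2 ^ n)\<bar> \<le> 1 / 2 ^ n"
        using A(2) unfolding atLeastAtMost_iff abs_le_iff by linarith
      then show "y \<in> {y. point A + y / 2 ^ n \<in> ball x r}" using r by (simp add: dist_real_def)
    qed
  qed simp
  moreover have "?m A \<le> (\<Sum>A\<in>Pow (S \<inter> {..<n}). ?m A)" using A by (intro member_le_sum) auto
  ultimately show ?thesis
    by (subst measure_digit_measure_level[where n = n]) auto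
qed

section \<open>The support\<close>

lemma digit_set_subset: "digit_set S \<subseteq> {0..1}"
  by (auto simp: digit_set_def point_def dest!: spec[of _ 0])

lemma compact_digit_set: "compact (digit_set S)"
proof -
  have "closed (digit_set S)" unfolding digit_set_def by (intro closed_INT ballI closed_UN) auto
  then show ?thesis
    using digit_set_subset[of S] bounded_subset[OF bounded_closed_interval] by (auto simp: compact_eq_bounded_closed)
qed

lemma digit_set_borel [measurable]: "digit_set S \<in> sets borel"
  by (simp add: compact_digit_set borel_closed compact_imp_closed)

text \<open>At level \<open>n\<close> every rescaled copy lives on its own interval, so the finite
  union has full measure; countably many levels are intersected.\<close>

lemma AE_digit_set: "AE x in digit_measure S. x \<in> digit_set S"
proof -
  interpret prob_space "digit_measure S" by (rule prob_space_digit_measure)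
  have "AE x in digit_measure S. x \<in> (\<Union>A\<in>Pow (S \<inter> {..<n}). {point A..point A + 1 / 2 ^ n})" for n
  proof -
    interpret Q: prob_space "digit_measure (tail_digits n S)" by (rule prob_space_digit_measure)
    let ?E = "\<Union>A\<in>Pow (S \<inter> {..<n}). {point A..point A + 1 / 2 ^ n}"
    have [measurable]: "?E \<in> sets borel" by (intro sets.finite_UN) auto
    have "measure (digit_measure (tail_digits n S)) {y. point A + y / 2 ^ n \<in> ?E} = 1"
      if "A \<in> Pow (S \<inter> {..<n})" for A
      by (subst Q.prob_eq_1, simp, rule AE_mp[OF AE_digit_measure])
         (use that in \<open>auto simp: divide_right_mono intro!: bexI[of _ A]\<close>)
    then have "prob ?E = (1/2) ^ card (S \<inter> {..<n}) * real (card (Pow (S \<inter> {..<n})))"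
      by (subst measure_digit_measure_level[where n = n]) (auto simp del: UN_iff)
    also have "\<dots> = 1" by (subst card_Pow) (auto simp: power_one_over)
    finally show ?thesis by (subst (asm) prob_eq_1) auto
  qed
  then show ?thesis unfolding digit_set_def by (subst INT_iff) (simp add: AE_all_countable)
qed

text \<open>The complement of \<open>digit_set S\<close> is an open null set, and
  \<open>measure_ball_ge\<close> gives positive mass around each of its points.\<close>

lemma msupport_digit_measure: "msupport (digit_measure S) = digit_set S"
proof (intro equalityI subsetI)
  interpret prob_space "digit_measure S" by (rule prob_space_digit_measure)
  fix x
  {
    assume "x \<in> msupport (digit_measure S)"
    moreover have "emeasure (digit_measure S) {x \<in> space (digit_measure S). x \<notin> digit_set S} = 0"
      by (rule emeasure_eq_0_AE) (use AE_digit_set in simp)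
    then have "emeasure (digit_measure S) (- digit_set S) = 0" by (simp add: Compl_eq)
    moreover have "open (- digit_set S)"
      by (simp add: compact_digit_set compact_imp_closed open_Compl)
    ultimately show "x \<in> digit_set S" unfolding msupport_def by fastforce
  next
    assume x: "x \<in> digit_set S"
    show "x \<in> msupport (digit_measure S)"
      unfolding msupport_def
    proof (intro CollectI allI impI)
      fix U :: "real set" assume U: "open U" "x \<in> U"
      then obtain r where r: "r > 0" "ball x r \<subseteq> U" by (auto simp: open_contains_ball)
      obtain n where n: "(1/2) ^ n < r" using real_arch_pow_inv[of r "1/2"] r by auto
      have "0 < (1/2::real) ^ card (S \<inter> {..<n})" by simp
      also have "\<dots> \<le> prob (ball x r)" using n by (intro measure_ball_ge x) (simp add: power_one_over)
      also have "\<dots> \<le> prob U" using U r by (intro finite_measure_mono) auto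
      finally show "emeasure (digit_measure S) U > 0" by (simp add: emeasure_eq_measure)
    qed
  }
qed

lemma diameter_digit_set_le: "diameter (digit_set S) \<le> 1"
proof (rule diameter_le)
  fix x y assume "x \<in> digit_set S" "y \<in> digit_set S"
  then have "x \<in> {0..1}" "y \<in> {0..1}" using digit_set_subset by blast+
  then show "norm (x - y) \<le> 1" by (auto simp: abs_le_iff)
qed simp

text \<open>For a support of diameter zero the conditions in \<open>assouad_dim\<close> and
  \<open>lower_dim\<close> would be vacuous. The points \<open>0\<close> and
  \<open>(1/2) ^ Suc k\<close> exclude this.\<close>

lemma diameter_digit_set_pos:
  assumes "k \<in> S" shows "diameter (digit_set S) > 0"
proof -
  have "0 \<in> digit_set S" unfolding digit_set_def by (intro INT_I UN_I[of "{}"]) (auto simp: point_def)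
  moreover have "(1/2) ^ Suc k \<in> digit_set S"
    unfolding digit_set_def
  proof (intro INT_I)
    fix n
    show "(1/2) ^ Suc k \<in> (\<Union>A\<in>Pow (S \<inter> {..<n}). {point A..point A + 1 / 2 ^ n})"
    proof (cases "k < n")
      case True
      then show ?thesis using assms by (intro UN_I[of "{k}"]) (auto simp: point_def)
    next
      case False
      then have "(1/2::real) ^ Suc k \<le> (1/2) ^ n" by (intro power_decreasing) auto
      then show ?thesis by (intro UN_I[of "{}"]) (auto simp: point_def power_one_over)
    qed
  qed
  ultimately have "dist 0 ((1/2::real) ^ Suc k) \<le> diameter (digit_set S)"
    using compact_digit_set compact_imp_bounded diameter_bounded_bound by blast
  moreover have "0 < dist 0 ((1/2::real) ^ Suc k)" by simp
  ultimately show ?thesis by linarith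
qed

section \<open>Bounded continuous functions in \<open>L\<^sup>2\<close>\<close>

text \<open>Membership in the closure of \<open>V\<close>, with the squared distance so that no
  roots occur in the estimates.\<close>

definition approximable :: "'a measure \<Rightarrow> ('a \<Rightarrow> complex) set \<Rightarrow> ('a \<Rightarrow> complex) \<Rightarrow> bool" where
  "approximable M V f \<longleftrightarrow> (\<forall>\<epsilon>>0. \<exists>v\<in>V. (\<integral>x. (cmod (f x - v x))\<^sup>2 \<partial>M) < \<epsilon>)"

definition bounded_continuous :: "('a::topological_space \<Rightarrow> complex) set" where
  "bounded_continuous = {g. continuous_on UNIV g \<and> bounded (range g)}"

lemma square_norm_add_le: "(cmod (a + b))\<^sup>2 \<le> 2 * (cmod a)\<^sup>2 + 2 * (cmod b)\<^sup>2"
proof -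
  have "(cmod (a + b))\<^sup>2 \<le> (cmod a + cmod b)\<^sup>2" by (intro power_mono norm_triangle_ineq) auto
  also have "\<dots> \<le> 2 * (cmod a)\<^sup>2 + 2 * (cmod b)\<^sup>2"
    using zero_le_power2[of "cmod a - cmod b"] by (simp add: power2_eq_square algebra_simps)
  finally show ?thesis .
qed

lemma square_integrable_add:
  assumes "square_integrable M f" "square_integrable M g"
  shows "square_integrable M (\<lambda>x. f x + g x)"
proof -
  have [measurable]: "f \<in> borel_measurable M" "g \<in> borel_measurable M"
    using assms by (auto simp: square_integrable_def)
  have "integrable M (\<lambda>x. (cmod (f x + g x))\<^sup>2)"
  proof (rule Bochner_Integration.integrable_bound)
    show "integrable M (\<lambda>x. 2 * (cmod (f x))\<^sup>2 + 2 * (cmod (g x))\<^sup>2)"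
      using assms by (auto simp: square_integrable_def)
  qed (auto simp: square_norm_add_le intro: order_trans[OF _ abs_ge_self])
  then show ?thesis by (simp add: square_integrable_def)
qed

lemma square_integrable_cmult:
  assumes "square_integrable M f" shows "square_integrable M (\<lambda>x. c * f x)"
  using assms by (auto simp: square_integrable_def norm_mult power_mult_distrib)

lemma square_integrable_diff:
  assumes "square_integrable M f" "square_integrable M g"
  shows "square_integrable M (\<lambda>x. f x - g x)"
  using square_integrable_add[OF assms(1) square_integrable_cmult[OF assms(2), of "-1"]] by simp

lemma integral_square_add_le:
  assumes "square_integrable M f" "square_integrable M g"
  shows "(\<integral>x. (cmod (f x + g x))\<^sup>2 \<partial>M) \<le> 2 * (\<integral>x. (cmod (f x))\<^sup>2 \<partial>M) + 2 * (\<integral>x. (cmod (g x))\<^sup>2 \<partial>M)"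
proof -
  have "(\<integral>x. (cmod (f x + g x))\<^sup>2 \<partial>M) \<le> (\<integral>x. 2 * (cmod (f x))\<^sup>2 + 2 * (cmod (g x))\<^sup>2 \<partial>M)"
    using square_integrable_add[OF assms] assms
    by (intro integral_mono) (auto simp: square_integrable_def square_norm_add_le)
  also have "\<dots> = 2 * (\<integral>x. (cmod (f x))\<^sup>2 \<partial>M) + 2 * (\<integral>x. (cmod (g x))\<^sup>2 \<partial>M)"
    using assms by (simp add: square_integrable_def)
  finally show ?thesis .
qed

lemma approximable_trans:
  assumes f: "square_integrable M f" and V: "\<And>v. v \<in> V \<Longrightarrow> square_integrable M v"
    and g: "\<And>\<epsilon>. \<epsilon> > 0 \<Longrightarrow>
      \<exists>g. square_integrable M g \<and> approximable M V g \<and> (\<integral>x. (cmod (f x - g x))\<^sup>2 \<partial>M) < \<epsilon>"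
  shows "approximable M V f"
  unfolding approximable_def
proof (intro allI impI)
  fix \<epsilon> :: real assume "\<epsilon> > 0"
  then obtain g where g: "square_integrable M g" "approximable M V g" "(\<integral>x. (cmod (f x - g x))\<^sup>2 \<partial>M) < \<epsilon> / 4"
    using g[of "\<epsilon> / 4"] by auto
  then obtain v where v: "v \<in> V" "(\<integral>x. (cmod (g x - v x))\<^sup>2 \<partial>M) < \<epsilon> / 4"
    using \<open>\<epsilon> > 0\<close> unfolding approximable_def by (meson divide_pos_pos zero_less_numeral)
  have "(\<integral>x. (cmod ((f x - g x) + (g x - v x)))\<^sup>2 \<partial>M) \<le>
      2 * (\<integral>x. (cmod (f x - g x))\<^sup>2 \<partial>M) + 2 * (\<integral>x. (cmod (g x - v x))\<^sup>2 \<partial>M)"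
    using f g v V by (intro integral_square_add_le square_integrable_diff) auto
  also have "\<dots> < \<epsilon>" using g v by simp
  finally show "\<exists>v\<in>V. (\<integral>x. (cmod (f x - v x))\<^sup>2 \<partial>M) < \<epsilon>" using v by auto
qed

lemma bounded_continuousE:
  assumes "f \<in> bounded_continuous"
  obtains B where "B > 0" "\<And>x. cmod (f x) \<le> B" "continuous_on UNIV f"
  using assms unfolding bounded_continuous_def bounded_pos by auto

lemma bounded_continuousI:
  assumes "continuous_on UNIV f" "\<And>x. cmod (f x) \<le> B"
  shows "f \<in> bounded_continuous"
  using assms unfolding bounded_continuous_def by (auto intro!: boundedI)

lemma bounded_continuous_add:
  assumes "f \<in> bounded_continuous" "g \<in> bounded_continuous"
  shows "(\<lambda>x. f x + g x) \<in> bounded_continuous"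
proof -
  obtain B C where "\<And>x. cmod (f x) \<le> B" "continuous_on UNIV f" "\<And>x. cmod (g x) \<le> C" "continuous_on UNIV g"
    using assms by (metis bounded_continuousE)
  then show ?thesis
    by (intro bounded_continuousI[where B = "B + C"] continuous_intros)
       (auto intro: norm_triangle_le add_mono)
qed

lemma bounded_continuous_cmult:
  assumes "f \<in> bounded_continuous" shows "(\<lambda>x. c * f x) \<in> bounded_continuous"
proof -
  obtain B where "\<And>x. cmod (f x) \<le> B" "continuous_on UNIV f"
    using assms by (metis bounded_continuousE)
  then show ?thesis
    by (intro bounded_continuousI[where B = "cmod c * B"] continuous_intros)
       (auto simp: norm_mult mult_left_mono)
qed

lemma bounded_continuous_sum:
  assumes "\<And>i. i \<in> I \<Longrightarrow> f i \<in> bounded_continuous"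
  shows "(\<lambda>x. \<Sum>i\<in>I. f i x) \<in> bounded_continuous"
  using assms
proof (induction I rule: infinite_finite_induct)
  case (insert i I)
  then show ?case by (simp add: bounded_continuous_add)
qed (auto intro!: bounded_continuousI[where B = 0])

lemma bounded_measurable_square_integrable:
  assumes "finite_measure M" and [measurable]: "f \<in> borel_measurable M" and "\<And>x. cmod (f x) \<le> B"
  shows "square_integrable M f"
proof -
  interpret finite_measure M by fact
  have "integrable M (\<lambda>x. (cmod (f x))\<^sup>2)"
    by (rule integrable_const_bound[where B = "B\<^sup>2"]) (use assms in \<open>auto intro!: power_mono\<close>)
  then show ?thesis by (simp add: square_integrable_def)
qed

lemma bounded_continuous_square_integrable:
  assumes "finite_measure M" "sets M = sets borel" "f \<in> bounded_continuous"
  shows "square_integrable M f"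
proof -
  obtain B where B: "\<And>x. cmod (f x) \<le> B" "continuous_on UNIV f"
    using assms by (metis bounded_continuousE)
  have "f \<in> borel_measurable M"
    using borel_measurable_continuous_onI[OF B(2)] measurable_cong_sets[OF assms(2) refl] by blast
  then show ?thesis using bounded_measurable_square_integrable assms(1) B by blast
qed

text \<open>Regularity encloses \<open>B\<close> between a compact \<open>K\<close> and an open
  \<open>U\<close> of nearly the same mass. A Urysohn function that is 1 on \<open>K\<close> and 0
  off \<open>U\<close> differs from the indicator only on \<open>U - K\<close>, by at most
  1.\<close>

lemma approximable_indicator:
  fixes M :: "'a::euclidean_space measure"
  assumes M: "finite_measure M" "sets M = sets borel" and B: "B \<in> sets borel"
  shows "approximable M bounded_continuous (indicator B)"
  unfolding approximable_def
proof (intro allI impI)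
  interpret finite_measure M by fact
  fix \<epsilon> :: real assume "\<epsilon> > 0"
  have fin: "emeasure M (space M) \<noteq> \<infinity>" "emeasure M B \<noteq> \<infinity>" by auto
  have "{} \<in> {K. K \<subseteq> B \<and> compact K}" by simp
  then have ne: "{K. K \<subseteq> B \<and> compact K} \<noteq> {}" by blast
  obtain K where K: "K \<subseteq> B" "compact K" "emeasure M B < emeasure M K + ennreal (\<epsilon> / 2)"
    using SUP_approx_ennreal[OF _ ne inner_regular[OF M(2) fin(1) B] fin(2), of "\<epsilon> / 2"] \<open>\<epsilon> > 0\<close> by auto
  obtain U where U: "B \<subseteq> U" "open U" "emeasure M U < emeasure M B + ennreal (\<epsilon> / 2)"
    using INF_approx_ennreal[OF _ outer_regular[OF M(2) fin(1) B] fin(2), of "\<epsilon> / 2"] \<open>\<epsilon> > 0\<close> by auto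
  have [measurable]: "K \<in> sets M" "U \<in> sets M" "B \<in> sets M"
    using K U B M(2) by (auto simp: borel_compact)
  have "measure M B < measure M K + \<epsilon> / 2" "measure M U < measure M B + \<epsilon> / 2"
    using K(3) U(3) \<open>\<epsilon> > 0\<close> by (simp_all add: emeasure_eq_measure ennreal_less_iff flip: ennreal_plus)
  then have UK: "measure M (U - K) < \<epsilon>" using K U by (subst finite_measure_Diff) auto
  obtain g :: "'a \<Rightarrow> real" where g: "continuous_on UNIV g" "\<And>x. g x \<in> closed_segment 1 0"
    "\<And>x. x \<in> K \<Longrightarrow> g x = 1" "\<And>x. x \<in> - U \<Longrightarrow> g x = 0"
    by (rule Urysohn[of K "- U" 1 0]) (use K U in \<open>auto intro: compact_imp_closed\<close>)
  have g01: "0 \<le> g x" "g x \<le> 1" for x using g(2)[of x] by (auto simp: closed_segment_eq_real_ivl)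
  have [measurable]: "g \<in> borel_measurable M"
    using borel_measurable_continuous_onI[OF g(1)] measurable_cong_sets[OF M(2) refl] by blast
  have "(\<lambda>x. complex_of_real (g x)) \<in> bounded_continuous"
    by (rule bounded_continuousI[where B = 1]) (use g01 in \<open>auto intro!: continuous_intros g(1)\<close>)
  moreover have "(\<integral>x. (cmod (indicator B x - of_real (g x)))\<^sup>2 \<partial>M) \<le> (\<integral>x. indicator (U - K) x \<partial>M)"
  proof (rule integral_mono_AE')
    show "AE x in M. (cmod (indicator B x - of_real (g x)))\<^sup>2 \<le> indicator (U - K) x"
    proof (rule AE_I2)
      fix x
      show "(cmod (indicator B x - of_real (g x)))\<^sup>2 \<le> (indicator (U - K) x :: real)"
      proof (cases "x \<in> U - K")
        case True
        have "cmod (indicator B x - of_real (g x)) \<le> 1"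
          using g01[of x] by (cases "x \<in> B") (auto simp: norm_complex_def simp flip: of_real_diff)
        then show ?thesis using True by (simp add: power_le_one)
      next
        case False
        then show ?thesis using g(3,4)[of x] K U by (auto simp: indicator_def)
      qed
    qed
  qed (auto intro!: integrable_real_indicator simp: emeasure_eq_measure)
  ultimately show "\<exists>v\<in>bounded_continuous. (\<integral>x. (cmod (indicator B x - v x))\<^sup>2 \<partial>M) < \<epsilon>"
    using UK by (intro bexI[of _ "\<lambda>x. of_real (g x)"]) auto
qed

lemma approximable_add:
  assumes M: "finite_measure M" "sets M = sets borel"
    and f: "square_integrable M f" "approximable M bounded_continuous f"
    and g: "square_integrable M g" "approximable M bounded_continuous g"
  shows "approximable M bounded_continuous (\<lambda>x. f x + g x)"
  unfolding approximable_def
proof (intro allI impI)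
  fix \<epsilon> :: real assume "\<epsilon> > 0"
  then have "\<epsilon> / 4 > 0" by simp
  with f g obtain u v where u: "u \<in> bounded_continuous" "(\<integral>x. (cmod (f x - u x))\<^sup>2 \<partial>M) < \<epsilon> / 4"
    and v: "v \<in> bounded_continuous" "(\<integral>x. (cmod (g x - v x))\<^sup>2 \<partial>M) < \<epsilon> / 4"
    unfolding approximable_def by blast
  have "(\<integral>x. (cmod ((f x - u x) + (g x - v x)))\<^sup>2 \<partial>M) \<le>
      2 * (\<integral>x. (cmod (f x - u x))\<^sup>2 \<partial>M) + 2 * (\<integral>x. (cmod (g x - v x))\<^sup>2 \<partial>M)"
    using M u v f g by (intro integral_square_add_le square_integrable_diff) (auto intro: bounded_continuous_square_integrable)
  also have "\<dots> < \<epsilon>" using u v by simp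
  finally show "\<exists>w\<in>bounded_continuous. (\<integral>x. (cmod (f x + g x - w x))\<^sup>2 \<partial>M) < \<epsilon>"
    using bounded_continuous_add[OF u(1) v(1)] by (intro bexI[of _ "\<lambda>x. u x + v x"]) (auto simp: algebra_simps)
qed

lemma approximable_cmult:
  assumes "approximable M bounded_continuous f"
  shows "approximable M bounded_continuous (\<lambda>x. c * f x)"
  unfolding approximable_def
proof (intro allI impI)
  fix \<epsilon> :: real assume "\<epsilon> > 0"
  have pos: "(cmod c)\<^sup>2 + 1 > 0" by (simp add: add_nonneg_pos)
  then obtain u where u: "u \<in> bounded_continuous" "(\<integral>x. (cmod (f x - u x))\<^sup>2 \<partial>M) < \<epsilon> / ((cmod c)\<^sup>2 + 1)"
    using assms \<open>\<epsilon> > 0\<close> unfolding approximable_def by (meson divide_pos_pos)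
  have "(\<integral>x. (cmod (c * f x - c * u x))\<^sup>2 \<partial>M) = (cmod c)\<^sup>2 * (\<integral>x. (cmod (f x - u x))\<^sup>2 \<partial>M)"
    by (simp add: norm_mult power_mult_distrib flip: right_diff_distrib)
  also have "\<dots> \<le> ((cmod c)\<^sup>2 + 1) * (\<integral>x. (cmod (f x - u x))\<^sup>2 \<partial>M)"
    by (intro mult_right_mono) auto
  also have "\<dots> < \<epsilon>" using u(2) pos by (simp add: field_simps)
  finally show "\<exists>w\<in>bounded_continuous. (\<integral>x. (cmod (c * f x - w x))\<^sup>2 \<partial>M) < \<epsilon>"
    using bounded_continuous_cmult[OF u(1)] by auto
qed

text \<open>Simple functions are finite combinations of indicators, hence approximable; dominated
  convergence passes to \<open>f\<close>.\<close>

lemma approximable_bounded_continuous: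
  fixes M :: "'a::euclidean_space measure"
  assumes M: "finite_measure M" "sets M = sets borel" and f: "square_integrable M f"
  shows "approximable M bounded_continuous f"
proof (rule approximable_trans[OF f])
  interpret finite_measure M by fact
  show "square_integrable M v" if "v \<in> bounded_continuous" for v
    using that M by (rule bounded_continuous_square_integrable[rotated 2])
  have sp: "space M = UNIV" using M(2) sets_eq_imp_space_eq by force
  have fm [measurable]: "f \<in> borel_measurable M" and fi: "integrable M (\<lambda>x. (cmod (f x))\<^sup>2)"
    using f by (auto simp: square_integrable_def)
  \<comment> \<open>The factor 2 in the bound on \<open>F i\<close> makes the error at most three
    times \<open>f\<close>, hence the dominating function \<open>9 * (cmod (f x))\<^sup>2\<close>
    below.\<close>
  obtain F where F: "\<And>i. simple_function M (F i)" "\<And>x. (\<lambda>i. F i x) \<longlonglongrightarrow> f x"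
    "\<And>i x. cmod (F i x) \<le> 2 * cmod (f x)"
    using borel_measurable_implies_sequence_metric[OF fm, of 0] by (auto simp: sp)
  have Fm [measurable]: "F i \<in> borel_measurable M" for i
    using F(1) by (rule borel_measurable_simple_function)
  have simple: "square_integrable M (F i) \<and> approximable M bounded_continuous (F i)" for i
  proof -
    have sets: "F i -` {y} \<in> sets M" for y
      using simple_functionD(2)[OF F(1), of i "{y}"] by (simp add: sp)
    have sq: "square_integrable M (indicator (F i -` {y}) :: 'a \<Rightarrow> complex)" for y
      by (rule bounded_measurable_square_integrable[where B = 1, OF M(1)]) (use sets in \<open>auto simp: indicator_def\<close>)
    have ap: "approximable M bounded_continuous (indicator (F i -` {y}))" for y
      using M sets by (intro approximable_indicator) auto
    have "square_integrable M (\<lambda>x. \<Sum>y\<in>Y. y * indicator (F i -` {y}) x) \<and>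
        approximable M bounded_continuous (\<lambda>x. \<Sum>y\<in>Y. y * indicator (F i -` {y}) x)" if "finite Y" for Y
      using that
    proof (induction Y rule: finite_induct)
      case empty
      have "(\<lambda>x. 0) \<in> (bounded_continuous :: ('a \<Rightarrow> complex) set)" by (rule bounded_continuousI[where B = 0]) auto
      then show ?case by (auto simp: square_integrable_def approximable_def intro!: bexI[of _ "\<lambda>x. 0"])
    next
      case (insert y Y)
      note IH = insert.IH[THEN conjunct1] insert.IH[THEN conjunct2]
      show ?case
        unfolding sum.insert[OF insert(1,2)]
        using approximable_add[OF M square_integrable_cmult[OF sq] approximable_cmult[OF ap] IH]
          square_integrable_add[OF square_integrable_cmult[OF sq] IH(1)] by blast
    qed
    from this[of "F i ` UNIV"] simple_functionD(1)[OF F(1), of i] sp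
    have "square_integrable M (\<lambda>x. \<Sum>y\<in>F i ` UNIV. y * indicator (F i -` {y}) x) \<and>
        approximable M bounded_continuous (\<lambda>x. \<Sum>y\<in>F i ` UNIV. y * indicator (F i -` {y}) x)" by simp
    moreover have "(\<Sum>y\<in>F i ` UNIV. y * indicator (F i -` {y}) x) = F i x" for x
      using simple_functionD(1)[OF F(1), of i]
      by (subst sum.remove[of _ "F i x"]) (auto simp: sp intro!: sum.neutral)
    ultimately show ?thesis by simp
  qed
  have lim: "(\<lambda>i. \<integral>x. (cmod (f x - F i x))\<^sup>2 \<partial>M) \<longlonglongrightarrow> (\<integral>x. 0 \<partial>M)"
  proof (rule integral_dominated_convergence)
    show "integrable M (\<lambda>x. 9 * (cmod (f x))\<^sup>2)" using fi by simp
    show "AE x in M. (\<lambda>i. (cmod (f x - F i x))\<^sup>2) \<longlonglongrightarrow> 0"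
    proof (rule AE_I2)
      fix x
      have "(\<lambda>i. (cmod (f x - F i x))\<^sup>2) \<longlonglongrightarrow> (cmod (f x - f x))\<^sup>2" by (intro tendsto_intros F)
      then show "(\<lambda>i. (cmod (f x - F i x))\<^sup>2) \<longlonglongrightarrow> 0" by simp
    qed
    fix i
    show "AE x in M. norm ((cmod (f x - F i x))\<^sup>2) \<le> 9 * (cmod (f x))\<^sup>2"
    proof (rule AE_I2)
      fix x
      have "cmod (f x - F i x) \<le> 3 * cmod (f x)" using F(3)[of i x] norm_triangle_ineq4[of "f x" "F i x"] by simp
      then have "(cmod (f x - F i x))\<^sup>2 \<le> (3 * cmod (f x))\<^sup>2" by (intro power_mono) auto
      then show "norm ((cmod (f x - F i x))\<^sup>2) \<le> 9 * (cmod (f x))\<^sup>2" by (simp add: power_mult_distrib)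
    qed
  qed auto
  fix \<epsilon> :: real assume "\<epsilon> > 0"
  then have "\<forall>\<^sub>F i in sequentially. (\<integral>x. (cmod (f x - F i x))\<^sup>2 \<partial>M) < \<epsilon>"
    using order_tendstoD(2)[OF lim] by simp
  then show "\<exists>g. square_integrable M g \<and> approximable M bounded_continuous g \<and> (\<integral>x. (cmod (f x - g x))\<^sup>2 \<partial>M) < \<epsilon>"
    using simple by (auto simp: eventually_sequentially)
qed

section \<open>Spectrality\<close>

definition expo_span :: "real set \<Rightarrow> (real \<Rightarrow> complex) set" where
  "expo_span \<Lambda> = {\<lambda>x. \<Sum>i\<in>F. c i * expo i x |F c. finite F \<and> F \<subseteq> \<Lambda>}"

definition digit_spectrum :: "nat set \<Rightarrow> real set" where
  "digit_spectrum S = freq ` {B. finite B \<and> B \<subseteq> S}"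

lemma continuous_expo [continuous_intros]: "continuous_on X (expo (l::real))"
  unfolding expo_def by (intro continuous_intros)

lemma expo_measurable [measurable]: "expo (l::real) \<in> borel_measurable borel"
  by (rule borel_measurable_continuous_onI) (rule continuous_expo)

lemma expo_bounded_continuous: "expo (l::real) \<in> bounded_continuous"
  by (rule bounded_continuousI[where B = 1]) (auto intro: continuous_expo)

lemma expo_span_bounded_continuous: "v \<in> expo_span \<Lambda> \<Longrightarrow> v \<in> bounded_continuous"
  by (auto simp: expo_span_def intro!: bounded_continuous_sum bounded_continuous_cmult expo_bounded_continuous)

lemma expo_spanI:
  assumes "finite F" "F \<subseteq> \<Lambda>" "\<And>x. v x = (\<Sum>i\<in>F. c i * expo i x)"
  shows "v \<in> expo_span \<Lambda>"
proof -
  have "v = (\<lambda>x. \<Sum>i\<in>F. c i * expo i x)" using assms(3) by (rule ext)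
  with assms(1,2) show ?thesis unfolding expo_span_def by blast
qed

lemma expo_span_add:
  assumes "u \<in> expo_span \<Lambda>" "v \<in> expo_span \<Lambda>"
  shows "(\<lambda>x. u x + v x) \<in> expo_span \<Lambda>"
proof -
  obtain F c where F: "finite F" "F \<subseteq> \<Lambda>" "u = (\<lambda>x. \<Sum>i\<in>F. c i * expo i x)"
    using assms unfolding expo_span_def by blast
  obtain G d where G: "finite G" "G \<subseteq> \<Lambda>" "v = (\<lambda>x. \<Sum>i\<in>G. d i * expo i x)"
    using assms unfolding expo_span_def by blast
  have "u x + v x = (\<Sum>i\<in>F \<union> G. ((if i \<in> F then c i else 0) + (if i \<in> G then d i else 0)) * expo i x)" for x
  proof -
    have "u x = (\<Sum>i\<in>F \<union> G. (if i \<in> F then c i else 0) * expo i x)"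
      unfolding F(3) using F G by (intro sum.mono_neutral_cong_left) auto
    moreover have "v x = (\<Sum>i\<in>F \<union> G. (if i \<in> G then d i else 0) * expo i x)"
      unfolding G(3) using F G by (intro sum.mono_neutral_cong_left) auto
    ultimately show ?thesis by (simp add: distrib_right sum.distrib)
  qed
  moreover have "finite (F \<union> G)" "F \<union> G \<subseteq> \<Lambda>" using F G by auto
  ultimately show ?thesis by (intro expo_spanI)
qed

text \<open>Coefficients in \<open>expo_span\<close> are indexed by frequencies; injectivity of
  \<open>freq\<close> allows indexing by digit sets instead.\<close>

lemma expo_span_freq:
  assumes "finite L" "L \<subseteq> S"
  shows "(\<lambda>x. \<Sum>B\<in>Pow L. c B * expo (freq B) x) \<in> expo_span (digit_spectrum S)"
proof -
  have inj: "inj_on freq (Pow L)"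
    by (rule inj_on_subset[OF inj_on_freq]) (use assms in \<open>auto intro: finite_subset\<close>)
  have "(\<Sum>B\<in>Pow L. c B * expo (freq B) x) = (\<Sum>i\<in>freq ` Pow L. c (the_inv_into (Pow L) freq i) * expo i x)" for x
    unfolding sum.reindex[OF inj] by (intro sum.cong) (auto simp: the_inv_into_f_f[OF inj])
  moreover have "finite (freq ` Pow L)" "freq ` Pow L \<subseteq> digit_spectrum S"
    using assms by (auto simp: digit_spectrum_def intro: finite_subset)
  ultimately show ?thesis by (intro expo_spanI)
qed

text \<open>The sum over all subsets factorises into \<open>expo l ((1/2) ^ Suc k) + 1\<close> over
  the positions \<open>k\<close>, where \<open>l\<close> is the difference of the frequencies. At
  the \<open>k\<close> of \<open>freq_diff_half_integer\<close> the factor vanishes.\<close>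

lemma sum_expo_freq_orthogonal:
  assumes L: "finite L" "A \<subseteq> L" "B \<subseteq> L"
  shows "(\<Sum>C\<in>Pow L. expo (freq A - freq B) (point C)) = (if A = B then 2 ^ card L else 0)"
proof (cases "A = B")
  case False
  have "finite A" "finite B" using L by (auto intro: finite_subset)
  with False obtain k where k: "k \<in> A \<union> B" "(freq A - freq B) * (1/2) ^ Suc k - 1 / 2 \<in> \<int>"
    by (metis freq_diff_half_integer)
  have "(\<Sum>C\<in>Pow L. expo (freq A - freq B) (point C)) = (\<Prod>k\<in>L. expo (freq A - freq B) ((1/2) ^ Suc k) + 1)"
    using L by (simp add: prod_add point_def expo_sum_right)
  also have "\<dots> = 0"
    using k L expo_half_integer[OF k(2)] by (intro prod_zero bexI[of _ k]) auto
  finally show ?thesis using False by simp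
qed (use L in \<open>simp add: card_Pow\<close>)

text \<open>With the previous lemma this says that the square matrix of the values
  \<open>expo (freq B) (point A)\<close> is unitary up to scaling: orthogonality in one index yields
  Parseval, in the other it yields interpolation.\<close>

lemma sum_expo_point_orthogonal:
  assumes L: "finite L" "A \<subseteq> L" "B \<subseteq> L"
  shows "(\<Sum>C\<in>Pow L. expo (freq C) (point A - point B)) = (if A = B then 2 ^ card L else 0)"
proof (cases "A = B")
  case False
  have "finite A" "finite B" using L by (auto intro: finite_subset)
  with False obtain k where k: "k \<in> A \<union> B" "2 ^ k * (point A - point B) - 1 / 2 \<in> \<int>"
    by (metis point_diff_half_integer)
  have "(\<Sum>C\<in>Pow L. expo (freq C) (point A - point B)) = (\<Prod>k\<in>L. expo (2 ^ k) (point A - point B) + 1)"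
    using L by (simp add: prod_add freq_def expo_sum_left)
  also have "\<dots> = 0"
    using k L expo_half_integer[OF k(2)] by (intro prod_zero bexI[of _ k]) auto
  finally show ?thesis using False by simp
qed (use L in \<open>simp add: card_Pow\<close>)

lemma sum_square_norm_orthogonal:
  fixes w :: "'b \<Rightarrow> complex" and e :: "'b \<Rightarrow> 'a \<Rightarrow> complex" and N :: real
  assumes "finite J"
    and orth: "\<And>b c. b \<in> J \<Longrightarrow> c \<in> J \<Longrightarrow> (\<Sum>a\<in>I. e b a * cnj (e c a)) = (if b = c then of_real N else 0)"
  shows "(\<Sum>a\<in>I. (cmod (\<Sum>b\<in>J. w b * e b a))\<^sup>2) = N * (\<Sum>b\<in>J. (cmod (w b))\<^sup>2)"
proof -
  have "complex_of_real (\<Sum>a\<in>I. (cmod (\<Sum>b\<in>J. w b * e b a))\<^sup>2) =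
      (\<Sum>a\<in>I. \<Sum>b\<in>J. \<Sum>c\<in>J. w b * cnj (w c) * (e b a * cnj (e c a)))"
    by (simp add: complex_norm_square sum_product cnj_sum algebra_simps del: of_real_power)
  also have "\<dots> = (\<Sum>b\<in>J. \<Sum>a\<in>I. \<Sum>c\<in>J. w b * cnj (w c) * (e b a * cnj (e c a)))"
    by (rule sum.swap)
  also have "\<dots> = (\<Sum>b\<in>J. \<Sum>c\<in>J. \<Sum>a\<in>I. w b * cnj (w c) * (e b a * cnj (e c a)))"
    by (intro sum.cong refl sum.swap)
  also have "\<dots> = (\<Sum>b\<in>J. \<Sum>c\<in>J. if b = c then w b * cnj (w c) * of_real N else 0)"
    by (intro sum.cong refl) (simp add: orth flip: sum_distrib_left)
  also have "\<dots> = (\<Sum>b\<in>J. w b * cnj (w b) * of_real N)"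
    using assms(1) by (intro sum.cong refl) (simp add: sum.delta)
  also have "\<dots> = complex_of_real (N * (\<Sum>b\<in>J. (cmod (w b))\<^sup>2))"
    by (simp add: complex_norm_square sum_distrib_left mult.commute del: of_real_power)
  finally show ?thesis by (simp only: of_real_eq_iff)
qed

lemma expo_level_parseval:
  assumes "finite L"
  shows "(\<Sum>A\<in>Pow L. (cmod (\<Sum>B\<in>Pow L. w B * expo (freq B) (point A)))\<^sup>2) =
    2 ^ card L * (\<Sum>B\<in>Pow L. (cmod (w B))\<^sup>2)"
  by (rule sum_square_norm_orthogonal)
     (use assms in \<open>auto simp: expo_mult_cnj_left sum_expo_freq_orthogonal\<close>)

text \<open>The coefficients come from the adjoint matrix divided by \<open>2 ^ card L\<close>,
  which is the inverse.\<close>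

lemma expo_level_interpolation:
  fixes f :: "nat set \<Rightarrow> complex"
  assumes "finite L" "A \<subseteq> L"
  defines "c \<equiv> \<lambda>B. (\<Sum>A'\<in>Pow L. f A' * cnj (expo (freq B) (point A'))) / 2 ^ card L"
  shows "(\<Sum>B\<in>Pow L. c B * expo (freq B) (point A)) = f A"
proof -
  have "(\<Sum>B\<in>Pow L. c B * expo (freq B) (point A)) =
      (\<Sum>B\<in>Pow L. \<Sum>A'\<in>Pow L. f A' * (expo (freq B) (point A) * cnj (expo (freq B) (point A')))) / 2 ^ card L"
    unfolding c_def sum_divide_distrib sum_distrib_right by (simp add: mult_ac)
  also have "(\<Sum>B\<in>Pow L. \<Sum>A'\<in>Pow L. f A' * (expo (freq B) (point A) * cnj (expo (freq B) (point A')))) =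
     (\<Sum>A'\<in>Pow L. \<Sum>B\<in>Pow L. f A' * (expo (freq B) (point A) * cnj (expo (freq B) (point A'))))"
    by (rule sum.swap)
  also have "\<dots> = (\<Sum>A'\<in>Pow L. if A = A' then f A' * 2 ^ card L else 0)"
    using assms by (intro sum.cong refl)
      (auto simp: expo_mult_cnj_right sum_expo_point_orthogonal simp flip: sum_distrib_left)
  also have "\<dots> = f A * 2 ^ card L" using assms by (simp add: sum.delta)
  finally show ?thesis by simp
qed

text \<open>For \<open>n\<close> beyond both digit sets the integral is the finite orthogonality sum
  of level \<open>n\<close> times an integral over the tail; the finite sum already
  vanishes.\<close>

lemma integral_expo_orthogonal:
  assumes "finite A" "A \<subseteq> S" "finite B" "B \<subseteq> S"
  shows "(\<integral>x. expo (freq A) x * cnj (expo (freq B) x) \<partial>digit_measure S) = (if A = B then 1 else 0)"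
proof (cases "A = B")
  case True
  interpret prob_space "digit_measure S" by (rule prob_space_digit_measure)
  show ?thesis using True by (simp add: expo_mult_cnj_left prob_space[simplified])
next
  case False
  obtain n where n: "A \<union> B \<subseteq> {..<n}"
    using assms finite_nat_bounded[of "A \<union> B"] by auto
  let ?L = "S \<inter> {..<n}"
  let ?l = "freq A - freq B"
  have "(\<integral>x. expo (freq A) x * cnj (expo (freq B) x) \<partial>digit_measure S) = (\<integral>x. expo ?l x \<partial>digit_measure S)"
    by (simp add: expo_mult_cnj_left)
  also have "\<dots> = (1/2) ^ card ?L *\<^sub>R
      (\<Sum>C\<in>Pow ?L. \<integral>y. expo ?l (point C + y / 2 ^ n) \<partial>digit_measure (tail_digits n S))"
    by (rule integral_digit_measure_level[where B = 1]) auto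
  also have "(\<Sum>C\<in>Pow ?L. \<integral>y. expo ?l (point C + y / 2 ^ n) \<partial>digit_measure (tail_digits n S)) =
      (\<Sum>C\<in>Pow ?L. expo ?l (point C)) * (\<integral>y. expo ?l (y / 2 ^ n) \<partial>digit_measure (tail_digits n S))"
    by (simp add: expo_add_right sum_distrib_right)
  also have "(\<Sum>C\<in>Pow ?L. expo ?l (point C)) = 0"
    using False assms n by (subst sum_expo_freq_orthogonal) auto
  finally show ?thesis using False by simp
qed

lemma AE_digit_measure_gap:
  assumes "S \<inter> {..<k} = {}"
  shows "AE x in digit_measure S. x \<in> {0..1 / 2 ^ k}"
proof (rule AE_mp[OF AE_digit_set], intro AE_I2 impI)
  fix x assume "x \<in> digit_set S"
  then have "x \<in> (\<Union>A\<in>Pow (S \<inter> {..<k}). {point A..point A + 1 / 2 ^ k})"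
    unfolding digit_set_def by (rule INT_D) simp
  then show "x \<in> {0..1 / 2 ^ k}" using assms by (simp add: point_def)
qed

text \<open>The symmetric weights 2 and 2 would give the contraction factor
  \<open>2 * 1/4 * 2 = 1\<close>, which is useless; the weight 3/2 on the main term brings it down
  to 3/4.\<close>

lemma square_norm_add_eps_le: "(cmod (a + b))\<^sup>2 \<le> (3/2) * (cmod a)\<^sup>2 + 3 * (cmod b)\<^sup>2"
proof -
  have "(cmod (a + b))\<^sup>2 \<le> (cmod a + cmod b)\<^sup>2" by (intro power_mono norm_triangle_ineq) auto
  also have "\<dots> \<le> (3/2) * (cmod a)\<^sup>2 + 3 * (cmod b)\<^sup>2"
    using zero_le_power2[of "cmod a - 2 * cmod b"] by (simp add: power2_eq_square algebra_simps)
  finally show ?thesis .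
qed

text \<open>
  The approximant interpolates \<open>f\<close> at the atoms of level \<open>n\<close>. For a frequency \<open>\<lambda> < 2\<^sup>n\<close> and a tail
  \<open>y / 2\<^sup>n\<close> with \<open>y \<le> 1/16\<close> the gap gives \<open>2 \<pi> \<lambda> y / 2\<^sup>n < 1/2\<close>, so Parseval at the atoms bounds
  the change of the approximant along the tail by half the norm of \<open>f\<close>.
\<close>

lemma digit_measure_contraction:
  assumes gap: "S \<inter> {n..<n + 4} = {}" and f: "f \<in> bounded_continuous"
    and unif: "\<And>x y. x \<in> {0..1} \<Longrightarrow> y \<in> {0..1} \<Longrightarrow> \<bar>x - y\<bar> \<le> 1 / 2 ^ n \<Longrightarrow> cmod (f x - f y) \<le> \<eta>"
  shows "\<exists>v\<in>expo_span (digit_spectrum S).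
    (\<integral>x. (cmod (f x - v x))\<^sup>2 \<partial>digit_measure S) \<le> 3/4 * (\<integral>x. (cmod (f x))\<^sup>2 \<partial>digit_measure S) + 4 * \<eta>\<^sup>2"
proof -
  let ?L = "S \<inter> {..<n}"
  let ?P = "digit_measure (tail_digits n S)"
  let ?N = "2 ^ card ?L :: real"
  interpret P: prob_space ?P by (rule prob_space_digit_measure)
  have finL: "finite ?L" by simp
  define c where "c = (\<lambda>B. (\<Sum>A\<in>Pow ?L. f (point A) * cnj (expo (freq B) (point A))) / 2 ^ card ?L)"
  define v where "v = (\<lambda>x. \<Sum>B\<in>Pow ?L. c B * expo (freq B) x)"
  have v_span: "v \<in> expo_span (digit_spectrum S)"
    unfolding v_def by (rule expo_span_freq) auto
  have v_point: "v (point A) = f (point A)" if "A \<in> Pow ?L" for A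
    unfolding v_def c_def
    using expo_level_interpolation[OF finL, of A "\<lambda>A. f (point A)"] that by simp
  have sum_c: "?N * (\<Sum>B\<in>Pow ?L. (cmod (c B))\<^sup>2) = (\<Sum>A\<in>Pow ?L. (cmod (f (point A)))\<^sup>2)"
    using expo_level_parseval[OF finL, of c] v_point unfolding v_def by simp
  have unif': "(cmod (f (point A + y / 2 ^ n) - f (point A)))\<^sup>2 \<le> \<eta>\<^sup>2"
    if A: "A \<in> Pow ?L" and y: "y \<in> {0..1}" for A y
  proof -
    \<comment> \<open>This keeps \<open>point A + y / 2 ^ n\<close> inside the unit interval, where
      the oscillation bound is available.\<close>
    have "0 \<le> point A" "point A \<le> 1 - 1 / 2 ^ n" using A point_nonneg point_le[of A n] by auto
    moreover have "0 \<le> y / 2 ^ n" "y / 2 ^ n \<le> 1 / 2 ^ n" using y by (auto simp: divide_right_mono)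
    ultimately have "cmod (f (point A + y / 2 ^ n) - f (point A)) \<le> \<eta>" by (intro unif) auto
    then show ?thesis by (intro power_mono) auto
  qed
  have key: "(\<Sum>A\<in>Pow ?L. (cmod (f (point A + y / 2 ^ n) - v (point A + y / 2 ^ n)))\<^sup>2) \<le>
      3/4 * (\<Sum>A\<in>Pow ?L. (cmod (f (point A + y / 2 ^ n)))\<^sup>2) + 4 * ?N * \<eta>\<^sup>2"
    if y: "y \<in> {0..1 / 2 ^ 4}" for y
  proof -
    have y': "y \<in> {0..1}" using y by auto
    \<comment> \<open>The change of \<open>v\<close> along the tail is again an exponential sum at
      the atoms, with coefficients \<open>w\<close>, so Parseval applies to it.\<close>
    define w where "w = (\<lambda>B. c B * (1 - expo (freq B) (y / 2 ^ n)))"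
    have w: "(cmod (w B))\<^sup>2 \<le> (1/4) * (cmod (c B))\<^sup>2" if B: "B \<in> Pow ?L" for B
    proof -
      have "freq B < 2 ^ n" "0 \<le> freq B" using B freq_nonneg by (auto intro: freq_less)
      then have "freq B * (y / 2 ^ n) \<le> 2 ^ n * (1 / 2 ^ 4 / 2 ^ n)"
        using y by (intro mult_mono divide_right_mono) auto
      then have "\<bar>freq B * (y / 2 ^ n)\<bar> \<le> 1 / 2 ^ 4" using \<open>0 \<le> freq B\<close> y by simp
      then have "2 * pi * \<bar>freq B * (y / 2 ^ n)\<bar> \<le> 2 * 4 * (1 / 2 ^ 4)"
        using pi_less_4 by (intro mult_mono) auto
      from order_trans[OF norm_expo_minus_1_le this]
      have "cmod (expo (freq B) (y / 2 ^ n) - 1) \<le> 1 / 2" by simp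
      then have "cmod (w B) \<le> cmod (c B) * (1/2)"
        unfolding w_def norm_mult by (intro mult_left_mono) (auto simp: norm_minus_commute)
      then have "(cmod (w B))\<^sup>2 \<le> (cmod (c B) * (1/2))\<^sup>2" by (intro power_mono) auto
      then show ?thesis by (simp add: power_mult_distrib power2_eq_square)
    qed
    have v_diff: "v (point A) - v (point A + y / 2 ^ n) = (\<Sum>B\<in>Pow ?L. w B * expo (freq B) (point A))" for A
      unfolding v_def w_def by (simp add: expo_add_right sum_subtractf[symmetric] algebra_simps)
    have "(\<Sum>A\<in>Pow ?L. (cmod (v (point A) - v (point A + y / 2 ^ n)))\<^sup>2) = ?N * (\<Sum>B\<in>Pow ?L. (cmod (w B))\<^sup>2)"
      unfolding v_diff by (rule expo_level_parseval[OF finL])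
    also have "\<dots> \<le> ?N * (\<Sum>B\<in>Pow ?L. (1/4) * (cmod (c B))\<^sup>2)"
      using w by (intro mult_left_mono sum_mono) auto
    also have "\<dots> = (1/4) * (\<Sum>A\<in>Pow ?L. (cmod (f (point A)))\<^sup>2)"
      using sum_c by (simp flip: sum_divide_distrib)
    finally have v_bound: "(\<Sum>A\<in>Pow ?L. (cmod (v (point A) - v (point A + y / 2 ^ n)))\<^sup>2) \<le>
        (1/4) * (\<Sum>A\<in>Pow ?L. (cmod (f (point A)))\<^sup>2)" .
    have eta: "(\<Sum>A\<in>Pow ?L. \<eta>\<^sup>2) = ?N * \<eta>\<^sup>2" by (simp add: card_Pow del: Pow_Int_eq)
    have nn: "0 \<le> ?N * \<eta>\<^sup>2" by simp
    have f_bound: "(\<Sum>A\<in>Pow ?L. (cmod (f (point A)))\<^sup>2) \<le>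
        (3/2) * (\<Sum>A\<in>Pow ?L. (cmod (f (point A + y / 2 ^ n)))\<^sup>2) + 3 * (?N * \<eta>\<^sup>2)"
      unfolding eta[symmetric] sum_distrib_left sum.distrib[symmetric]
    proof (rule sum_mono)
      fix A assume A: "A \<in> Pow ?L"
      have "(cmod (f (point A + y / 2 ^ n) + (f (point A) - f (point A + y / 2 ^ n))))\<^sup>2
          \<le> (3/2) * (cmod (f (point A + y / 2 ^ n)))\<^sup>2 + 3 * (cmod (f (point A) - f (point A + y / 2 ^ n)))\<^sup>2"
        by (rule square_norm_add_eps_le)
      then show "(cmod (f (point A)))\<^sup>2 \<le> 3/2 * (cmod (f (point A + y / 2 ^ n)))\<^sup>2 + 3 * \<eta>\<^sup>2"
        using unif'[OF A y'] by (simp add: norm_minus_commute)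
    qed
    \<comment> \<open>As \<open>v\<close> equals \<open>f\<close> at the atoms, the error is the
      change of \<open>f\<close> along the tail plus that of \<open>v\<close>.\<close>
    have "(\<Sum>A\<in>Pow ?L. (cmod (f (point A + y / 2 ^ n) - v (point A + y / 2 ^ n)))\<^sup>2) \<le>
      (\<Sum>A\<in>Pow ?L. 2 * \<eta>\<^sup>2 + 2 * (cmod (v (point A) - v (point A + y / 2 ^ n)))\<^sup>2)"
    proof (rule sum_mono)
      fix A assume A: "A \<in> Pow ?L"
      have "f (point A + y / 2 ^ n) - v (point A + y / 2 ^ n) =
          (f (point A + y / 2 ^ n) - f (point A)) + (v (point A) - v (point A + y / 2 ^ n))"
        using v_point[OF A] by simp
      then show "(cmod (f (point A + y / 2 ^ n) - v (point A + y / 2 ^ n)))\<^sup>2 \<le>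
          2 * \<eta>\<^sup>2 + 2 * (cmod (v (point A) - v (point A + y / 2 ^ n)))\<^sup>2"
        using square_norm_add_le[of "f (point A + y / 2 ^ n) - f (point A)" "v (point A) - v (point A + y / 2 ^ n)"]
          unif'[OF A y'] by simp
    qed
    also have "\<dots> = 2 * (?N * \<eta>\<^sup>2) + 2 * (\<Sum>A\<in>Pow ?L. (cmod (v (point A) - v (point A + y / 2 ^ n)))\<^sup>2)"
      unfolding eta[symmetric] by (simp only: sum.distrib sum_distrib_left)
    \<comment> \<open>Total constants: \<open>2 * 1/4 * 3/2 = 3/4\<close> for the norm of
      \<open>f\<close>, and \<open>2 + 2 * 1/4 * 3 = 7/2\<close>, rounded up to 4, for the
      oscillation.\<close>
    finally show ?thesis
      using v_bound f_bound nn by (simp only: mult.assoc)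
  qed
  have level: "(\<integral>x. (cmod (g x))\<^sup>2 \<partial>digit_measure S) =
      (1/2) ^ card ?L * (\<integral>y. (\<Sum>A\<in>Pow ?L. (cmod (g (point A + y / 2 ^ n)))\<^sup>2) \<partial>?P) \<and>
      integrable ?P (\<lambda>y. \<Sum>A\<in>Pow ?L. (cmod (g (point A + y / 2 ^ n)))\<^sup>2)"
    if g: "g \<in> bounded_continuous" for g
  proof -
    obtain B where B: "B > 0" "\<And>x. cmod (g x) \<le> B" "continuous_on UNIV g"
      using g by (metis bounded_continuousE)
    have [measurable]: "g \<in> borel_measurable borel" using B by (simp add: borel_measurable_continuous_onI)
    have bnd: "norm ((cmod (g x))\<^sup>2) \<le> B\<^sup>2" for x using B by (auto intro!: power_mono)
    have int: "integrable ?P (\<lambda>y. (cmod (g (point A + y / 2 ^ n)))\<^sup>2)" for A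
      by (rule P.integrable_const_bound[where B = "B\<^sup>2"]) (use bnd in auto)
    have "(\<integral>x. (cmod (g x))\<^sup>2 \<partial>digit_measure S) = (1/2) ^ card ?L *\<^sub>R
        (\<Sum>A\<in>Pow ?L. \<integral>y. (cmod (g (point A + y / 2 ^ n)))\<^sup>2 \<partial>?P)"
      by (rule integral_digit_measure_level[where B = "B\<^sup>2"]) (use bnd in auto)
    then show ?thesis using int by (simp add: Bochner_Integration.integral_sum)
  qed
  have fv: "(\<lambda>x. f x - v x) \<in> bounded_continuous"
    using bounded_continuous_add[OF f bounded_continuous_cmult[OF expo_span_bounded_continuous[OF v_span], of "-1"]]
    by simp
  \<comment> \<open>After the shift by \<open>n\<close> the gap occupies the first four positions of
    the tail.\<close>
  have "AE y in ?P. y \<in> {0..1 / 2 ^ 4}"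
    by (rule AE_digit_measure_gap) (use gap in \<open>force simp: tail_digits_def\<close>)
  then have "(\<integral>y. (\<Sum>A\<in>Pow ?L. (cmod (f (point A + y / 2 ^ n) - v (point A + y / 2 ^ n)))\<^sup>2) \<partial>?P) \<le>
      (\<integral>y. 3/4 * (\<Sum>A\<in>Pow ?L. (cmod (f (point A + y / 2 ^ n)))\<^sup>2) + 4 * ?N * \<eta>\<^sup>2 \<partial>?P)"
    using level[OF f] level[OF fv] key by (intro integral_mono_AE) (auto intro: AE_mp)
  also have "\<dots> = 3/4 * (\<integral>y. (\<Sum>A\<in>Pow ?L. (cmod (f (point A + y / 2 ^ n)))\<^sup>2) \<partial>?P) + 4 * ?N * \<eta>\<^sup>2"
    using level[OF f] P.prob_space by (simp add: Bochner_Integration.integral_add)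
  finally have "(1/2) ^ card ?L * (\<integral>y. (\<Sum>A\<in>Pow ?L. (cmod (f (point A + y / 2 ^ n) - v (point A + y / 2 ^ n)))\<^sup>2) \<partial>?P)
     \<le> (1/2) ^ card ?L * (3/4 * (\<integral>y. (\<Sum>A\<in>Pow ?L. (cmod (f (point A + y / 2 ^ n)))\<^sup>2) \<partial>?P) + 4 * ?N * \<eta>\<^sup>2)"
    by (rule mult_left_mono) simp
  also have "\<dots> = 3/4 * (\<integral>x. (cmod (f x))\<^sup>2 \<partial>digit_measure S) + 4 * \<eta>\<^sup>2"
    using level[OF f] by (simp add: algebra_simps power_one_over)
  finally have "(\<integral>x. (cmod (f x - v x))\<^sup>2 \<partial>digit_measure S) \<le> 3/4 * (\<integral>x. (cmod (f x))\<^sup>2 \<partial>digit_measure S) + 4 * \<eta>\<^sup>2"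
    using level[OF fv] by simp
  then show ?thesis using v_span by blast
qed

lemma approximable_expo_span_bounded_continuous:
  assumes gaps: "\<And>m. \<exists>n\<ge>m. S \<inter> {n..<n + 4} = {}" and f: "f \<in> bounded_continuous"
  shows "approximable (digit_measure S) (expo_span (digit_spectrum S)) f"
proof -
  let ?V = "expo_span (digit_spectrum S)"
  define err where "err = (\<lambda>v. \<integral>x. (cmod (f x - v x))\<^sup>2 \<partial>digit_measure S)"
  \<comment> \<open>Applying the contraction to \<open>f - u\<close> for \<open>u\<close> in the span gives \<open>q \<le> 3/4 q\<close>.\<close>
  define q where "q = Inf (err ` ?V)"
  have zero: "(\<lambda>x. 0) \<in> ?V" unfolding expo_span_def by (rule CollectI, rule exI[of _ "{}"]) auto
  have bdd: "bdd_below (err ` ?V)"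
    by (rule bdd_belowI[where m = 0]) (auto simp: err_def)
  have q_le: "q \<le> 3/4 * err u" if u: "u \<in> ?V" for u
  proof (rule field_le_epsilon)
    fix e :: real assume "e > 0"
    define \<eta> where "\<eta> = sqrt (e / 4)"
    have \<eta>: "\<eta> > 0" "4 * \<eta>\<^sup>2 = e" using \<open>e > 0\<close> by (auto simp: \<eta>_def)
    define g where "g = (\<lambda>x. f x - u x)"
    have g: "g \<in> bounded_continuous"
      using bounded_continuous_add[OF f bounded_continuous_cmult[OF expo_span_bounded_continuous[OF u], of "-1"]]
      by (simp add: g_def)
    then have "continuous_on {0..1} g" by (auto simp: bounded_continuous_def intro: continuous_on_subset)
    then have "uniformly_continuous_on {0..1} g" by (rule compact_uniformly_continuous) simp
    then obtain d where d: "d > 0" "\<And>x y. x \<in> {0..1} \<Longrightarrow> y \<in> {0..1} \<Longrightarrow> \<bar>x - y\<bar> < d \<Longrightarrow> cmod (g x - g y) < \<eta>"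
      unfolding uniformly_continuous_on_def dist_norm using \<eta>(1) by (metis norm_minus_commute real_norm_def)
    obtain m where m: "(1/2) ^ m < d" using real_arch_pow_inv[of d "1/2"] d by auto
    \<comment> \<open>The level depends on the residual \<open>g\<close>, through its modulus of
      continuity.\<close>
    obtain n where n: "n \<ge> m" "S \<inter> {n..<n + 4} = {}" using gaps by blast
    have "(1/2::real) ^ n \<le> (1/2) ^ m" using n by (intro power_decreasing) auto
    then have nd: "1 / 2 ^ n < d" using m by (simp add: power_one_over)
    have "cmod (g x - g y) \<le> \<eta>" if "x \<in> {0..1}" "y \<in> {0..1}" "\<bar>x - y\<bar> \<le> 1 / 2 ^ n" for x y
      using d(2)[OF that(1,2)] that(3) nd by auto
    from digit_measure_contraction[OF n(2) g this]
    obtain v where v: "v \<in> ?V" "(\<integral>x. (cmod (g x - v x))\<^sup>2 \<partial>digit_measure S) \<le>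
        3/4 * (\<integral>x. (cmod (g x))\<^sup>2 \<partial>digit_measure S) + 4 * \<eta>\<^sup>2" by blast
    have "q \<le> err (\<lambda>x. u x + v x)"
      unfolding q_def by (intro cINF_lower bdd expo_span_add u v)
    also have "\<dots> \<le> 3/4 * err u + e" using v(2) \<eta>(2) by (simp add: err_def g_def algebra_simps)
    finally show "q \<le> 3/4 * err u + e" .
  qed
  have "4/3 * q \<le> q"
    unfolding q_def using zero q_le[unfolded q_def] by (intro cINF_greatest) (auto, force)
  then have "q \<le> 0" by simp
  show ?thesis
    unfolding approximable_def
  proof (intro allI impI)
    fix \<epsilon> :: real assume "\<epsilon> > 0"
    then have "Inf (err ` ?V) < \<epsilon>" using \<open>q \<le> 0\<close> by (simp add: q_def)
    then obtain v where "v \<in> ?V" "err v < \<epsilon>"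
      using cInf_lessD[of "err ` ?V" \<epsilon>] zero by auto
    then show "\<exists>v\<in>?V. (\<integral>x. (cmod (f x - v x))\<^sup>2 \<partial>digit_measure S) < \<epsilon>" by (auto simp: err_def)
  qed
qed

lemma compactly_supported_digit_measure: "compactly_supported_borel_prob (digit_measure S)"
  unfolding compactly_supported_borel_prob_def
  by (simp add: prob_space_digit_measure msupport_digit_measure compact_digit_set)

text \<open>The gaps enter through completeness: square-integrable functions are approximated by
  bounded continuous ones, and these by the span.\<close>

lemma spectral_digit_measure:
  assumes gaps: "\<And>m. \<exists>n\<ge>m. S \<inter> {n..<n + 4} = {}"
  shows "spectral_measure (digit_measure S)"
  unfolding spectral_measure_def
proof (intro conjI exI)
  let ?M = "digit_measure S" and ?V = "expo_span (digit_spectrum S)"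
  interpret prob_space ?M by (rule prob_space_digit_measure)
  have fm: "finite_measure ?M" by (rule finite_measure_axioms)
  show "compactly_supported_borel_prob ?M" by (rule compactly_supported_digit_measure)
  show "countable (digit_spectrum S)"
    unfolding digit_spectrum_def
    by (intro countable_image countable_subset[OF _ countable_Collect_finite]) auto
  show "orthonormal_basis_L2 ?M (digit_spectrum S) expo"
    unfolding orthonormal_basis_L2_def
  proof (intro conjI ballI allI impI)
    fix i assume i: "i \<in> digit_spectrum S"
    show "square_integrable ?M (expo i)"
      by (rule bounded_continuous_square_integrable[OF fm _ expo_bounded_continuous]) simp
    fix j assume j: "j \<in> digit_spectrum S"
    obtain A where A: "i = freq A" "finite A" "A \<subseteq> S" using i by (auto simp: digit_spectrum_def)
    obtain B where B: "j = freq B" "finite B" "B \<subseteq> S" using j by (auto simp: digit_spectrum_def)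
    have "freq A = freq B \<longleftrightarrow> A = B" using inj_on_freq A B by (auto simp: inj_on_def)
    then show "(\<integral>x. expo i x * cnj (expo j x) \<partial>?M) = (if i = j then 1 else 0)"
      using integral_expo_orthogonal[of A S B] A B by simp
  next
    fix f and \<epsilon> :: real assume f: "square_integrable ?M f" and \<epsilon>: "\<epsilon> > 0"
    have "approximable ?M ?V f"
    proof (rule approximable_trans[OF f])
      show "square_integrable ?M v" if "v \<in> ?V" for v
        using that by (intro bounded_continuous_square_integrable[OF fm] expo_span_bounded_continuous) auto
      fix e :: real assume "e > 0"
      moreover have "approximable ?M bounded_continuous f"
        using f fm by (intro approximable_bounded_continuous) auto
      ultimately obtain g where g: "g \<in> bounded_continuous" "(\<integral>x. (cmod (f x - g x))\<^sup>2 \<partial>?M) < e"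
        unfolding approximable_def by blast
      then show "\<exists>g. square_integrable ?M g \<and> approximable ?M ?V g \<and> (\<integral>x. (cmod (f x - g x))\<^sup>2 \<partial>?M) < e"
        using bounded_continuous_square_integrable[OF fm _ g(1)]
          approximable_expo_span_bounded_continuous[OF gaps g(1)] by auto
    qed
    moreover have "\<epsilon>\<^sup>2 > 0" using \<epsilon> by simp
    ultimately obtain v where v: "v \<in> ?V" "(\<integral>x. (cmod (f x - v x))\<^sup>2 \<partial>?M) < \<epsilon>\<^sup>2"
      unfolding approximable_def by blast
    then obtain F c where F: "finite F" "F \<subseteq> digit_spectrum S" "v = (\<lambda>x. \<Sum>i\<in>F. c i * expo i x)"
      unfolding expo_span_def by blast
    have "sqrt (\<integral>x. (cmod (f x - v x))\<^sup>2 \<partial>?M) < \<epsilon>"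
      using v(2) \<epsilon> by (intro real_less_lsqrt) auto
    then show "\<exists>F c. finite F \<and> F \<subseteq> digit_spectrum S \<and> sqrt (\<integral>x. (cmod (f x - (\<Sum>i\<in>F. c i * expo i x)))\<^sup>2 \<partial>?M) < \<epsilon>"
      using F by blast
  qed
qed

section \<open>Assouad and lower dimension\<close>

abbreviation digit_count :: "nat set \<Rightarrow> nat \<Rightarrow> nat" where
  "digit_count S n \<equiv> card (S \<inter> {..<n})"

lemma half_power_eq_powr: "(1/2::real) ^ k = 2 powr (- real k)"
  by (simp add: powr_minus powr_realpow power_one_over inverse_eq_divide)

lemma one_div_power_eq_powr: "1 / 2 ^ k = (2::real) powr (- real k)"
  by (simp add: powr_minus powr_realpow inverse_eq_divide)

text \<open>The strict and the weak inequality match the requirements of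
  \<open>measure_ball_ge\<close> and \<open>measure_ball_le\<close>.\<close>

lemma dyadic_scale:
  fixes r :: real
  assumes "0 < r" "r \<le> 1"
  obtains n where "1 / 2 ^ Suc n < r" "r \<le> 1 / 2 ^ n"
proof -
  define m where "m = (LEAST m. 1 / 2 ^ m < r)"
  obtain k where "(1/2) ^ k < r" using real_arch_pow_inv[of r "1/2"] assms by auto
  then have "1 / 2 ^ k < r" by (simp add: power_one_over)
  then have m: "1 / 2 ^ m < r" unfolding m_def by (rule LeastI)
  have "m \<noteq> 0" using m assms by (intro notI) simp
  then obtain n where n: "m = Suc n" by (cases m) auto
  have "\<not> 1 / 2 ^ n < r" using not_less_Least[of n "\<lambda>m. 1 / 2 ^ m < r"] n by (simp add: m_def)
  then show ?thesis using that m n by (auto simp: not_less)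
qed

lemma dyadic_less_imp_less:
  assumes "1 / 2 ^ m < (1 / 2 ^ n :: real)" shows "n < m"
  using assms by (simp add: field_simps)

lemma digit_count_mono: "n \<le> m \<Longrightarrow> digit_count S n \<le> digit_count S m"
  by (intro card_mono) auto

lemma digit_count_Suc_le: "digit_count S (Suc n) \<le> digit_count S n + 1"
proof -
  have "S \<inter> {..<Suc n} \<subseteq> insert n (S \<inter> {..<n})" by (auto simp: less_Suc_eq)
  then have "digit_count S (Suc n) \<le> card (insert n (S \<inter> {..<n}))" by (intro card_mono) auto
  also have "\<dots> = digit_count S n + 1" by simp
  finally show ?thesis .
qed

lemma measure_ball_pos:
  assumes "x \<in> digit_set S" "0 < r" shows "0 < measure (digit_measure S) (ball x r)"
proof -
  obtain k where "(1/2) ^ k < r" using real_arch_pow_inv[of r "1/2"] assms by auto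
  then have "(1/2) ^ digit_count S k \<le> measure (digit_measure S) (ball x r)"
    by (intro measure_ball_ge assms) (simp add: power_one_over)
  moreover have "0 < (1/2::real) ^ digit_count S k" by simp
  ultimately show ?thesis by linarith
qed

lemma measure_ball_le:
  assumes "r \<le> 1 / 2 ^ n"
  shows "measure (digit_measure S) (ball x r) \<le> 4 * (1/2) ^ digit_count S n"
proof -
  interpret prob_space "digit_measure S" by (rule prob_space_digit_measure)
  have "prob (ball x r) \<le> prob (cball x r)" by (intro finite_measure_mono) auto
  then show ?thesis using measure_cball_le[OF assms, of S x] by linarith
qed

lemma ball_ratio_le:
  assumes x: "x \<in> digit_set S" and R: "R \<le> 1 / 2 ^ n" and r: "1 / 2 ^ m < r"
  shows "measure (digit_measure S) (ball x R) / measure (digit_measure S) (ball x r)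
    \<le> 4 * 2 powr (real (digit_count S m) - real (digit_count S n))"
proof -
  have "measure (digit_measure S) (ball x R) / measure (digit_measure S) (ball x r)
    \<le> (4 * (1/2) ^ digit_count S n) / (1/2) ^ digit_count S m"
    by (intro frac_le measure_ball_le measure_ball_ge assms) auto
  also have "\<dots> = 4 * 2 powr (real (digit_count S m) - real (digit_count S n))"
    by (simp add: powr_diff powr_realpow power_one_over)
  finally show ?thesis .
qed

lemma ball_ratio_ge:
  assumes x: "x \<in> digit_set S" and R: "1 / 2 ^ n < R" and r: "0 < r" "r \<le> 1 / 2 ^ m"
  shows "measure (digit_measure S) (ball x R) / measure (digit_measure S) (ball x r)
    \<ge> 1/4 * 2 powr (real (digit_count S m) - real (digit_count S n))"
proof -
  have "1/4 * 2 powr (real (digit_count S m) - real (digit_count S n))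
      = (1/2) ^ digit_count S n / (4 * (1/2) ^ digit_count S m)"
    by (simp add: powr_diff powr_realpow power_one_over)
  also have "\<dots> \<le> measure (digit_measure S) (ball x R) / measure (digit_measure S) (ball x r)"
    by (intro frac_le measure_ball_le measure_ball_ge measure_ball_pos assms) auto
  finally show ?thesis .
qed

text \<open>Turns an admissible exponent into a bound on it: the constant \<open>D\<close> cannot
  absorb an exponential in \<open>k\<close>. The case \<open>k = 0\<close> is left out because the
  radii in the dimension conditions must be distinct.\<close>

lemma powr_growth_le:
  assumes D: "D > 0" and "\<And>k::nat. k \<ge> 1 \<Longrightarrow> 2 powr (a * real k) \<le> D * 2 powr (b * real k)"
  shows "a \<le> b"
proof (rule ccontr)
  assume "\<not> a \<le> b"
  then have "1 < 2 powr (a - b)" by simp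
  then obtain k where "D < (2 powr (a - b)) ^ k" using real_arch_pow by blast
  also have "\<dots> \<le> (2 powr (a - b)) ^ Suc k" using \<open>1 < 2 powr (a - b)\<close> by (intro power_increasing) auto
  also have "\<dots> = 2 powr (a * real (Suc k) - b * real (Suc k))"
    by (simp add: powr_powr algebra_simps del: power_Suc flip: powr_realpow)
  also have "\<dots> \<le> D" using assms(2)[of "Suc k"] by (simp add: powr_diff field_simps)
  finally show False by simp
qed

lemma digit_set_nonempty: "digit_set S \<noteq> {}"
proof -
  have "0 \<in> digit_set S" unfolding digit_set_def by (intro INT_I UN_I[of "{}"]) (auto simp: point_def)
  then show ?thesis by auto
qed

lemma assouad_dim_le:
  assumes t: "t \<ge> 0"
    and count: "\<And>n m. n \<le> m \<Longrightarrow> real (digit_count S m) - real (digit_count S n) \<le> t * (real m - real n) + C"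
  shows "assouad_dim (digit_measure S) \<le> ereal t"
proof -
  let ?\<mu> = "digit_measure S"
  have "measure ?\<mu> (ball x R) / measure ?\<mu> (ball x r) \<le> 4 * 2 powr (C + 2 * t) * (R / r) powr t"
    if x: "x \<in> msupport ?\<mu>" and r: "0 < r" "r < R" "R < diameter (msupport ?\<mu>)" for x r R
  proof -
    have R1: "R \<le> 1" using r diameter_digit_set_le[of S] by (simp add: msupport_digit_measure)
    obtain n where n: "1 / 2 ^ Suc n < R" "R \<le> 1 / 2 ^ n" using dyadic_scale[of R] r R1 by auto
    obtain m where m: "1 / 2 ^ Suc m < r" "r \<le> 1 / 2 ^ m" using dyadic_scale[of r] r R1 by auto
    have nm: "n < Suc m" using m n r by (intro dyadic_less_imp_less) linarith
    have "measure ?\<mu> (ball x R) / measure ?\<mu> (ball x r)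
        \<le> 4 * 2 powr (real (digit_count S (Suc m)) - real (digit_count S n))"
      using ball_ratio_le[OF _ n(2) m(1)] x by (simp add: msupport_digit_measure)
    also have "\<dots> \<le> 4 * 2 powr (t * (real (Suc m) - real n) + C)"
      using count[of n "Suc m"] nm by simp
    \<comment> \<open>Rounding both radii to dyadic scales costs two steps, hence the
      \<open>2 * t\<close> in the constant.\<close>
    also have "\<dots> = 4 * 2 powr (C + 2 * t) * (2 powr (real m - real (Suc n))) powr t"
      by (simp add: powr_powr algebra_simps flip: powr_add)
    also have "2 powr (real m - real (Suc n)) = (1 / 2 ^ Suc n) / (1 / 2 ^ m)"
      unfolding one_div_power_eq_powr by (simp add: algebra_simps flip: powr_diff)
    also have "((1 / 2 ^ Suc n) / (1 / 2 ^ m)) powr t \<le> (R / r) powr t"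
      using n m r t by (intro powr_mono2 frac_le) auto
    finally show ?thesis by simp
  qed
  then show ?thesis
    unfolding assouad_dim_def using t
    by (intro Inf_lower imageI CollectI conjI exI[of _ "4 * 2 powr (C + 2 * t)"]) auto
qed

lemma assouad_dim_ge:
  assumes S: "S \<noteq> {}"
    and count: "\<And>k n\<^sub>0. \<exists>n\<ge>n\<^sub>0. real (digit_count S (n + k)) - real (digit_count S n) \<ge> t * real k - C"
  shows "ereal t \<le> assouad_dim (digit_measure S)"
  unfolding assouad_dim_def
proof (safe intro!: Inf_greatest, simp only: ereal_less_eq)
  let ?\<mu> = "digit_measure S"
  fix s D :: real assume s: "0 \<le> s" and D: "D > 0"
    and adm: "\<forall>r R. \<forall>x\<in>msupport ?\<mu>. 0 < r \<longrightarrow> r < R \<longrightarrow> R < diameter (msupport ?\<mu>) \<longrightarrow>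
      measure ?\<mu> (ball x R) / measure ?\<mu> (ball x r) \<le> D * (R / r) powr s"
  have diam: "diameter (digit_set S) > 0" using S diameter_digit_set_pos by blast
  then obtain n\<^sub>0 where n0: "(1/2) ^ n\<^sub>0 < diameter (digit_set S)"
    using real_arch_pow_inv[of "diameter (digit_set S)" "1/2"] by auto
  obtain x where x: "x \<in> digit_set S" using digit_set_nonempty by blast
  show "t \<le> s"
  proof (rule powr_growth_le)
    show "D * 2 powr (C + 3) > 0" using D by simp
    fix k :: nat assume k: "k \<ge> 1"
    obtain n where n: "n \<ge> n\<^sub>0" "real (digit_count S (n + k)) - real (digit_count S n) \<ge> t * real k - C"
      using count by blast
    have "(1/2::real) ^ n \<le> (1/2) ^ n\<^sub>0" using n by (intro power_decreasing) auto
    then have nd: "1 / 2 ^ n < diameter (digit_set S)" using n0 by (simp add: power_one_over)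
    have lt: "1 / 2 ^ (n + k) < (1 / 2 ^ n :: real)" using k by (intro divide_strict_left_mono power_strict_increasing) auto
    \<comment> \<open>Of the 3, one pays for \<open>Suc n\<close> in place of \<open>n\<close>,
      since \<open>ball_ratio_ge\<close> needs a strictly larger radius, and two pay for its factor
      \<open>1/4\<close>.\<close>
    have "2 powr (t * real k - C - 3) \<le>
        2 powr (real (digit_count S (n + k)) - real (digit_count S (Suc n)) - 2)"
      using n(2) digit_count_Suc_le[of S n] by (intro powr_mono) linarith+
    also have "\<dots> = 1/4 * 2 powr (real (digit_count S (n + k)) - real (digit_count S (Suc n)))"
      by (simp add: powr_diff)
    also have "\<dots> \<le> measure ?\<mu> (ball x (1 / 2 ^ n)) / measure ?\<mu> (ball x (1 / 2 ^ (n + k)))"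
      by (rule ball_ratio_ge) (use x in \<open>auto simp: field_simps\<close>)
    also have "\<dots> \<le> D * ((1 / 2 ^ n) / (1 / 2 ^ (n + k))) powr s"
      using adm x lt nd unfolding msupport_digit_measure by (metis zero_less_divide_1_iff zero_less_numeral zero_less_power)
    also have "((1 / 2 ^ n) / (1 / 2 ^ (n + k)) :: real) = 2 powr real k"
      by (simp add: power_add powr_realpow)
    finally show "2 powr (t * real k) \<le> D * 2 powr (C + 3) * 2 powr (s * real k)"
      by (simp add: powr_powr powr_diff powr_add field_simps)
  qed
qed

lemma lower_dim_ge:
  assumes t: "t \<ge> 0"
    and count: "\<And>n m. n \<le> m \<Longrightarrow> real (digit_count S m) - real (digit_count S n) \<ge> t * (real m - real n) - C"
  shows "ereal t \<le> lower_dim (digit_measure S)"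
proof -
  let ?\<mu> = "digit_measure S"
  \<comment> \<open>The \<open>t\<close> accounts for \<open>r\<close> being only above
    \<open>1 / 2 ^ Suc m\<close>; the 3 covers \<open>Suc n\<close> in place of \<open>n\<close> and
    the factor \<open>1/4\<close>.\<close>
  let ?D = "2 powr (- C - 3 - t)"
  have "measure ?\<mu> (ball x R) / measure ?\<mu> (ball x r) \<ge> ?D * (R / r) powr t"
    if x: "x \<in> msupport ?\<mu>" and r: "0 < r" "r < R" "R < diameter (msupport ?\<mu>)" for x r R
  proof -
    have R1: "R \<le> 1" using r diameter_digit_set_le[of S] by (simp add: msupport_digit_measure)
    obtain n where n: "1 / 2 ^ Suc n < R" "R \<le> 1 / 2 ^ n" using dyadic_scale[of R] r R1 by auto
    obtain m where m: "1 / 2 ^ Suc m < r" "r \<le> 1 / 2 ^ m" using dyadic_scale[of r] r R1 by auto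
    have nm: "n < Suc m" using m n r by (intro dyadic_less_imp_less) linarith
    have "?D * (R / r) powr t \<le> ?D * ((1 / 2 ^ n) / (1 / 2 ^ Suc m)) powr t"
      using n m r t by (intro mult_left_mono powr_mono2 frac_le) auto
    also have "((1 / 2 ^ n) / (1 / 2 ^ Suc m)) = 2 powr (real (Suc m) - real n)"
      unfolding one_div_power_eq_powr by (simp add: algebra_simps flip: powr_diff)
    also have "?D * (2 powr (real (Suc m) - real n)) powr t = 2 powr (t * (real m - real n) - C - 3)"
      by (simp add: powr_powr algebra_simps flip: powr_add)
    also have "\<dots> \<le> 2 powr (real (digit_count S m) - real (digit_count S (Suc n)) - 2)"
      using count[of n m] nm digit_count_Suc_le[of S n] by (intro powr_mono) linarith+
    also have "\<dots> = 1/4 * 2 powr (real (digit_count S m) - real (digit_count S (Suc n)))"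
      by (simp add: powr_diff)
    also have "\<dots> \<le> measure ?\<mu> (ball x R) / measure ?\<mu> (ball x r)"
      by (rule ball_ratio_ge) (use x n m r in \<open>auto simp: msupport_digit_measure\<close>)
    finally show ?thesis .
  qed
  then show ?thesis
    unfolding lower_dim_def using t
    by (intro Sup_upper imageI CollectI conjI exI[of _ ?D]) auto
qed

lemma lower_dim_le:
  assumes S: "S \<noteq> {}"
    and count: "\<And>k n\<^sub>0. \<exists>n\<ge>n\<^sub>0. real (digit_count S (n + k)) - real (digit_count S n) \<le> t * real k + C"
  shows "lower_dim (digit_measure S) \<le> ereal t"
  unfolding lower_dim_def
proof (safe intro!: Sup_least, simp only: ereal_less_eq)
  let ?\<mu> = "digit_measure S"
  fix s D :: real assume s: "0 \<le> s" and D: "D > 0"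
    and adm: "\<forall>r R. \<forall>x\<in>msupport ?\<mu>. 0 < r \<longrightarrow> r < R \<longrightarrow> R < diameter (msupport ?\<mu>) \<longrightarrow>
      measure ?\<mu> (ball x R) / measure ?\<mu> (ball x r) \<ge> D * (R / r) powr s"
  have diam: "diameter (digit_set S) > 0" using S diameter_digit_set_pos by blast
  then obtain n\<^sub>0 where n0: "(1/2) ^ n\<^sub>0 < diameter (digit_set S)"
    using real_arch_pow_inv[of "diameter (digit_set S)" "1/2"] by auto
  obtain x where x: "x \<in> digit_set S" using digit_set_nonempty by blast
  show "s \<le> t"
  proof (rule powr_growth_le)
    show "2 powr (C + 3) / D > 0" using D by simp
    fix k :: nat assume k: "k \<ge> 1"
    obtain n where n: "n \<ge> n\<^sub>0" "real (digit_count S (n + k)) - real (digit_count S n) \<le> t * real k + C"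
      using count by blast
    have "(1/2::real) ^ n \<le> (1/2) ^ n\<^sub>0" using n by (intro power_decreasing) auto
    then have nd: "1 / 2 ^ n < diameter (digit_set S)" using n0 by (simp add: power_one_over)
    have lt: "1 / 2 ^ (n + k) < (1 / 2 ^ n :: real)" using k by (intro divide_strict_left_mono power_strict_increasing) auto
    have "D * (2 powr real k) powr s = D * ((1 / 2 ^ n) / (1 / 2 ^ (n + k))) powr s"
      by (simp add: power_add powr_realpow)
    also have "\<dots> \<le> measure ?\<mu> (ball x (1 / 2 ^ n)) / measure ?\<mu> (ball x (1 / 2 ^ (n + k)))"
      using adm x lt nd unfolding msupport_digit_measure by (metis zero_less_divide_1_iff zero_less_numeral zero_less_power)
    also have "\<dots> \<le> 4 * 2 powr (real (digit_count S (Suc (n + k))) - real (digit_count S n))"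
      by (rule ball_ratio_le) (use x in \<open>auto simp: field_simps\<close>)
    also have "\<dots> = 2 powr (real (digit_count S (Suc (n + k))) - real (digit_count S n) + 2)"
      by (simp add: powr_add)
    \<comment> \<open>The 3 consists of 2 for the factor 4 and 1 for the digit at position
      \<open>n + k\<close>.\<close>
    also have "\<dots> \<le> 2 powr (t * real k + (C + 3))"
      using n(2) digit_count_Suc_le[of S "n + k"] by (intro powr_mono) linarith+
    finally show "2 powr (s * real k) \<le> 2 powr (C + 3) / D * 2 powr (t * real k)"
      using D by (simp add: powr_powr powr_add field_simps)
  qed
qed

section \<open>Hausdorff and packing dimension\<close>

lemma dyadic_powr: "(1 / 2 ^ n) powr s = (2::real) powr (- (s * real n))"
  by (simp add: one_div_power_eq_powr powr_powr mult.commute)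

lemma emeasure_cball_le:
  assumes "r \<le> 1 / 2 ^ n"
  shows "emeasure (digit_measure S) (cball x r) \<le> ennreal (4 * 2 powr (- real (digit_count S n)))"
proof -
  interpret prob_space "digit_measure S" by (rule prob_space_digit_measure)
  show ?thesis
    using measure_cball_le[OF assms, of S x] by (simp add: emeasure_eq_measure half_power_eq_powr)
qed

text \<open>A bounded set lies in a closed ball whose radius is its diameter. Covering sets need not
  be Borel, so the bound is stated for a Borel superset; for \<open>s = 0\<close> and nonempty
  \<open>U\<close> the whole line serves.\<close>

lemma cover_set_mass:
  assumes s: "s \<ge> 0" and count: "\<And>n. n \<ge> n\<^sub>0 \<Longrightarrow> real (digit_count S n) \<ge> s * real n"
    and U: "bounded U" "diameter U \<le> 1 / 2 ^ n\<^sub>0"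
  shows "\<exists>D\<in>sets borel. U \<subseteq> D \<and>
    emeasure (digit_measure S) D \<le> ennreal (4 * 2 powr s) * cover_size s U"
proof (cases "U = {} \<or> s = 0")
  case True
  interpret prob_space "digit_measure S" by (rule prob_space_digit_measure)
  show ?thesis
  proof (cases "U = {}")
    case False
    then have "emeasure (digit_measure S) UNIV \<le> ennreal (4 * 2 powr s) * cover_size s U"
      using True emeasure_space_1 by (simp add: cover_size_def)
    then show ?thesis by (intro bexI[of _ UNIV]) auto
  qed (auto intro!: bexI[of _ "{}"])
next
  case False
  then have s0: "s > 0" and "U \<noteq> {}" using s by auto
  then obtain x where x: "x \<in> U" by blast
  define d where "d = diameter U"
  have "U \<subseteq> cball x d"
    using diameter_bounded_bound[OF U(1) x] by (auto simp: d_def)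
  moreover have "emeasure (digit_measure S) (cball x d) \<le> ennreal (4 * 2 powr s * d powr s)"
  proof (cases "d = 0")
    case True
    \<comment> \<open>A singleton has no mass: it lies in balls of every level, and
      \<open>digit_count S n\<close> grows at least like \<open>s * n\<close> with
      \<open>s > 0\<close>.\<close>
    have lim: "(\<lambda>n. ennreal (4 * 2 powr (- (s * real n)))) \<longlonglongrightarrow> ennreal 0"
      using s0 by (intro tendsto_ennrealI) real_asymp
    have "emeasure (digit_measure S) (cball x d) \<le> ennreal 0"
    proof (rule tendsto_lowerbound[OF lim])
      show "\<forall>\<^sub>F n in sequentially. emeasure (digit_measure S) (cball x d) \<le> ennreal (4 * 2 powr (- (s * real n)))"
        unfolding eventually_sequentially
      proof (intro exI allI impI)
        fix n assume "n \<ge> n\<^sub>0"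
        have "emeasure (digit_measure S) (cball x d) \<le> ennreal (4 * 2 powr (- real (digit_count S n)))"
          using True by (intro emeasure_cball_le) auto
        also have "\<dots> \<le> ennreal (4 * 2 powr (- (s * real n)))"
          using count[OF \<open>n \<ge> n\<^sub>0\<close>] by (intro ennreal_leI mult_left_mono powr_mono) auto
        finally show "emeasure (digit_measure S) (cball x d) \<le> ennreal (4 * 2 powr (- (s * real n)))" .
      qed
    qed simp
    then show ?thesis using True by simp
  next
    case False
    moreover have "d \<ge> 0" unfolding d_def using U by (intro diameter_ge_0)
    moreover have "(1::real) / 2 ^ n\<^sub>0 \<le> 1" by simp
    then have "d \<le> 1" using U(2) unfolding d_def by linarith
    ultimately obtain n where n: "1 / 2 ^ Suc n < d" "d \<le> 1 / 2 ^ n" using dyadic_scale[of d] by auto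
    have "n\<^sub>0 < Suc n" using n(1) U(2) by (intro dyadic_less_imp_less) (auto simp: d_def)
    then have "n \<ge> n\<^sub>0" by simp
    have "emeasure (digit_measure S) (cball x d) \<le> ennreal (4 * 2 powr (- real (digit_count S n)))"
      using n by (intro emeasure_cball_le)
    also have "\<dots> \<le> ennreal (4 * 2 powr (- (s * real n)))"
      using count[OF \<open>n \<ge> n\<^sub>0\<close>] by (intro ennreal_leI mult_left_mono powr_mono) auto
    also have "4 * 2 powr (- (s * real n)) = 4 * 2 powr s * (1 / 2 ^ Suc n) powr s"
      unfolding one_div_power_eq_powr by (simp add: powr_powr algebra_simps flip: powr_add)
    also have "\<dots> \<le> 4 * 2 powr s * d powr s" using n(1) s by (intro mult_left_mono powr_mono2) auto
    finally show ?thesis by (simp add: ennreal_leI)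
  qed
  moreover have "ennreal (4 * 2 powr s * d powr s) = ennreal (4 * 2 powr s) * cover_size s U"
    using s0 \<open>U \<noteq> {}\<close> by (simp add: cover_size_def d_def ennreal_mult)
  ultimately show ?thesis by (intro bexI[of _ "cball x d"]) auto
qed

text \<open>The mass distribution principle: a cover of too small total size cannot carry the mass
  of \<open>E\<close>.\<close>

lemma measure_hausdorff_dim_ge:
  assumes count: "\<And>s. s < t \<Longrightarrow> \<exists>n\<^sub>0. \<forall>n\<ge>n\<^sub>0. real (digit_count S n) \<ge> s * real n"
  shows "ereal t \<le> measure_hausdorff_dim (digit_measure S)"
  unfolding measure_hausdorff_dim_def hausdorff_dim_def
proof (safe intro!: Inf_greatest, simp only: ereal_less_eq)
  interpret prob_space "digit_measure S" by (rule prob_space_digit_measure)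
  let ?\<mu> = "digit_measure S"
  fix E :: "real set" and s :: real
  assume E: "E \<in> sets borel" "0 < emeasure ?\<mu> E" and s: "0 \<le> s" "hausdorff_measure s E = 0"
  show "t \<le> s"
  proof (rule ccontr)
    assume "\<not> t \<le> s"
    then obtain n\<^sub>0 where n0: "\<And>n. n \<ge> n\<^sub>0 \<Longrightarrow> real (digit_count S n) \<ge> s * real n" using count[of s] by auto
    define C where "C = 4 * 2 powr s"
    have C: "C > 0" by (simp add: C_def)
    have E': "measure ?\<mu> E > 0" using E(2) by (simp add: emeasure_eq_measure)
    have "hausdorff_premeasure s (1 / 2 ^ n\<^sub>0) E \<le> hausdorff_measure s E"
      unfolding hausdorff_measure_def by (intro SUP_upper) simp
    then have "hausdorff_premeasure s (1 / 2 ^ n\<^sub>0) E < ennreal (measure ?\<mu> E / C)"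
      using s(2) C E' by simp
    then obtain U where U: "E \<subseteq> (\<Union>n. U n)" "\<And>n. bounded (U n)" "\<And>n. diameter (U n) \<le> 1 / 2 ^ n\<^sub>0"
      and sum: "(\<Sum>n. cover_size s (U n)) < ennreal (measure ?\<mu> E / C)"
      unfolding hausdorff_premeasure_def Inf_less_iff by blast
    have "\<forall>n. \<exists>D\<in>sets borel. U n \<subseteq> D \<and> emeasure ?\<mu> D \<le> ennreal C * cover_size s (U n)"
      unfolding C_def using cover_set_mass[OF s(1) n0] U by blast
    then obtain D where D: "\<And>n. D n \<in> sets borel" "\<And>n. U n \<subseteq> D n"
      "\<And>n. emeasure ?\<mu> (D n) \<le> ennreal C * cover_size s (U n)" by metis
    have "emeasure ?\<mu> E \<le> emeasure ?\<mu> (\<Union>n. D n)"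
      using U(1) D(1,2) by (intro emeasure_mono) (auto, blast)
    also have "\<dots> \<le> (\<Sum>n. emeasure ?\<mu> (D n))" using D(1) by (intro emeasure_subadditive_countably) auto
    also have "\<dots> \<le> (\<Sum>n. ennreal C * cover_size s (U n))" using D(3) by (intro suminf_le) auto
    also have "\<dots> = ennreal C * (\<Sum>n. cover_size s (U n))" by simp
    also have "\<dots> < ennreal C * ennreal (measure ?\<mu> E / C)"
      using sum C by (intro ennreal_mult_strict_left_mono) auto
    also have "\<dots> = emeasure ?\<mu> E" using C by (simp add: emeasure_eq_measure flip: ennreal_mult')
    finally show False by simp
  qed
qed

section \<open>Upper bound for the Hausdorff dimension\<close>

lemma emeasure_digit_set: "emeasure (digit_measure S) (digit_set S) = 1"
proof -
  interpret prob_space "digit_measure S" by (rule prob_space_digit_measure)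
  have "prob (digit_set S) = 1" by (subst prob_eq_1) (use AE_digit_set in auto)
  then show ?thesis by (simp add: emeasure_eq_measure)
qed

text \<open>Uses the cover by the intervals of level \<open>n\<close>, one for each subset of the
  available digits, padded with empty sets to a sequence.\<close>

lemma hausdorff_premeasure_digit_set_le:
  assumes s: "s > 0" and n: "1 / 2 ^ n \<le> \<delta>"
  shows "hausdorff_premeasure s \<delta> (digit_set S) \<le> ennreal (2 powr (real (digit_count S n) - s * real n))"
proof -
  let ?P = "Pow (S \<inter> {..<n})" and ?N = "2 ^ digit_count S n :: nat"
  have "card ?P = ?N" by (rule card_Pow) simp
  then obtain g where g: "bij_betw g {..<?N} ?P"
    using ex_bij_betw_nat_finite[of ?P] by (auto simp: atLeast0LessThan)
  define U where "U i = (if i < ?N then {point (g i)..point (g i) + 1 / 2 ^ n} else {})" for i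
  have diam: "diameter {a..a + 1 / 2 ^ n :: real} \<le> 1 / 2 ^ n" for a
    by (rule diameter_le) (auto simp: abs_le_iff)
  have cover: "digit_set S \<subseteq> (\<Union>i. U i)"
  proof
    fix x assume "x \<in> digit_set S"
    then have "x \<in> (\<Union>A\<in>?P. {point A..point A + 1 / 2 ^ n})"
      unfolding digit_set_def by (rule INT_D) simp
    then obtain A where A: "A \<in> ?P" "x \<in> {point A..point A + 1 / 2 ^ n}" by (rule UN_E)
    then have "A \<in> g ` {..<?N}" using bij_betw_imp_surj_on[OF g] by blast
    then obtain i where "i < ?N" "A = g i" by blast
    then show "x \<in> (\<Union>i. U i)" using A(2) by (intro UN_I[of i]) (auto simp: U_def)
  qed
  have bound: "bounded (U i) \<and> diameter (U i) \<le> \<delta>" for i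
    using diam[of "point (g i)"] n by (auto simp: U_def intro: order_trans[of 0 "1 / 2 ^ n"])
  have size: "cover_size s (U i) \<le> ennreal ((1 / 2 ^ n) powr s)" for i
    using s diam[of "point (g i)"]
    by (auto simp: U_def cover_size_def intro!: ennreal_leI powr_mono2 diameter_ge_0)
  have "hausdorff_premeasure s \<delta> (digit_set S) \<le> (\<Sum>i. cover_size s (U i))"
    unfolding hausdorff_premeasure_def using cover bound by (intro Inf_lower) blast
  also have "\<dots> = (\<Sum>i<?N. cover_size s (U i))"
    by (rule suminf_finite) (auto simp: U_def cover_size_def)
  also have "\<dots> \<le> (\<Sum>i<?N. ennreal ((1 / 2 ^ n) powr s))" by (intro sum_mono size)
  also have "\<dots> = ennreal (2 ^ digit_count S n * (1 / 2 ^ n) powr s)"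
    by (simp add: ennreal_mult' ennreal_power flip: ennreal_numeral)
  also have "2 ^ digit_count S n * (1 / 2 ^ n) powr s = 2 powr (real (digit_count S n) - s * real n)"
    unfolding dyadic_powr by (simp add: powr_diff powr_minus powr_realpow divide_inverse)
  finally show ?thesis .
qed

text \<open>The support has full mass, and covering it at the sparse levels \<open>n\<close>
  supplied by \<open>count\<close> makes every premeasure with exponent above \<open>t\<close>
  vanish.\<close>

lemma measure_hausdorff_dim_le:
  assumes t: "t \<ge> 0" and count: "\<And>s n\<^sub>0. t < s \<Longrightarrow> \<exists>n\<ge>n\<^sub>0. real (digit_count S n) \<le> s * real n"
  shows "measure_hausdorff_dim (digit_measure S) \<le> ereal t"
proof -
  have zero: "hausdorff_measure s (digit_set S) = 0" if s: "s > t" for s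
  proof -
    have "hausdorff_premeasure s \<delta> (digit_set S) \<le> 0" if \<delta>: "\<delta> > 0" for \<delta>
    proof (rule ennreal_le_epsilon)
      fix e :: real assume e: "0 < e"
      \<comment> \<open>An exponent strictly between \<open>t\<close> and \<open>s\<close> leaves
        the decaying factor \<open>2 powr ((u - s) * real n)\<close>.\<close>
      define u where "u = (s + t) / 2"
      have u: "t < u" "u < s" using s by (auto simp: u_def)
      have "(\<lambda>n. 2 powr (- (d * real n))) \<longlonglongrightarrow> 0" if "d > 0" for d :: real
        using that by real_asymp
      from this[of "s - u"] u(2) have "(\<lambda>n. 2 powr ((u - s) * real n)) \<longlonglongrightarrow> 0"
        by (simp add: algebra_simps)
      then have "\<forall>\<^sub>F n in sequentially. 2 powr ((u - s) * real n) < e" using e by (rule order_tendstoD)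
      moreover have "(\<lambda>n. 1 / 2 ^ n :: real) \<longlonglongrightarrow> 0" by real_asymp
      then have "\<forall>\<^sub>F n in sequentially. 1 / 2 ^ n < \<delta>" using \<delta> by (rule order_tendstoD)
      ultimately have "\<forall>\<^sub>F n in sequentially. 2 powr ((u - s) * real n) < e \<and> 1 / 2 ^ n < \<delta>"
        by (rule eventually_conj)
      then obtain n\<^sub>0 where n0: "\<And>n. n \<ge> n\<^sub>0 \<Longrightarrow> 2 powr ((u - s) * real n) < e \<and> 1 / 2 ^ n < \<delta>"
        unfolding eventually_sequentially by blast
      obtain n where n: "n \<ge> n\<^sub>0" "real (digit_count S n) \<le> u * real n" using count[OF u(1)] by blast
      have "hausdorff_premeasure s \<delta> (digit_set S) \<le> ennreal (2 powr (real (digit_count S n) - s * real n))"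
        using s t n0[OF n(1)] by (intro hausdorff_premeasure_digit_set_le) auto
      also have "\<dots> \<le> ennreal (2 powr ((u - s) * real n))"
        using n(2) by (intro ennreal_leI powr_mono) (auto simp: algebra_simps)
      also have "\<dots> \<le> ennreal e" using n0[OF n(1)] by (intro ennreal_leI) auto
      finally show "hausdorff_premeasure s \<delta> (digit_set S) \<le> 0 + ennreal e" by simp
    qed
    then have "hausdorff_measure s (digit_set S) \<le> 0"
      unfolding hausdorff_measure_def by (intro SUP_least) auto
    then show ?thesis by simp
  qed
  have le: "hausdorff_dim (digit_set S) \<le> ereal s" if "s > t" for s
    unfolding hausdorff_dim_def using zero[OF that] t that by (intro Inf_lower) auto
  have "hausdorff_dim (digit_set S) \<le> ereal t"
  proof (rule ereal_le_epsilon2)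
    fix e :: real assume "0 < e"
    then show "hausdorff_dim (digit_set S) \<le> ereal t + ereal e" using le[of "t + e"] by simp
  qed
  moreover have "measure_hausdorff_dim (digit_measure S) \<le> hausdorff_dim (digit_set S)"
    unfolding measure_hausdorff_dim_def by (intro Inf_lower) (auto simp: emeasure_digit_set)
  ultimately show ?thesis by (rule order_trans[rotated])
qed

text \<open>The balls of radius \<open>1 / 2 ^ n\<close> are disjoint and their masses add up to at
  most 1. This bound guarantees separated sets of maximal cardinality.\<close>

lemma separated_subset_card_le:
  assumes P: "P \<subseteq> digit_set S" and sep: "\<And>x y. x \<in> P \<Longrightarrow> y \<in> P \<Longrightarrow> x \<noteq> y \<Longrightarrow> dist x y > 2 / 2 ^ n"
    and fin: "finite P"
  shows "card P \<le> 2 ^ digit_count S (Suc n)"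
proof -
  interpret prob_space "digit_measure S" by (rule prob_space_digit_measure)
  have disj: "disjoint_family_on (\<lambda>x. ball x (1 / 2 ^ n)) P"
    unfolding disjoint_family_on_def
  proof (intro ballI impI equals0I)
    fix x y z assume "x \<in> P" "y \<in> P" "x \<noteq> y" "z \<in> ball x (1 / 2 ^ n) \<inter> ball y (1 / 2 ^ n)"
    then show False using sep[of x y] dist_triangle2[of x y z] by (simp add: dist_commute)
  qed
  have "real (card P) * (1/2) ^ digit_count S (Suc n) = (\<Sum>x\<in>P. (1/2) ^ digit_count S (Suc n))" by simp
  also have "\<dots> \<le> (\<Sum>x\<in>P. prob (ball x (1 / 2 ^ n)))"
    using P by (intro sum_mono measure_ball_ge) (auto simp: field_simps)
  also have "\<dots> = prob (\<Union>x\<in>P. ball x (1 / 2 ^ n))"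
    using fin disj by (intro finite_measure_finite_Union[symmetric]) auto
  also have "\<dots> \<le> 1" by simp
  finally have "real (card P) \<le> 2 ^ digit_count S (Suc n)" by (simp add: power_one_over field_simps)
  then show ?thesis by (metis of_nat_le_iff of_nat_numeral of_nat_power)
qed

text \<open>Packing measure allows covers by arbitrary sets, so \<open>F\<close> is not assumed
  measurable and outer measure is used. One dense scale \<open>n\<close> below
  \<open>\<delta>\<close> suffices. The 8 is the factor 4 of the ball bound, doubled because the
  enlarged radius belongs to level \<open>n - 1\<close>.\<close>

lemma packing_premeasure_ge:
  assumes s: "s \<ge> 0" and count: "\<And>n\<^sub>0. \<exists>n\<ge>n\<^sub>0. real (digit_count S n) \<ge> s * real n"
  shows "outer_measure_of (digit_measure S) F \<le> 8 * packing_premeasure s F"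
proof -
  interpret prob_space "digit_measure S" by (rule prob_space_digit_measure)
  let ?\<mu> = "digit_measure S"
  have "outer_measure_of ?\<mu> F / 8 \<le> packing_premeasure_at s \<delta> F" if \<delta>: "\<delta> > 0" for \<delta>
  proof -
    obtain k where "(1/2) ^ k < \<delta>" using real_arch_pow_inv[of \<delta> "1/2"] \<delta> by auto
    moreover obtain n where n: "n \<ge> Suc k" "real (digit_count S n) \<ge> s * real n" using count by blast
    moreover have "(1/2::real) ^ n \<le> (1/2) ^ k" using n by (intro power_decreasing) auto
    ultimately have nd: "1 / 2 ^ n \<le> \<delta>" by (simp add: power_one_over)
    obtain m where m: "n = Suc m" using n(1) by (cases n) auto
    \<comment> \<open>A separated set of maximal cardinality is a packing whose enlarged balls cover \<open>F\<close>.\<close>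
    define sep where "sep P \<longleftrightarrow> finite P \<and> P \<subseteq> F \<inter> digit_set S \<and>
      (\<forall>x\<in>P. \<forall>y\<in>P. x \<noteq> y \<longrightarrow> dist x y > 2 / 2 ^ n)" for P
    have sep_empty: "sep {}" by (simp add: sep_def)
    have "\<forall>P. sep P \<longrightarrow> card P < Suc (2 ^ digit_count S (Suc n))"
      using separated_subset_card_le unfolding sep_def less_Suc_eq_le by (metis Int_subset_iff)
    from ex_has_greatest_nat[of sep, OF sep_empty this]
    obtain P where P: "sep P" and max: "\<And>Q. sep Q \<Longrightarrow> card Q \<le> card P" by blast
    have finP: "finite P" and PF: "P \<subseteq> F" "P \<subseteq> digit_set S" using P by (auto simp: sep_def)
    have cover: "F \<inter> digit_set S \<subseteq> (\<Union>x\<in>P. cball x (2 / 2 ^ n))"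
    proof (rule subsetI, rule ccontr)
      fix z assume z: "z \<in> F \<inter> digit_set S" "z \<notin> (\<Union>x\<in>P. cball x (2 / 2 ^ n))"
      then have far: "dist x z > 2 / 2 ^ n" if "x \<in> P" for x using that by (auto simp: not_le)
      then have "z \<notin> P" by force
      have "sep (insert z P)" using P z(1) far by (auto simp: sep_def dist_commute)
      then have "card (insert z P) \<le> card P" by (rule max)
      then show False using \<open>z \<notin> P\<close> finP by simp
    qed
    define W where "W = (\<Union>x\<in>P. cball x (2 / 2 ^ n))"
    have W [measurable]: "W \<in> sets borel" unfolding W_def using finP by (intro sets.finite_UN) auto
    have C [measurable]: "- digit_set S \<in> sets borel"
      by (simp add: borel_open compact_digit_set compact_imp_closed open_Compl)
    \<comment> \<open>Points of \<open>F\<close> outside the support are not covered by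
      \<open>W\<close>, but they lie in a null set.\<close>
    have "outer_measure_of ?\<mu> F \<le> outer_measure_of ?\<mu> (W \<union> - digit_set S)"
      using cover unfolding W_def by (intro outer_measure_of_mono) blast
    also have "\<dots> = emeasure ?\<mu> (W \<union> - digit_set S)" by (intro outer_measure_of_eq) simp
    also have "\<dots> \<le> emeasure ?\<mu> W + emeasure ?\<mu> (- digit_set S)"
      by (intro emeasure_subadditive) auto
    also have "emeasure ?\<mu> (- digit_set S) = 0"
      using emeasure_compl[of "digit_set S" ?\<mu>] emeasure_space_1
      by (simp add: Compl_eq_Diff_UNIV emeasure_digit_set)
    also have "emeasure ?\<mu> W + 0 \<le> (\<Sum>x\<in>P. emeasure ?\<mu> (cball x (2 / 2 ^ n)))"
      unfolding W_def add_0_right using finP by (intro emeasure_subadditive_finite) auto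
    also have "\<dots> \<le> (\<Sum>x\<in>P. ennreal (4 * 2 powr (- real (digit_count S m))))"
      by (intro sum_mono emeasure_cball_le) (simp add: m)
    also have "\<dots> \<le> (\<Sum>x\<in>P. ennreal (8 * (2 * (1 / 2 ^ n)) powr s))"
    proof (intro sum_mono ennreal_leI)
      have "4 * 2 powr (- real (digit_count S m)) \<le> 4 * 2 powr (1 - real (digit_count S n))"
        using digit_count_Suc_le[of S m] m by (intro mult_left_mono powr_mono) auto
      also have "\<dots> = 8 * 2 powr (- real (digit_count S n))" by (simp add: powr_diff powr_minus field_simps)
      also have "\<dots> \<le> 8 * 2 powr (- (s * real n))" using n(2) by (intro mult_left_mono powr_mono) auto
      also have "2 powr (- (s * real n)) = (1 / 2 ^ n) powr s" by (simp only: dyadic_powr)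
      also have "8 * (1 / 2 ^ n) powr s \<le> 8 * (2 * (1 / 2 ^ n)) powr s"
        using s by (intro mult_left_mono powr_mono2) (auto intro: divide_right_mono)
      finally show "4 * 2 powr (- real (digit_count S m)) \<le> 8 * (2 * (1 / 2 ^ n)) powr s" .
    qed
    also have "\<dots> = 8 * (\<Sum>x\<in>P. ennreal ((2 * (1 / 2 ^ n)) powr s))"
      by (simp add: ennreal_mult' sum_distrib_left mult_ac)
    also have "(\<Sum>x\<in>P. ennreal ((2 * (1 / 2 ^ n)) powr s)) =
        (\<Sum>\<^sub>\<infinity>(x, r)\<in>(\<lambda>x. (x, 1 / 2 ^ n)) ` P. ennreal ((2 * r) powr s))"
      using finP by (simp add: sum.reindex inj_on_def)
    also have "\<dots> \<le> packing_premeasure_at s \<delta> F"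
      unfolding packing_premeasure_at_def
    proof (intro Sup_upper CollectI exI[of _ "(\<lambda>x. (x, 1 / 2 ^ n)) ` P"] conjI refl)
      have "disjoint_family_on (\<lambda>(x, r). cball x r) ((\<lambda>x. (x, 1 / 2 ^ n)) ` P)"
        unfolding disjoint_family_on_def
      proof (intro ballI impI equals0I)
        fix p q :: "real \<times> real" and z
        assume pq: "p \<in> (\<lambda>x. (x, 1 / 2 ^ n)) ` P" "q \<in> (\<lambda>x. (x, 1 / 2 ^ n)) ` P" "p \<noteq> q"
          and z: "z \<in> (case p of (x, r) \<Rightarrow> cball x r) \<inter> (case q of (x, r) \<Rightarrow> cball x r)"
        then obtain x y where xy: "x \<in> P" "y \<in> P" "p = (x, 1 / 2 ^ n)" "q = (y, 1 / 2 ^ n)" by blast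
        with pq z have "x \<in> P" "y \<in> P" "x \<noteq> y" "dist x z \<le> 1 / 2 ^ n" "dist y z \<le> 1 / 2 ^ n"
          by auto
        moreover from this have "dist x y > 2 / 2 ^ n" using P by (auto simp: sep_def)
        moreover have "dist x y \<le> dist x z + dist y z" by (rule dist_triangle2)
        ultimately show False by simp
      qed
      then show "packing \<delta> F ((\<lambda>x. (x, 1 / 2 ^ n)) ` P)"
        using finP PF nd by (auto simp: packing_def countable_finite)
    qed
    finally have "outer_measure_of ?\<mu> F \<le> 8 * packing_premeasure_at s \<delta> F" by (simp add: mult_left_mono)
    then show ?thesis by (simp add: divide_le_posI_ennreal)
  qed
  then have "outer_measure_of ?\<mu> F / 8 \<le> packing_premeasure s F"
    unfolding packing_premeasure_def by (intro INF_greatest) auto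
  then have "8 * (outer_measure_of ?\<mu> F / 8) \<le> 8 * packing_premeasure s F" by (intro mult_left_mono) auto
  then show ?thesis by (simp add: ennreal_times_divide ennreal_mult_divide_eq mult.commute)
qed

lemma measure_packing_dim_ge:
  assumes count: "\<And>s n\<^sub>0. s < t \<Longrightarrow> \<exists>n\<ge>n\<^sub>0. real (digit_count S n) \<ge> s * real n"
  shows "ereal t \<le> measure_packing_dim (digit_measure S)"
  unfolding measure_packing_dim_def packing_dim_def
proof (safe intro!: Inf_greatest, simp only: ereal_less_eq)
  interpret prob_space "digit_measure S" by (rule prob_space_digit_measure)
  let ?\<mu> = "digit_measure S"
  fix E :: "real set" and s :: real
  assume E: "E \<in> sets borel" "0 < emeasure ?\<mu> E" and s: "0 \<le> s" "packing_measure s E = 0"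
  show "t \<le> s"
  proof (rule ccontr)
    assume "\<not> t \<le> s"
    then have n: "\<And>n\<^sub>0. \<exists>n\<ge>n\<^sub>0. real (digit_count S n) \<ge> s * real n" using count by simp
    have E': "measure ?\<mu> E > 0" using E(2) by (simp add: emeasure_eq_measure)
    then have "packing_measure s E < ennreal (measure ?\<mu> E / 8)" using s(2) by simp
    then obtain F where F: "E \<subseteq> (\<Union>n. F n)"
      and sum: "(\<Sum>n. packing_premeasure s (F n)) < ennreal (measure ?\<mu> E / 8)"
      unfolding packing_measure_def Inf_less_iff by blast
    \<comment> \<open>Measurable hulls of the covering sets, to which countable subadditivity
      applies.\<close>
    have "\<forall>n. \<exists>D\<in>sets ?\<mu>. F n \<subseteq> D \<and> outer_measure_of ?\<mu> (F n) = emeasure ?\<mu> D"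
      by (intro allI outer_measure_of_attain) simp
    then obtain D where D: "\<And>n. D n \<in> sets ?\<mu>" "\<And>n. F n \<subseteq> D n"
      "\<And>n. outer_measure_of ?\<mu> (F n) = emeasure ?\<mu> (D n)" by metis
    have "emeasure ?\<mu> E \<le> emeasure ?\<mu> (\<Union>n. D n)"
      using F D(1,2) by (intro emeasure_mono) (auto, blast)
    also have "\<dots> \<le> (\<Sum>n. emeasure ?\<mu> (D n))" using D(1) by (intro emeasure_subadditive_countably) auto
    also have "\<dots> \<le> (\<Sum>n. 8 * packing_premeasure s (F n))"
      unfolding D(3)[symmetric] using packing_premeasure_ge[OF s(1) n] by (intro suminf_le) auto
    also have "\<dots> = 8 * (\<Sum>n. packing_premeasure s (F n))" by simp
    also have "\<dots> < ennreal 8 * ennreal (measure ?\<mu> E / 8)"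
      using sum by (subst ennreal_numeral, intro ennreal_mult_strict_left_mono) auto
    also have "\<dots> = emeasure ?\<mu> E" by (simp add: emeasure_eq_measure flip: ennreal_mult' del: ennreal_numeral)
    finally show False by simp
  qed
qed

text \<open>Each packing ball has mass at least a constant times \<open>(2 * r) powr s\<close>, and
  disjoint balls have total mass at most 1. The surplus exponent \<open>s - t\<close> yields the
  small factor in \<open>\<delta>\<close>.\<close>

lemma packing_premeasure_at_digit_set_le:
  assumes t: "0 \<le> t" and s: "t \<le> s" and count: "\<And>n. n \<ge> n\<^sub>0 \<Longrightarrow> real (digit_count S n) \<le> t * real n"
    and \<delta>: "0 < \<delta>" "\<delta> \<le> 1 / 2 ^ n\<^sub>0"
  shows "packing_premeasure_at s \<delta> (digit_set S) \<le> ennreal (2 powr (s + t) * \<delta> powr (s - t))"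
  unfolding packing_premeasure_at_def
proof (safe intro!: Sup_least)
  interpret prob_space "digit_measure S" by (rule prob_space_digit_measure)
  fix P :: "(real \<times> real) set" assume P: "packing \<delta> (digit_set S) P"
  define K where "K = 2 powr (s + t) * \<delta> powr (s - t)"
  have K: "K \<ge> 0" by (simp add: K_def)
  have ball: "(2 * r) powr s \<le> K * prob (cball x r)" if xr: "(x, r) \<in> P" for x r
  proof -
    have x: "x \<in> digit_set S" and r: "0 < r" "r \<le> \<delta>" using P xr by (auto simp: packing_def)
    have "(1::real) / 2 ^ n\<^sub>0 \<le> 1" by simp
    then have "r \<le> 1" using r \<delta> by linarith
    then obtain n where n: "1 / 2 ^ Suc n < r" "r \<le> 1 / 2 ^ n" using dyadic_scale[of r] r by auto
    have "n\<^sub>0 < Suc n" using n(1) r(2) \<delta>(2) by (intro dyadic_less_imp_less) linarith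
    have "(2 * r) powr s = 2 powr s * (r powr (s - t) * r powr t)"
      using r by (simp add: powr_mult flip: powr_add)
    also have "\<dots> \<le> 2 powr s * (\<delta> powr (s - t) * (1 / 2 ^ n) powr t)"
      using r n s t by (intro mult_left_mono mult_mono powr_mono2) auto
    \<comment> \<open>Passing to \<open>Suc n\<close>, where the ball bound is available, costs the
      factor \<open>2 powr t\<close> contained in \<open>K\<close>.\<close>
    also have "\<dots> = K * 2 powr (- (t * real (Suc n)))"
      unfolding dyadic_powr K_def by (simp add: algebra_simps flip: powr_add)
    also have "\<dots> \<le> K * 2 powr (- real (digit_count S (Suc n)))"
      using count[of "Suc n"] \<open>n\<^sub>0 < Suc n\<close> K by (intro mult_left_mono powr_mono) auto
    also have "\<dots> = K * (1/2) ^ digit_count S (Suc n)" by (simp add: half_power_eq_powr)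
    also have "\<dots> \<le> K * prob (ball x r)" using n(1) K x by (intro mult_left_mono measure_ball_ge) auto
    also have "\<dots> \<le> K * prob (cball x r)" using K by (intro mult_left_mono finite_measure_mono) auto
    finally show ?thesis .
  qed
  have "(\<Sum>(x, r)\<in>Q. ennreal ((2 * r) powr s)) \<le> ennreal K" if Q: "finite Q" "Q \<subseteq> P" for Q
  proof -
    have "(\<Sum>(x, r)\<in>Q. (2 * r) powr s) \<le> (\<Sum>p\<in>Q. K * prob (case p of (x, r) \<Rightarrow> cball x r))"
      using Q ball by (intro sum_mono) auto
    also have "\<dots> = K * (\<Sum>p\<in>Q. prob (case p of (x, r) \<Rightarrow> cball x r))" by (simp add: sum_distrib_left)
    also have "(\<Sum>p\<in>Q. prob (case p of (x, r) \<Rightarrow> cball x r)) = prob (\<Union>p\<in>Q. case p of (x, r) \<Rightarrow> cball x r)"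
    proof (rule finite_measure_finite_Union[symmetric])
      show "disjoint_family_on (\<lambda>p. case p of (x, r) \<Rightarrow> cball x r) Q"
        using P Q disjoint_family_on_mono by (fastforce simp: packing_def)
    qed (use Q in auto)
    also have "K * \<dots> \<le> K * 1" using K by (intro mult_left_mono) auto
    finally have "(\<Sum>(x, r)\<in>Q. (2 * r) powr s) \<le> K" by simp
    moreover have "(\<Sum>(x, r)\<in>Q. ennreal ((2 * r) powr s)) = ennreal (\<Sum>(x, r)\<in>Q. (2 * r) powr s)"
      by (simp add: case_prod_beta)
    ultimately show ?thesis by (simp add: ennreal_leI)
  qed
  then show "(\<Sum>\<^sub>\<infinity>(x, r)\<in>P. ennreal ((2 * r) powr s)) \<le> ennreal (2 powr (s + t) * \<delta> powr (s - t))"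
    unfolding K_def by (subst nonneg_infsum_complete) (auto intro!: SUP_least)
qed

lemma measure_packing_dim_le:
  assumes t: "t \<ge> 0" and count: "\<And>s. t < s \<Longrightarrow> \<exists>n\<^sub>0. \<forall>n\<ge>n\<^sub>0. real (digit_count S n) \<le> s * real n"
  shows "measure_packing_dim (digit_measure S) \<le> ereal t"
proof -
  have zero: "packing_measure s (digit_set S) = 0" if s: "s > t" for s
  proof -
    define u where "u = (s + t) / 2"
    have u: "t < u" "u < s" "0 \<le> u" using s t by (auto simp: u_def)
    obtain n\<^sub>0 where n0: "\<And>n. n \<ge> n\<^sub>0 \<Longrightarrow> real (digit_count S n) \<le> u * real n" using count[OF u(1)] by blast
    have "packing_premeasure s (digit_set S) \<le> 0"
    proof (rule ennreal_le_epsilon)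
      fix e :: real assume e: "0 < e"
      have "((\<lambda>\<delta>. c * \<delta> powr d) \<longlongrightarrow> 0) (at_right 0)" if "d > 0" for c d :: real
        using that by real_asymp
      from this[of "s - u"] u(2)
      have "((\<lambda>\<delta>. 2 powr (s + u) * \<delta> powr (s - u)) \<longlongrightarrow> 0) (at_right 0)" by simp
      then have "\<forall>\<^sub>F \<delta> in at_right 0. 2 powr (s + u) * \<delta> powr (s - u) < e" using e by (rule order_tendstoD)
      moreover have "\<forall>\<^sub>F \<delta>::real in at_right 0. \<delta> < 1 / 2 ^ n\<^sub>0"
        by (rule order_tendstoD(2)[OF tendsto_ident_at]) simp
      moreover have "\<forall>\<^sub>F \<delta>::real in at_right 0. 0 < \<delta>" by (simp add: eventually_at_right_less)
      ultimately have "\<forall>\<^sub>F \<delta> in at_right 0. 2 powr (s + u) * \<delta> powr (s - u) < e \<and> \<delta> < 1 / 2 ^ n\<^sub>0 \<and> 0 < \<delta>"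
        by (intro eventually_conj)
      then obtain \<delta> where \<delta>: "2 powr (s + u) * \<delta> powr (s - u) < e" "\<delta> < 1 / 2 ^ n\<^sub>0" "0 < \<delta>"
        using eventually_happens[of _ "at_right (0::real)"] by (auto simp: trivial_limit_at_right_real)
      have "packing_premeasure s (digit_set S) \<le> packing_premeasure_at s \<delta> (digit_set S)"
        unfolding packing_premeasure_def using \<delta> by (intro INF_lower) auto
      also have "\<dots> \<le> ennreal (2 powr (s + u) * \<delta> powr (s - u))"
        using u \<delta> by (intro packing_premeasure_at_digit_set_le[OF _ _ n0]) auto
      also have "\<dots> \<le> ennreal e" using \<delta> by (intro ennreal_leI) auto
      finally show "packing_premeasure s (digit_set S) \<le> 0 + ennreal e" by simp
    qed
    moreover have "packing_premeasure s ({} :: real set) = 0"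
    proof -
      have "packing_premeasure_at s \<delta> ({} :: real set) = 0" for \<delta>
      proof -
        have "packing \<delta> ({} :: real set) P \<longleftrightarrow> P = {}" for P by (auto simp: packing_def disjoint_family_on_def)
        then show ?thesis by (simp add: packing_premeasure_at_def)
      qed
      then show ?thesis by (simp add: packing_premeasure_def)
    qed
    \<comment> \<open>The trivial cover suffices, because already the premeasure of the whole
      support vanishes.\<close>
    moreover have "packing_measure s (digit_set S) \<le>
        (\<Sum>n. packing_premeasure s (if n = 0 then digit_set S else {}))"
      unfolding packing_measure_def
      by (intro Inf_lower CollectI exI[of _ "\<lambda>n. if n = 0 then digit_set S else {}"]) auto
    moreover have "(\<Sum>n. packing_premeasure s (if n = 0 then digit_set S else {}))
        = (\<Sum>n\<in>{0::nat}. packing_premeasure s (if n = 0 then digit_set S else {}))"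
      using calculation by (intro suminf_finite) auto
    ultimately show ?thesis by simp
  qed
  have le: "packing_dim (digit_set S) \<le> ereal s" if "s > t" for s
    unfolding packing_dim_def using zero[OF that] t that by (intro Inf_lower) auto
  have "packing_dim (digit_set S) \<le> ereal t"
  proof (rule ereal_le_epsilon2)
    fix e :: real assume "0 < e"
    then show "packing_dim (digit_set S) \<le> ereal t + ereal e" using le[of "t + e"] by simp
  qed
  moreover have "measure_packing_dim (digit_measure S) \<le> packing_dim (digit_set S)"
    unfolding measure_packing_dim_def by (intro Inf_lower) (auto simp: emeasure_digit_set)
  ultimately show ?thesis by (rule order_trans[rotated])
qed

section \<open>Digit sets with prescribed densities\<close>

text \<open>The digit set whose counting function is the integer part of the partial sums of \<open>a\<close>.\<close>

definition slope_digits :: "(nat \<Rightarrow> real) \<Rightarrow> nat set" where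
  "slope_digits a = {n. \<lfloor>\<Sum>i<n. a i\<rfloor> < \<lfloor>\<Sum>i<Suc n. a i\<rfloor>}"

text \<open>With slopes between 0 and 1 the integer part of the partial sums rises by 0 or 1 at each
  step, and the rises are exactly the digits.\<close>

lemma digit_count_slope_digits:
  assumes a: "\<And>i. 0 \<le> a i" "\<And>i. a i \<le> 1"
  shows "int (digit_count (slope_digits a) n) = \<lfloor>\<Sum>i<n. a i\<rfloor>"
proof (induction n)
  case (Suc n)
  let ?S = "slope_digits a"
  show ?case
  proof (cases "n \<in> ?S")
    case True
    then have "?S \<inter> {..<Suc n} = insert n (?S \<inter> {..<n})" by (auto simp: less_Suc_eq)
    then have "int (digit_count ?S (Suc n)) = \<lfloor>\<Sum>i<n. a i\<rfloor> + 1" using Suc by simp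
    also have "\<dots> = \<lfloor>\<Sum>i<Suc n. a i\<rfloor>"
    proof -
      have "(\<Sum>i<Suc n. a i) \<le> (\<Sum>i<n. a i) + 1" using a(2)[of n] by simp
      then have "\<lfloor>\<Sum>i<Suc n. a i\<rfloor> \<le> \<lfloor>\<Sum>i<n. a i\<rfloor> + 1" by linarith
      then show ?thesis using True by (simp add: slope_digits_def)
    qed
    finally show ?thesis .
  next
    case False
    then have "?S \<inter> {..<Suc n} = ?S \<inter> {..<n}" by (auto simp: less_Suc_eq)
    then have "int (digit_count ?S (Suc n)) = \<lfloor>\<Sum>i<n. a i\<rfloor>" using Suc by simp
    moreover have "\<lfloor>\<Sum>i<n. a i\<rfloor> \<le> \<lfloor>\<Sum>i<Suc n. a i\<rfloor>" using a(1)[of n] by (intro floor_mono) simp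
    ultimately show ?thesis using False by (simp add: slope_digits_def)
  qed
qed simp

lemma digit_count_slope_bounds:
  assumes a: "\<And>i. 0 \<le> a i" "\<And>i. a i \<le> 1"
  shows "real (digit_count (slope_digits a) n) \<le> (\<Sum>i<n. a i)"
    and "(\<Sum>i<n. a i) - 1 < real (digit_count (slope_digits a) n)"
proof -
  have "real (digit_count (slope_digits a) n) = of_int \<lfloor>\<Sum>i<n. a i\<rfloor>"
    using digit_count_slope_digits[of a n, OF a] by (metis of_int_of_nat_eq)
  then show "real (digit_count (slope_digits a) n) \<le> (\<Sum>i<n. a i)"
    and "(\<Sum>i<n. a i) - 1 < real (digit_count (slope_digits a) n)" by linarith+
qed

lemma digit_count_slope_diff_bounds:
  assumes a: "\<And>i. 0 \<le> a i" "\<And>i. a i \<le> 1" and nm: "n \<le> m"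
  shows "real (digit_count (slope_digits a) m) - real (digit_count (slope_digits a) n) \<le> (\<Sum>i=n..<m. a i) + 1"
    and "(\<Sum>i=n..<m. a i) - 1 \<le> real (digit_count (slope_digits a) m) - real (digit_count (slope_digits a) n)"
proof -
  have split: "(\<Sum>i<m. a i) = (\<Sum>i<n. a i) + (\<Sum>i=n..<m. a i)"
    using nm by (metis lessThan_atLeast0 sum.atLeastLessThan_concat zero_le)
  note b = digit_count_slope_bounds[of a n, OF a] digit_count_slope_bounds[of a m, OF a]
  show "real (digit_count (slope_digits a) m) - real (digit_count (slope_digits a) n) \<le> (\<Sum>i=n..<m. a i) + 1"
    using split b(2,3) by linarith
  show "(\<Sum>i=n..<m. a i) - 1 \<le> real (digit_count (slope_digits a) m) - real (digit_count (slope_digits a) n)"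
    using split b(1,4) by linarith
qed

lemma slope_digits_gap:
  assumes "\<And>i. i \<in> {n..<m} \<Longrightarrow> a i = 0"
  shows "slope_digits a \<inter> {n..<m} = {}"
  using assms by (auto simp: slope_digits_def)

text \<open>The square in the exponent makes quotients of consecutive starts unbounded; a geometric
  sequence would let earlier blocks influence the density at the end of a block.\<close>

definition block_start :: "nat \<Rightarrow> nat" where
  "block_start k = 2 ^ (k * k)"

definition zero_run :: "nat set" where
  "zero_run = (\<Union>k. {block_start k..<block_start k + 4})"

definition upper_run :: "nat set" where
  "upper_run = (\<Union>k. {block_start k + 4..<block_start k + 4 + k})"

definition lower_run :: "nat set" where
  "lower_run = (\<Union>k. {block_start k + 4 + k..<block_start k + 4 + 2 * k})"

definition special_run :: "nat set" where
  "special_run = (\<Union>k. {block_start k..<block_start k + 4 + 2 * k})"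

definition even_block :: "nat set" where
  "even_block = (\<Union>k. {block_start (2 * k)..<block_start (Suc (2 * k))})"

section \<open>Growth of the blocks and sparsity of the runs\<close>

lemma block_start_le: "j \<le> k \<Longrightarrow> block_start j \<le> block_start k"
  unfolding block_start_def by (intro power_increasing mult_le_mono) auto

lemma block_start_ge: "k \<le> block_start k"
proof -
  have "k \<le> k * k" by (cases k) auto
  also have "\<dots> < 2 ^ (k * k)" by (rule less_exp)
  finally show ?thesis by (simp add: block_start_def)
qed

lemma block_start_Suc_ge_double: "2 * block_start k \<le> block_start (Suc k)"
proof -
  have "(2::nat) ^ Suc (k * k) \<le> 2 ^ (Suc k * Suc k)" by (intro power_increasing) auto
  then show ?thesis by (simp add: block_start_def)
qed

text \<open>The runs fit into their block. Block 0 is excluded: it has length 1, less than its four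
  missing positions.\<close>

lemma block_start_Suc_ge:
  assumes "k \<ge> 1" shows "block_start k + 4 + 2 * k \<le> block_start (Suc k)"
proof -
  have "2 * k + 5 \<le> 2 ^ (2 * k + 1)" using assms by (induction k rule: nat_induct_at_least) auto
  then have "block_start k * (2 * k + 5) \<le> block_start k * 2 ^ (2 * k + 1)" by (rule mult_le_mono2)
  moreover have "block_start (Suc k) = block_start k * 2 ^ (2 * k + 1)"
    unfolding block_start_def power_add[symmetric] by (rule arg_cong[where f = "power 2"]) simp
  moreover have "block_start k * 1 + 1 * (2 * k + 4) \<le> block_start k * 1 + block_start k * (2 * k + 4)"
    by (intro add_left_mono mult_le_mono1) (simp add: block_start_def)
  ultimately show ?thesis by (simp add: algebra_simps)
qed

lemma real_block_start: "real (block_start k) = 2 powr (real k * real k)"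
  by (simp add: block_start_def powr_realpow flip: of_nat_mult)

lemma block_start_dominates:
  assumes "\<epsilon> > 0"
  shows "\<exists>k\<^sub>0. \<forall>k\<ge>k\<^sub>0. real (block_start k) + 4 * real k + 20 \<le> \<epsilon> * real (block_start (Suc k))"
proof -
  have "(\<lambda>k. (2 powr (real k * real k) + 4 * real k + 20) / 2 powr ((real k + 1) * (real k + 1))) \<longlonglongrightarrow> 0"
    by real_asymp
  then have "\<forall>\<^sub>F k in sequentially. (2 powr (real k * real k) + 4 * real k + 20) / 2 powr ((real k + 1) * (real k + 1)) < \<epsilon>"
    using assms by (rule order_tendstoD)
  then show ?thesis
    unfolding eventually_sequentially real_block_start by (auto simp: field_simps intro: less_imp_le)
qed

text \<open>The left side bounds the special positions of the blocks \<open>0, ..., q\<close>: there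
  are \<open>q + 1\<close> blocks with at most \<open>2 * q + 4\<close> such positions each. The
  constant \<open>C\<close> absorbs small \<open>q\<close>.\<close>

lemma block_start_quadratic:
  assumes "\<epsilon> > 0"
  shows "\<exists>C\<ge>0. \<forall>q. real ((q + 1) * (2 * q + 4)) \<le> \<epsilon> * real (block_start q) + C"
proof -
  have "(\<lambda>q. ((real q + 1) * (2 * real q + 4)) / 2 powr (real q * real q)) \<longlonglongrightarrow> 0"
    by real_asymp
  then have "\<forall>\<^sub>F q in sequentially. ((real q + 1) * (2 * real q + 4)) / 2 powr (real q * real q) < \<epsilon>"
    using assms by (rule order_tendstoD)
  then obtain q\<^sub>0 where q0: "\<And>q. q \<ge> q\<^sub>0 \<Longrightarrow> real ((q + 1) * (2 * q + 4)) \<le> \<epsilon> * real (block_start q)"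
    unfolding eventually_sequentially real_block_start by (auto simp: field_simps intro: less_imp_le)
  have "real ((q + 1) * (2 * q + 4)) \<le> \<epsilon> * real (block_start q) + real ((q\<^sub>0 + 1) * (2 * q\<^sub>0 + 4))" for q
  proof (cases "q \<ge> q\<^sub>0")
    case True
    then show ?thesis using q0[of q] by linarith
  next
    case False
    then have "(q + 1) * (2 * q + 4) \<le> (q\<^sub>0 + 1) * (2 * q\<^sub>0 + 4)" by (intro mult_le_mono) auto
    then have "real ((q + 1) * (2 * q + 4)) \<le> real ((q\<^sub>0 + 1) * (2 * q\<^sub>0 + 4))" by (simp only: of_nat_le_iff)
    moreover have "0 \<le> \<epsilon> * real (block_start q)" using assms by simp
    ultimately show ?thesis by linarith
  qed
  then show ?thesis by (intro exI[of _ "real ((q\<^sub>0 + 1) * (2 * q\<^sub>0 + 4))"]) simp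
qed

lemma card_special_run_le:
  assumes \<epsilon>: "\<epsilon> > 0"
  shows "\<exists>C\<ge>0. \<forall>n. real (card (special_run \<inter> {..<n})) \<le> \<epsilon> * real n + C"
proof -
  obtain C where C: "C \<ge> 0" "\<And>q. real ((q + 1) * (2 * q + 4)) \<le> \<epsilon> * real (block_start q) + C"
    using block_start_quadratic[OF \<epsilon>] by blast
  have "real (card (special_run \<inter> {..<n})) \<le> \<epsilon> * real n + C" for n
  proof -
    define J where "J = {k. block_start k < n}"
    have finJ: "finite J"
      unfolding J_def by (rule finite_subset[of _ "{..<n}"]) (auto intro: le_less_trans[OF block_start_ge])
    have sub: "special_run \<inter> {..<n} \<subseteq> (\<Union>k\<in>J. {block_start k..<block_start k + 4 + 2 * k})"
      by (force simp: special_run_def J_def)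
    show ?thesis
    proof (cases "J = {}")
      case True
      then show ?thesis using sub \<epsilon> C by simp
    next
      case False
      define q where "q = Max J"
      have q: "q \<in> J" "J \<subseteq> {..q}" using finJ False by (auto simp: q_def)
      have "card (special_run \<inter> {..<n}) \<le> card (\<Union>k\<in>J. {block_start k..<block_start k + 4 + 2 * k})"
        using finJ sub by (intro card_mono) auto
      also have "\<dots> \<le> (\<Sum>k\<in>J. card {block_start k..<block_start k + 4 + 2 * k})"
        using finJ by (rule card_UN_le)
      also have "\<dots> \<le> (\<Sum>k\<in>J. 2 * q + 4)" using q(2) by (intro sum_mono) auto
      also have "\<dots> = card J * (2 * q + 4)" by simp
      also have "card J \<le> card {..q}" using q(2) by (intro card_mono) auto
      then have "card J * (2 * q + 4) \<le> (q + 1) * (2 * q + 4)" by (intro mult_le_mono1) simp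
      finally have "real (card (special_run \<inter> {..<n})) \<le> real ((q + 1) * (2 * q + 4))" by (simp only: of_nat_le_iff)
      also have "\<dots> \<le> \<epsilon> * real (block_start q) + C" by (rule C)
      also have "\<dots> \<le> \<epsilon> * real n + C" using q(1) \<epsilon> by (simp add: J_def)
      finally show ?thesis .
    qed
  qed
  then show ?thesis using C(1) by blast
qed

text \<open>Uniform in the position of the window, as the Banach densities require.\<close>

lemma card_zero_run_le:
  assumes \<epsilon>: "\<epsilon> > 0"
  shows "\<exists>C. \<forall>n m. n \<le> m \<longrightarrow> real (card (zero_run \<inter> {n..<m})) \<le> \<epsilon> * (real m - real n) + C"
proof -
  obtain C where C: "C \<ge> 0" "\<And>q. real ((q + 1) * (2 * q + 4)) \<le> \<epsilon> / 2 * real (block_start q) + C"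
    using block_start_quadratic[of "\<epsilon> / 2"] \<epsilon> by auto
  have "real (card (zero_run \<inter> {n..<m})) \<le> \<epsilon> * (real m - real n) + (C + 4 + 4 * \<epsilon>)" if nm: "n \<le> m" for n m
  proof -
    define J where "J = {k. block_start k < m \<and> n < block_start k + 4}"
    have finJ: "finite J"
      unfolding J_def by (rule finite_subset[of _ "{..<m}"]) (auto intro: le_less_trans[OF block_start_ge])
    have sub: "zero_run \<inter> {n..<m} \<subseteq> (\<Union>k\<in>J. {block_start k..<block_start k + 4})"
      by (force simp: zero_run_def J_def)
    have "card (zero_run \<inter> {n..<m}) \<le> card (\<Union>k\<in>J. {block_start k..<block_start k + 4})"
      using finJ sub by (intro card_mono) auto
    also have "\<dots> \<le> (\<Sum>k\<in>J. card {block_start k..<block_start k + 4})"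
      using finJ by (rule card_UN_le)
    also have "\<dots> = 4 * card J" by simp
    finally have card: "card (zero_run \<inter> {n..<m}) \<le> 4 * card J" .
    have nonneg: "0 \<le> \<epsilon> * (real m - real n)" using \<epsilon> nm by simp
    show ?thesis
    proof (cases "\<exists>p q. p \<in> J \<and> q \<in> J \<and> p < q")
      case False
      \<comment> \<open>A window meeting at most one run contains at most four missing positions,
        whatever its place.\<close>
      then have "card J \<le> 1" using finJ by (metis card_le_Suc0_iff_eq One_nat_def nat_neq_iff)
      then have "real (card (zero_run \<inter> {n..<m})) \<le> 4" using card by linarith
      then show ?thesis using nonneg C(1) \<epsilon> by linarith
    next
      case True
      define q where "q = Max J"
      have ne: "J \<noteq> {}" using True by auto
      have q: "q \<in> J" "J \<subseteq> {..q}" using finJ ne by (auto simp: q_def)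
      obtain p where p: "p \<in> J" "p < q" using True q(2) by (metis atMost_iff less_le_trans subsetD)
      obtain q' where q': "q = Suc q'" using p by (cases q) auto
      \<comment> \<open>Two runs meet the window. As block starts at least double, the window is
        about half as long as \<open>block_start q\<close> or longer, and this length absorbs the
        quadratic count.\<close>
      have "2 * block_start p \<le> 2 * block_start q'" using p q' by (intro mult_le_mono2 block_start_le) simp
      also have "\<dots> \<le> block_start q" using block_start_Suc_ge_double[of q'] q' by simp
      finally have "2 * block_start p \<le> block_start q" .
      moreover have "block_start q < m" "n < block_start p + 4" using q(1) p(1) by (auto simp: J_def)
      ultimately have "2 * real (block_start p) \<le> real (block_start q)"
        "real (block_start q) \<le> real m" "real n \<le> real (block_start p) + 4" by simp_all
      then have "real (block_start q) \<le> 2 * (real m - real n) + 8" unfolding right_diff_distrib by linarith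
      then have "\<epsilon> / 2 * real (block_start q) \<le> \<epsilon> / 2 * (2 * (real m - real n) + 8)"
        using \<epsilon> by (intro mult_left_mono) auto
      also have "\<dots> = \<epsilon> * (real m - real n) + 4 * \<epsilon>" by (simp add: algebra_simps)
      finally have *: "\<epsilon> / 2 * real (block_start q) \<le> \<epsilon> * (real m - real n) + 4 * \<epsilon>" .
      have "card J \<le> card {..q}" using q(2) by (intro card_mono) auto
      then have "4 * card J \<le> (q + 1) * (2 * q + 4)" by (simp add: algebra_simps)
      then have "card (zero_run \<inter> {n..<m}) \<le> (q + 1) * (2 * q + 4)" using card by linarith
      then have "real (card (zero_run \<inter> {n..<m})) \<le> real ((q + 1) * (2 * q + 4))" by (simp only: of_nat_le_iff)
      also have "\<dots> \<le> \<epsilon> / 2 * real (block_start q) + C" by (rule C)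
      finally show ?thesis using * by linarith
    qed
  qed
  then show ?thesis by blast
qed

lemma not_special_run:
  assumes "i \<in> {block_start k + 4 + 2 * k..<block_start (Suc k)}"
  shows "i \<notin> special_run"
proof
  assume "i \<in> special_run"
  then obtain j where j: "block_start j \<le> i" "i < block_start j + 4 + 2 * j" by (auto simp: special_run_def)
  show False
  proof (cases "j \<le> k")
    case True
    then show False using block_start_le[OF True] j assms by auto
  next
    case False
    then show False using block_start_le[of "Suc k" j] j assms by auto
  qed
qed

lemma even_block_iff:
  assumes "i \<in> {block_start k..<block_start (Suc k)}"
  shows "i \<in> even_block \<longleftrightarrow> even k"
proof
  assume "i \<in> even_block"
  then obtain j where j: "block_start (2 * j) \<le> i" "i < block_start (Suc (2 * j))" by (auto simp: even_block_def)
  have "\<not> 2 * j < k" using block_start_le[of "Suc (2 * j)" k] j assms by auto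
  moreover have "\<not> k < 2 * j" using block_start_le[of "Suc k" "2 * j"] j assms by auto
  ultimately show "even k" by (metis dvd_triv_left nat_neq_iff)
next
  assume "even k"
  then obtain j where "k = 2 * j" by blast
  then show "i \<in> even_block" using assms by (auto simp: even_block_def)
qed

lemma upper_run_not_zero_run:
  assumes k: "k \<ge> 1" and i: "i \<in> {block_start k + 4..<block_start k + 4 + 2 * k}"
  shows "i \<notin> zero_run"
proof
  assume "i \<in> zero_run"
  then obtain j where j: "block_start j \<le> i" "i < block_start j + 4" by (auto simp: zero_run_def)
  show False
  proof (cases "j \<le> k")
    case True
    then show False using block_start_le[OF True] j i by auto
  next
    case False
    then show False using block_start_le[of "Suc k" j] block_start_Suc_ge[OF k] j i by auto
  qed
qed

lemma lower_run_not_upper_run: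
  assumes k: "k \<ge> 1" and i: "i \<in> {block_start k + 4 + k..<block_start k + 4 + 2 * k}"
  shows "i \<notin> upper_run"
proof
  assume "i \<in> upper_run"
  then obtain j where j: "block_start j + 4 \<le> i" "i < block_start j + 4 + j" by (auto simp: upper_run_def)
  show False
  proof (cases "j \<le> k")
    case True
    then show False using block_start_le[OF True] j i by auto
  next
    case False
    then show False using block_start_le[of "Suc k" j] block_start_Suc_ge[OF k] j i by auto
  qed
qed

lemma sum_indicator_card: "finite B \<Longrightarrow> (\<Sum>i\<in>B. indicator A i) = real (card (A \<inter> B))"
  by (simp add: indicator_def sum.If_cases Int_commute)

lemma runs_subset_special_run:
  "zero_run \<subseteq> special_run" "upper_run \<subseteq> special_run" "lower_run \<subseteq> special_run"
  unfolding zero_run_def upper_run_def lower_run_def special_run_def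
  by (intro UN_mono order_refl; auto)+

section \<open>The digit set for given parameters\<close>

locale dimension_parameters =
  fixes t_L t_H t_P t_A :: real
  assumes order: "0 \<le> t_L" "t_L \<le> t_H" "t_H \<le> t_P" "t_P \<le> t_A" "t_A \<le> 1"
begin

text \<open>
  Long blocks of slope \<open>t_H\<close> and \<open>t_P\<close> alternate and fix the densities; each starts with much
  shorter but unboundedly long runs of slope \<open>t_A\<close> and \<open>t_L\<close>, which only affect the Banach
  densities, and with the four missing positions needed for spectrality. The value at \<open>0\<close> keeps the
  digit set nonempty, so that the support has positive diameter.
\<close>

definition slope :: "nat \<Rightarrow> real" where
  "slope i = (if i = 0 then 1 else if i \<in> zero_run then 0 else if i \<in> upper_run then t_A
     else if i \<in> lower_run then t_L else if i \<in> even_block then t_H else t_P)"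

definition digits :: "nat set" where
  "digits = slope_digits slope"

lemma slope_nonneg: "0 \<le> slope i" and slope_le_1: "slope i \<le> 1"
  using order by (auto simp: slope_def)

lemmas slope_bounds = digit_count_slope_bounds[of slope, OF slope_nonneg slope_le_1, folded digits_def]

lemmas slope_diff_bounds =
  digit_count_slope_diff_bounds[of slope, OF slope_nonneg slope_le_1, folded digits_def]

lemma digits_nonempty: "digits \<noteq> {}"
proof -
  have "0 \<in> digits" by (simp add: digits_def slope_digits_def slope_def)
  then show ?thesis by auto
qed

lemma digits_gap: "\<exists>n\<ge>m. digits \<inter> {n..<n + 4} = {}"
proof (intro exI conjI)
  show "m \<le> block_start m" by (rule block_start_ge)
  show "digits \<inter> {block_start m..<block_start m + 4} = {}"
    unfolding digits_def
  proof (rule slope_digits_gap)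
    fix i assume i: "i \<in> {block_start m..<block_start m + 4}"
    moreover have "block_start m > 0" by (simp add: block_start_def)
    ultimately show "slope i = 0" by (auto simp: slope_def zero_run_def)
  qed
qed

lemma digits_diff_le:
  assumes "n \<le> m"
  shows "real (digit_count digits m) - real (digit_count digits n) \<le> t_A * (real m - real n) + 2"
proof -
  \<comment> \<open>Position 0 has slope 1, possibly above \<open>t_A\<close>; this and the integer
    part make up the constant 2.\<close>
  have "(\<Sum>i=n..<m. slope i) \<le> (\<Sum>i=n..<m. t_A + (if i = 0 then 1 else 0))"
    using order by (intro sum_mono) (auto simp: slope_def)
  also have "\<dots> \<le> t_A * (real m - real n) + 1"
    using assms by (simp add: sum.distrib of_nat_diff mult.commute)
  finally show ?thesis using slope_diff_bounds(1)[OF assms] by linarith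
qed

lemma digits_diff_ge:
  assumes "n \<le> m"
  shows "real (digit_count digits m) - real (digit_count digits n)
    \<ge> t_L * (real m - real n) - real (card (zero_run \<inter> {n..<m})) - 1"
proof -
  have "t_L * (real m - real n) - real (card (zero_run \<inter> {n..<m}))
      = (\<Sum>i=n..<m. t_L - indicator zero_run i)"
    unfolding sum_subtractf sum_indicator_card[OF finite_atLeastLessThan]
    using assms by (simp add: of_nat_diff)
  also have "\<dots> \<le> (\<Sum>i=n..<m. slope i)"
    using order by (intro sum_mono) (auto simp: slope_def indicator_def)
  finally show ?thesis using slope_diff_bounds(2)[OF assms] by linarith
qed

lemma digits_upper_run: "\<exists>n\<ge>n\<^sub>0. real (digit_count digits (n + k)) - real (digit_count digits n) \<ge> t_A * real k - 1"
proof (intro exI conjI)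
  \<comment> \<open>Block \<open>K\<close> starts beyond \<open>n\<^sub>0\<close>, its run has
    length at least \<open>k\<close>, and \<open>K \<ge> 1\<close> keeps the runs inside the
    block.\<close>
  define K where "K = max n\<^sub>0 (max k 1)"
  have K: "n\<^sub>0 \<le> K" "k \<le> K" "1 \<le> K" by (auto simp: K_def)
  show "n\<^sub>0 \<le> block_start K + 4" using block_start_ge[of K] K by simp
  have "slope i = t_A" if "i \<in> {block_start K + 4..<block_start K + 4 + k}" for i
  proof -
    have "i \<notin> zero_run" using that K by (intro upper_run_not_zero_run[of K]) auto
    moreover have "i \<in> upper_run" using that K by (auto simp: upper_run_def intro!: exI[of _ K])
    ultimately show ?thesis using that by (auto simp: slope_def)
  qed
  then have "(\<Sum>i=block_start K + 4..<block_start K + 4 + k. slope i) = t_A * real k" by simp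
  then show "t_A * real k - 1 \<le> real (digit_count digits (block_start K + 4 + k)) - real (digit_count digits (block_start K + 4))"
    using slope_diff_bounds(2)[of "block_start K + 4" "block_start K + 4 + k"] by simp
qed

lemma digits_lower_run: "\<exists>n\<ge>n\<^sub>0. real (digit_count digits (n + k)) - real (digit_count digits n) \<le> t_L * real k + 1"
proof (intro exI conjI)
  define K where "K = max n\<^sub>0 (max k 1)"
  have K: "n\<^sub>0 \<le> K" "k \<le> K" "1 \<le> K" by (auto simp: K_def)
  let ?n = "block_start K + 4 + K"
  show "n\<^sub>0 \<le> ?n" using K by simp
  have "slope i = t_L" if "i \<in> {?n..<?n + k}" for i
  proof -
    have "i \<notin> zero_run" using that K by (intro upper_run_not_zero_run[of K]) auto
    moreover have "i \<notin> upper_run" using that K by (intro lower_run_not_upper_run[of K]) auto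
    moreover have "i \<in> lower_run" using that K by (auto simp: lower_run_def intro!: exI[of _ K])
    ultimately show ?thesis using that by (auto simp: slope_def)
  qed
  then have "(\<Sum>i=?n..<?n + k. slope i) = t_L * real k" by simp
  then show "real (digit_count digits (?n + k)) - real (digit_count digits ?n) \<le> t_L * real k + 1"
    using slope_diff_bounds(1)[of ?n "?n + k"] by simp
qed

lemma digits_count_ge: "t_H * real n - real (card (special_run \<inter> {..<n})) - 1 \<le> real (digit_count digits n)"
proof -
  have "t_H * real n - real (card (special_run \<inter> {..<n})) = (\<Sum>i<n. t_H - indicator special_run i)"
    unfolding sum_subtractf sum_indicator_card[OF finite_lessThan] by simp
  also have "\<dots> \<le> (\<Sum>i<n. slope i)"
    using order runs_subset_special_run by (intro sum_mono) (auto simp: slope_def indicator_def)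
  finally show ?thesis using slope_bounds(2)[of n] by linarith
qed

lemma digits_count_le: "real (digit_count digits n) \<le> t_P * real n + real (card (special_run \<inter> {..<n})) + 1"
proof -
  have "(\<Sum>i<n. slope i) \<le> (\<Sum>i<n. t_P + indicator special_run i + (if i = 0 then 1 else 0))"
    using order runs_subset_special_run by (intro sum_mono) (auto simp: slope_def indicator_def)
  also have "\<dots> \<le> t_P * real n + real (card (special_run \<inter> {..<n})) + 1"
    unfolding sum.distrib sum_indicator_card[OF finite_lessThan] by simp
  finally show ?thesis using slope_bounds(1)[of n] by linarith
qed

lemma digits_density_ge:
  assumes "s < t_H"
  shows "\<exists>n\<^sub>0. \<forall>n\<ge>n\<^sub>0. real (digit_count digits n) \<ge> s * real n"
proof -
  \<comment> \<open>One \<open>e\<close> pays for the special runs, the other absorbs the constant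
    \<open>C + 1\<close> for large \<open>n\<close>.\<close>
  define e where "e = (t_H - s) / 2"
  have e: "e > 0" using assms by (simp add: e_def)
  obtain C where C: "\<And>n. real (card (special_run \<inter> {..<n})) \<le> e * real n + C"
    using card_special_run_le[OF e] by blast
  obtain n\<^sub>0 where n0: "(C + 1) / e < real n\<^sub>0" using reals_Archimedean2 by blast
  have "real (digit_count digits n) \<ge> s * real n" if "n \<ge> n\<^sub>0" for n
  proof -
    have "real n\<^sub>0 \<le> real n" using that by simp
    with n0 have "(C + 1) / e \<le> real n" by linarith
    then have "C + 1 \<le> e * real n" using e by (simp add: field_simps)
    moreover have "2 * e = t_H - s" by (simp add: e_def)
    then have "t_H * real n - 2 * (e * real n) = s * real n"
      by (simp add: left_diff_distrib flip: mult.assoc)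
    ultimately show ?thesis using digits_count_ge[of n] C[of n] by linarith
  qed
  then show ?thesis by blast
qed

lemma digits_density_le:
  assumes "t_P < s"
  shows "\<exists>n\<^sub>0. \<forall>n\<ge>n\<^sub>0. real (digit_count digits n) \<le> s * real n"
proof -
  define e where "e = (s - t_P) / 2"
  have e: "e > 0" using assms by (simp add: e_def)
  obtain C where C: "\<And>n. real (card (special_run \<inter> {..<n})) \<le> e * real n + C"
    using card_special_run_le[OF e] by blast
  obtain n\<^sub>0 where n0: "(C + 1) / e < real n\<^sub>0" using reals_Archimedean2 by blast
  have "real (digit_count digits n) \<le> s * real n" if "n \<ge> n\<^sub>0" for n
  proof -
    have "real n\<^sub>0 \<le> real n" using that by simp
    with n0 have "(C + 1) / e \<le> real n" by linarith
    then have "C + 1 \<le> e * real n" using e by (simp add: field_simps)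
    moreover have "2 * e = s - t_P" by (simp add: e_def)
    then have "t_P * real n + 2 * (e * real n) = s * real n"
      by (simp add: left_diff_distrib flip: mult.assoc)
    ultimately show ?thesis using digits_count_le[of n] C[of n] by linarith
  qed
  then show ?thesis by blast
qed

lemma slope_ordinary:
  assumes "k \<ge> 1" "i \<in> {block_start k + 4 + 2 * k..<block_start (Suc k)}"
  shows "slope i = (if even k then t_H else t_P)"
  using assms not_special_run[OF assms(2)] even_block_iff[of i k] runs_subset_special_run
  by (auto simp: slope_def)

text \<open>Everything before the ordinary part of block \<open>k\<close> is estimated trivially,
  with slopes between 0 and 1; it is short compared with the block.\<close>

lemma sum_slope_block:
  assumes "k \<ge> 1"
  defines "u \<equiv> (if even k then t_H else t_P)"
  shows "(\<Sum>i<block_start (Suc k). slope i) \<le> real (block_start k + 4 + 2 * k) + u * real (block_start (Suc k))"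
    and "(\<Sum>i<block_start (Suc k). slope i) \<ge> u * real (block_start (Suc k)) - real (block_start k + 4 + 2 * k)"
proof -
  let ?b = "block_start k + 4 + 2 * k" and ?e = "block_start (Suc k)"
  have be: "?b \<le> ?e" using assms by (intro block_start_Suc_ge)
  have u: "0 \<le> u" "u \<le> 1" using order by (auto simp: u_def)
  have split: "(\<Sum>i<?e. slope i) = (\<Sum>i<?b. slope i) + (\<Sum>i=?b..<?e. slope i)"
    using be by (metis lessThan_atLeast0 sum.atLeastLessThan_concat zero_le)
  have "(\<Sum>i=?b..<?e. slope i) = (\<Sum>i=?b..<?e. u)"
    unfolding u_def using assms by (intro sum.cong refl slope_ordinary) auto
  also have "\<dots> = u * (real ?e - real ?b)" using be by (simp add: of_nat_diff mult.commute del: of_nat_add)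
  finally have main: "(\<Sum>i=?b..<?e. slope i) = u * (real ?e - real ?b)" .
  have "(\<Sum>i<?b. slope i) \<le> (\<Sum>i<?b. 1)" by (intro sum_mono slope_le_1)
  then have upper: "(\<Sum>i<?b. slope i) \<le> real ?b" by simp
  have lower: "0 \<le> (\<Sum>i<?b. slope i)" by (intro sum_nonneg slope_nonneg)
  define b where "b = real ?b"
  have "0 \<le> b" by (simp add: b_def)
  then have "u * b \<le> b" "0 \<le> u * b" using u by (auto intro: mult_left_le_one_le)
  then show "(\<Sum>i<?e. slope i) \<le> real ?b + u * real ?e" "(\<Sum>i<?e. slope i) \<ge> u * real ?e - real ?b"
    using split main upper lower unfolding b_def[symmetric] right_diff_distrib by linarith+
qed

lemma digits_lower_density:
  assumes "t_H < s"
  shows "\<exists>n\<ge>n\<^sub>0. real (digit_count digits n) \<le> s * real n"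
proof -
  obtain k\<^sub>0 where k0: "\<And>k. k \<ge> k\<^sub>0 \<Longrightarrow> real (block_start k) + 4 * real k + 20 \<le> (s - t_H) * real (block_start (Suc k))"
    using block_start_dominates[of "s - t_H"] assms by auto
  \<comment> \<open>An even block has ordinary slope \<open>t_H\<close>; its end is a scale of low
    density.\<close>
  define k where "k = 2 * (k\<^sub>0 + n\<^sub>0 + 1)"
  have k: "even k" "k \<ge> k\<^sub>0" "k \<ge> n\<^sub>0" "k \<ge> 1" by (auto simp: k_def)
  have "real (digit_count digits (block_start (Suc k))) \<le> real (block_start k + 4 + 2 * k) + t_H * real (block_start (Suc k))"
    using slope_bounds(1)[of "block_start (Suc k)"] sum_slope_block(1)[OF k(4)] k(1) by simp
  also have "\<dots> \<le> s * real (block_start (Suc k))" using k0[OF k(2)] by (simp add: left_diff_distrib)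
  finally show ?thesis using block_start_ge[of "Suc k"] k(3) by (intro exI[of _ "block_start (Suc k)"]) simp
qed

lemma digits_upper_density:
  assumes "s < t_P"
  shows "\<exists>n\<ge>n\<^sub>0. real (digit_count digits n) \<ge> s * real n"
proof -
  obtain k\<^sub>0 where k0: "\<And>k. k \<ge> k\<^sub>0 \<Longrightarrow> real (block_start k) + 4 * real k + 20 \<le> (t_P - s) * real (block_start (Suc k))"
    using block_start_dominates[of "t_P - s"] assms by auto
  \<comment> \<open>An odd block has ordinary slope \<open>t_P\<close>; its end is a scale of high
    density.\<close>
  define k where "k = 2 * (k\<^sub>0 + n\<^sub>0) + 1"
  have k: "odd k" "k \<ge> k\<^sub>0" "k \<ge> n\<^sub>0" "k \<ge> 1" by (auto simp: k_def)
  have "s * real (block_start (Suc k)) \<le> t_P * real (block_start (Suc k)) - real (block_start k + 4 + 2 * k) - 1"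
    using k0[OF k(2)] by (simp add: left_diff_distrib)
  also have "\<dots> \<le> real (digit_count digits (block_start (Suc k)))"
    using slope_bounds(2)[of "block_start (Suc k)"] sum_slope_block(2)[OF k(4)] k(1) by simp
  finally show ?thesis using block_start_ge[of "Suc k"] k(3) by (intro exI[of _ "block_start (Suc k)"]) simp
qed

text \<open>The gaps have slope 0, below \<open>t_L\<close>, so the lower bound is obtained for
  \<open>t_L - e\<close> with a constant depending on \<open>e\<close>. When that is not positive,
  exponent 0 serves, as \<open>lower_dim_ge\<close> requires a nonnegative one.\<close>

lemma lower_dim_digits: "lower_dim (digit_measure digits) = ereal t_L"
proof (rule antisym)
  show "lower_dim (digit_measure digits) \<le> ereal t_L"
    using digits_lower_run by (intro lower_dim_le[where C = 1] digits_nonempty) auto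
  show "ereal t_L \<le> lower_dim (digit_measure digits)"
  proof (rule ereal_le_epsilon2)
    fix e :: real assume e: "0 < e"
    show "ereal t_L \<le> lower_dim (digit_measure digits) + ereal e"
    proof (cases "t_L \<le> e")
      case True
      have "ereal 0 \<le> lower_dim (digit_measure digits)"
        by (rule lower_dim_ge[where C = 0]) (use digit_count_mono in auto)
      then have "ereal 0 + ereal e \<le> lower_dim (digit_measure digits) + ereal e" by (rule add_right_mono)
      then show ?thesis using True by (metis add_0 ereal_less_eq(3) order_trans zero_ereal_def)
    next
      case False
      obtain C where C: "\<And>n m. n \<le> m \<Longrightarrow> real (card (zero_run \<inter> {n..<m})) \<le> e * (real m - real n) + C"
        using card_zero_run_le[OF e] by blast
      have "ereal (t_L - e) \<le> lower_dim (digit_measure digits)"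
      proof (rule lower_dim_ge[where C = "C + 1"])
        fix n m :: nat assume "n \<le> m"
        then show "(t_L - e) * (real m - real n) - (C + 1)
            \<le> real (digit_count digits m) - real (digit_count digits n)"
          using digits_diff_ge[of n m] C[of n m] by (simp add: left_diff_distrib)
      qed (use False in simp)
      then have "ereal (t_L - e) + ereal e \<le> lower_dim (digit_measure digits) + ereal e" by (rule add_right_mono)
      then show ?thesis by simp
    qed
  qed
qed

lemma hausdorff_dim_digits: "measure_hausdorff_dim (digit_measure digits) = ereal t_H"
  using order digits_density_ge digits_lower_density
  by (intro antisym measure_hausdorff_dim_le measure_hausdorff_dim_ge) auto

lemma packing_dim_digits: "measure_packing_dim (digit_measure digits) = ereal t_P"
  using order digits_density_le digits_upper_density
  by (intro antisym measure_packing_dim_le measure_packing_dim_ge) auto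

lemma assouad_dim_digits: "assouad_dim (digit_measure digits) = ereal t_A"
  using order digits_diff_le digits_upper_run
  by (intro antisym assouad_dim_le[where C = 2] assouad_dim_ge[where C = 1] digits_nonempty) auto

end

theorem theorem1p2:
  fixes t_L t_H t_P t_A :: real
  assumes "0 \<le> t_L" and "t_L \<le> t_H" and "t_H \<le> t_P" and "t_P \<le> t_A" and "t_A \<le> 1"
  shows "\<exists>\<mu> :: real measure. spectral_measure \<mu> \<and>
           lower_dim \<mu> = ereal t_L \<and>
           measure_hausdorff_dim \<mu> = ereal t_H \<and>
           measure_packing_dim \<mu> = ereal t_P \<and>
           assouad_dim \<mu> = ereal t_A"
proof -
  interpret dimension_parameters t_L t_H t_P t_A by unfold_locales fact+
  show ?thesis
    using spectral_digit_measure[OF digits_gap] lower_dim_digits hausdorff_dim_digits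
      packing_dim_digits assouad_dim_digits by blast
qed

end
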